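(* Let $T$ be a tree with $m\geq 1$ edges and let $k\geq 3$ be an integer. Then: (i) $f_k(n,T)=\Omega(n^{k/(k-1)})$. Moreover, if $T$ has at least two edges, then $f_3(n,T)=\Theta(n^{3/2})$. (ii) $f_k(n,T)=\Omega(n^{(m+1)/m})$, and there exists an integer $k'$ such that $f_{k'}(n,T)=O(n^{(m+1)/m})$.
   Context: All colourings are edge-colourings of the complete graph $K_n$; a colouring is proper if any two edges sharing a vertex receive different colours. Two copies of a graph $H$ in an edge-coloured $K_n$ are colour isomorphic if there is a graph isomorphism between them mapping each edge to an edge of the same colour. A $k$-repeat of $H$ is a collection of $k$ pairwise vertex-disjoint, pairwise colour-isomorphic copies of $H$. For integers $k,n\geq 2$ and a graph $H$, $f_k(n,H)$ is the smallest integer $C$ such that there is a proper edge-colouring of $K_n$ with $C$ colours containing no $k$-repeat of $H$. Asymptotic notation is with respect to $n\to\infty$ with $T,k,k'$ fixed. *)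

theory Defs
  imports "HOL-Library.Landau_Symbols" "HOL-Library.FuncSet" "HOL-Library.Disjoint_Sets"
begin

text \<open>A simple graph is a vertex set together with a set of two-element sets of vertices.\<close>

type_synonym 'a graph = "'a set \<times> 'a set set"

abbreviation verts :: "'a graph \<Rightarrow> 'a set" where "verts \<equiv> fst"
abbreviation edges :: "'a graph \<Rightarrow> 'a set set" where "edges \<equiv> snd"

definition all_edges :: "'a set \<Rightarrow> 'a set set" where
  "all_edges V = {e. e \<subseteq> V \<and> card e = 2}"

definition finite_graph :: "'a graph \<Rightarrow> bool" where
  "finite_graph G \<longleftrightarrow> finite (verts G) \<and> edges G \<subseteq> all_edges (verts G)"

definition connected_graph :: "'a graph \<Rightarrow> bool" where
  "connected_graph G \<longleftrightarrow> verts G \<noteq> {} \<and>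
     (\<forall>u\<in>verts G. \<forall>v\<in>verts G. (u, v) \<in> {(x, y). {x, y} \<in> edges G}\<^sup>*)"

text \<open>A cycle is the list of its vertices in cyclic order, without repeating the first one.\<close>

definition is_cycle :: "'a graph \<Rightarrow> 'a list \<Rightarrow> bool" where
  "is_cycle G vs \<longleftrightarrow> length vs \<ge> 3 \<and> distinct vs \<and>
     (\<forall>i<length vs. {vs ! i, vs ! (Suc i mod length vs)} \<in> edges G)"

definition is_tree :: "'a graph \<Rightarrow> bool" where
  "is_tree G \<longleftrightarrow> finite_graph G \<and> connected_graph G \<and> (\<nexists>vs. is_cycle G vs)"

definition graph_iso :: "('a \<Rightarrow> 'b) \<Rightarrow> 'a graph \<Rightarrow> 'b graph \<Rightarrow> bool" where
  "graph_iso \<phi> G H \<longleftrightarrow> bij_betw \<phi> (verts G) (verts H) \<and>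
     (\<forall>u\<in>verts G. \<forall>v\<in>verts G. {u, v} \<in> edges G \<longleftrightarrow> {\<phi> u, \<phi> v} \<in> edges H)"

definition complete_graph :: "nat \<Rightarrow> nat graph" where
  "complete_graph n = ({..<n}, all_edges {..<n})"

definition subgraph :: "'a graph \<Rightarrow> 'a graph \<Rightarrow> bool" where
  "subgraph G H \<longleftrightarrow> finite_graph G \<and> verts G \<subseteq> verts H \<and> edges G \<subseteq> edges H"

definition copy_of :: "'a graph \<Rightarrow> nat \<Rightarrow> nat graph \<Rightarrow> bool" where
  "copy_of H n G \<longleftrightarrow> subgraph G (complete_graph n) \<and> (\<exists>\<phi>. graph_iso \<phi> H G)"

text \<open>Colours are the numbers below \<open>C\<close>. Not every colour has to be used; this does not
  affect the minimum in \<open>repeat_number\<close> below.\<close>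

definition proper_colouring :: "nat \<Rightarrow> nat \<Rightarrow> (nat set \<Rightarrow> nat) \<Rightarrow> bool" where
  "proper_colouring n C c \<longleftrightarrow> c \<in> edges (complete_graph n) \<rightarrow> {..<C} \<and>
     (\<forall>e\<in>edges (complete_graph n). \<forall>e'\<in>edges (complete_graph n).
        e \<noteq> e' \<and> e \<inter> e' \<noteq> {} \<longrightarrow> c e \<noteq> c e')"

definition colour_isomorphic :: "('a set \<Rightarrow> nat) \<Rightarrow> 'a graph \<Rightarrow> 'a graph \<Rightarrow> bool" where
  "colour_isomorphic c G H \<longleftrightarrow>
     (\<exists>\<phi>. graph_iso \<phi> G H \<and> (\<forall>e\<in>edges G. c (\<phi> ` e) = c e))"

definition is_repeat ::
  "nat \<Rightarrow> 'a graph \<Rightarrow> nat \<Rightarrow> (nat set \<Rightarrow> nat) \<Rightarrow> nat graph set \<Rightarrow> bool" where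
  "is_repeat k H n c S \<longleftrightarrow> finite S \<and> card S = k \<and> (\<forall>G\<in>S. copy_of H n G) \<and>
     disjoint_family_on verts S \<and> pairwise (colour_isomorphic c) S"

text \<open>\<open>repeat_number k n H\<close> is $f_k(n,H)$. For \<open>k \<ge> 2\<close> and \<open>H\<close> with at least one edge, giving all
  edges distinct colours avoids every \<open>k\<close>-repeat, so the minimum is attained.\<close>

definition repeat_number :: "nat \<Rightarrow> nat \<Rightarrow> 'a graph \<Rightarrow> nat" where
  "repeat_number k n H =
     (LEAST C. \<exists>c. proper_colouring n C c \<and> (\<nexists>S. is_repeat k H n c S))"

end

theory Submission
  imports Defs "HOL-Library.Function_Algebras"
    "HOL-Algebra.Algebraic_Closure_Type" "Berlekamp_Zassenhaus.Finite_Field"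
begin

text \<open>
  Lower bounds, for a proper colouring with \<open>C\<close> colours. For the exponent \<open>(m + 1) / m\<close>: some colour
  pattern is shared by at least about \<open>n^(m + 1) / C^m\<close> embeddings of \<open>T\<close>. An embedding is determined by its
  pattern and the image of one vertex, so each embedding meets boundedly many others with the same
  pattern, and \<open>k\<close> disjoint ones can be chosen greedily. For the exponent \<open>k / (k - 1)\<close>: call two
  \<open>k\<close>-tuples of vertices adjacent if the \<open>k\<close> edges joining corresponding entries have the same colour.
  By convexity the average degree of this graph is at least about \<open>n^k / C^(k - 1)\<close>; if it is large, then
  \<open>T\<close> embeds greedily into a subgraph of large minimum degree, which yields a \<open>k\<close>-repeat.

  Upper bounds. Place the vertices in a suitable part of the field with \<open>q^m\<close> elements, where \<open>q\<close> is a
  power of 3, and let \<open>N\<close> be the norm to the field with \<open>q\<close> elements. The edge \<open>xy\<close> with smaller endpoint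
  \<open>x\<close> gets the colour \<open>(x + y, N(x^2 - g(x + y)))\<close>, where \<open>g\<close> maps the sums injectively to nonsquares.
  In copies of \<open>T\<close> with the same colours the first components express all vertices as \<open>\<plusminus>(x + a)\<close> in
  terms of the image \<open>x\<close> of a root. The second components then say that \<open>N((x + a)^2 - g) = t\<close> for \<open>m\<close>
  pairwise coprime quadratics: a common root of two of them would lie in the field, although \<open>g\<close> is
  not a square. Such a system has boundedly many solutions, by an argument in the spirit of the
  norm graphs of Kollar, Ronyai and Szabo. For \<open>k = 3\<close> take \<open>m = 2\<close> and the colour \<open>(x + y, N(x - y))\<close>,
  that is, the circle with diameter \<open>xy\<close>: the centre of a cherry lies on two different circles, and
  these meet in at most two points.
\<close>

section \<open>Trees and repeats\<close>

lemma card_injections_ge: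
  assumes "finite A" "finite B"
  shows "(card B - card A) ^ card A \<le> card {f \<in> A \<rightarrow>\<^sub>E B. inj_on f A}"
proof -
  have "(card B - card A) ^ card A = (\<Prod>i\<in>{0..<card A}. card B - card A)" by simp
  also have "\<dots> \<le> prod ((-) (card B)) {0..<card A}" by (intro prod_mono) auto
  also have "\<dots> = card {f \<in> A \<rightarrow>\<^sub>E B. inj_on f A}"
    using card_inj_on_subset_funcset[of A B A] assms by simp
  finally show ?thesis .
qed

section \<open>Trees as sequences of leaf attachments\<close>

text \<open>Rule induction on leaf attachments serves as induction on trees: rigidity of embeddings
  and greedy embedding into tuples both proceed one leaf at a time.\<close>

inductive grows :: "'a set \<Rightarrow> 'a set set \<Rightarrow> bool" where
  single: "grows {v} {}"
| extend: "grows U F \<Longrightarrow> u \<in> U \<Longrightarrow> w \<notin> U \<Longrightarrow> grows (insert w U) (insert {u, w} F)"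

lemma grows_facts:
  assumes "grows U F"
  shows "finite U \<and> U \<noteq> {} \<and> finite F \<and> F \<subseteq> all_edges U \<and> card U = Suc (card F)"
  using assms
proof (induction rule: grows.induct)
  case (extend U F u w)
  then have "{u, w} \<notin> F" "u \<noteq> w" by (auto simp: all_edges_def)
  with extend show ?case by (auto simp: all_edges_def)
qed (simp add: all_edges_def)

text \<open>Used for the cycle in \<open>tree_grows\<close>: a path with distinct vertices closes up
  through an outside vertex joined to both of its ends.\<close>

lemma grows_path:
  assumes "grows U F" "x \<in> U" "y \<in> U"
  shows "\<exists>xs. xs \<noteq> [] \<and> hd xs = x \<and> last xs = y \<and> distinct xs \<and> set xs \<subseteq> U \<and>
    successively (\<lambda>a b. {a, b} \<in> F) xs"
  using assms
proof (induction arbitrary: x y rule: grows.induct)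
  case (single v)
  then show ?case by (intro exI[of _ "[v]"]) auto
next
  case (extend U F u w)
  have mono: "successively (\<lambda>a b. {a, b} \<in> insert {u, w} F) xs"
    if "successively (\<lambda>a b. {a, b} \<in> F) xs" for xs
    using that by (rule successively_mono) auto
  consider "x = w" "y = w" | "x = w" "y \<in> U" | "x \<in> U" "y = w" | "x \<in> U" "y \<in> U"
    using extend.prems by auto
  then show ?case
  proof cases
    case 1
    then show ?thesis by (intro exI[of _ "[w]"]) auto
  next
    case 2
    then obtain xs where xs: "xs \<noteq> []" "hd xs = u" "last xs = y" "distinct xs" "set xs \<subseteq> U"
      "successively (\<lambda>a b. {a, b} \<in> F) xs" using extend.IH extend.hyps by blast
    then show ?thesis using extend.hyps 2 mono[OF xs(6)]
      by (intro exI[of _ "w # xs"]) (auto simp: successively_Cons insert_commute)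
  next
    case 3
    then obtain xs where xs: "xs \<noteq> []" "hd xs = x" "last xs = u" "distinct xs" "set xs \<subseteq> U"
      "successively (\<lambda>a b. {a, b} \<in> F) xs" using extend.IH extend.hyps by blast
    then show ?thesis using extend.hyps 3 mono[OF xs(6)]
      by (intro exI[of _ "xs @ [w]"]) (auto simp: successively_append_iff)
  next
    case 4
    then show ?thesis using extend.IH[OF 4] mono by blast
  qed
qed

lemma ex_crossing_step:
  assumes "(x, y) \<in> R\<^sup>*" "x \<in> U" "y \<notin> U"
  shows "\<exists>u w. (u, w) \<in> R \<and> u \<in> U \<and> w \<notin> U"
  using assms by (induction rule: rtrancl_induct) auto

text \<open>Take a vertex set that is maximal among those whose induced graph arises by attaching
  leaves. If it is not everything, connectivity gives an edge to an outside vertex \<open>w\<close>.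
  Two neighbours of \<open>w\<close> inside would close a cycle, so \<open>w\<close> could be
  attached as a leaf, against maximality.\<close>

lemma tree_grows:
  assumes "is_tree G"
  shows "grows (verts G) (edges G)"
proof -
  let ?V = "verts G" and ?E = "edges G"
  have fin: "finite ?V" and E: "?E \<subseteq> all_edges ?V" and ne: "?V \<noteq> {}"
    and conn: "\<And>u v. u \<in> ?V \<Longrightarrow> v \<in> ?V \<Longrightarrow> (u, v) \<in> {(x, y). {x, y} \<in> ?E}\<^sup>*"
    and acyc: "\<And>vs. \<not> is_cycle G vs"
    using assms by (auto simp: is_tree_def finite_graph_def connected_graph_def)
  define \<U> where "\<U> = {U. U \<subseteq> ?V \<and> grows U {e \<in> ?E. e \<subseteq> U}}"
  obtain v where v: "v \<in> ?V" using ne by auto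
  have no_edge: "{e \<in> ?E. e \<subseteq> {v}} = {}"
    using E by (auto simp: all_edges_def dest!: subset_singletonD)
  have "grows {v} {e \<in> ?E. e \<subseteq> {v}}" unfolding no_edge by (rule grows.single)
  then have "{v} \<in> \<U>" using v by (simp add: \<U>_def)
  moreover have "finite \<U>" using fin by (auto simp: \<U>_def intro: finite_subset[of _ "Pow ?V"])
  ultimately obtain U where U: "U \<in> \<U>" and max: "\<forall>U'\<in>\<U>. U \<subseteq> U' \<longrightarrow> U = U'"
    using finite_has_maximal2[of \<U> "{v}"] by blast
  have gU: "grows U {e \<in> ?E. e \<subseteq> U}" and UV: "U \<subseteq> ?V" using U by (auto simp: \<U>_def)
  have "U = ?V"
  proof (rule ccontr)
    assume "U \<noteq> ?V"
    then obtain w0 where "w0 \<in> ?V" "w0 \<notin> U" using UV by auto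
    moreover obtain u0 where "u0 \<in> U" using grows_facts[OF gU] by auto
    ultimately have "\<exists>u w. (u, w) \<in> {(x, y). {x, y} \<in> ?E} \<and> u \<in> U \<and> w \<notin> U"
      using UV by (intro ex_crossing_step[OF conn[of u0 w0]]) auto
    then obtain u w where uw: "{u, w} \<in> ?E" "u \<in> U" "w \<notin> U" by auto
    have wV: "w \<in> ?V" using uw(1) E by (auto simp: all_edges_def)
    have uniq: "u' = u" if u': "{u', w} \<in> ?E" "u' \<in> U" for u'
    proof (rule ccontr)
      assume "u' \<noteq> u"
      obtain xs where xs: "xs \<noteq> []" "hd xs = u" "last xs = u'" "distinct xs" "set xs \<subseteq> U"
        "successively (\<lambda>a b. {a, b} \<in> {e \<in> ?E. e \<subseteq> U}) xs"
        using grows_path[OF gU uw(2) u'(2)] by blast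
      have "xs \<noteq> [x]" for x using xs(2,3) \<open>u' \<noteq> u\<close> by auto
      then have len: "length xs \<ge> 2" using xs(1) by (metis One_nat_def Suc_leI le_neq_implies_less length_0_conv length_Suc_conv neq0_conv one_add_one plus_1_eq_Suc)
      \<comment> \<open>The three cases are an edge of the path, the edge from \<open>u'\<close> to
        \<open>w\<close>, and the wrap-around edge from \<open>w\<close> back to
        \<open>u\<close>.\<close>
      have "is_cycle G (xs @ [w])"
        unfolding is_cycle_def
      proof (intro conjI allI impI)
        show "distinct (xs @ [w])" using xs uw by auto
        fix i assume "i < length (xs @ [w])"
        then consider "Suc i < length xs" | "Suc i = length xs" | "i = length xs" by force
        then show "{(xs @ [w]) ! i, (xs @ [w]) ! (Suc i mod length (xs @ [w]))} \<in> ?E"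
        proof cases
          case 1
          then show ?thesis using successively_nth[OF xs(6) 1] by (simp add: nth_append)
        next
          case 2
          have "length xs - 1 = i" using 2 by simp
          then have "xs ! i = u'" using last_conv_nth[OF xs(1)] xs(3) by simp
          then show ?thesis using 2 u' by (simp add: nth_append)
        next
          case 3
          then show ?thesis using xs(1,2) uw(1) hd_conv_nth[OF xs(1)]
            by (simp add: nth_append insert_commute[of w])
        qed
      qed (use len in auto)
      then show False using acyc by blast
    qed
    have "{e \<in> ?E. e \<subseteq> insert w U} = insert {u, w} {e \<in> ?E. e \<subseteq> U}"
    proof (intro equalityI subsetI)
      fix e assume e: "e \<in> {e \<in> ?E. e \<subseteq> insert w U}"
      show "e \<in> insert {u, w} {e \<in> ?E. e \<subseteq> U}"
      proof (cases "w \<in> e")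
        case True
        have "card e = 2" using e E by (auto simp: all_edges_def)
        then obtain x y where xy: "e = {x, y}" "x \<noteq> y" unfolding card_2_iff by blast
        then have "e = {x, w} \<and> x \<noteq> w \<or> e = {y, w} \<and> y \<noteq> w" using True by blast
        then obtain u' where u': "e = {u', w}" "u' \<noteq> w" by blast
        moreover have "u' \<in> U" using u' e by blast
        ultimately have "u' = u" using uniq[of u'] e by blast
        then show ?thesis using u'(1) by simp
      qed (use e in auto)
    qed (use uw in auto)
    then have "insert w U \<in> \<U>"
      using grows.extend[OF gU uw(2,3)] UV wV by (simp add: \<U>_def)
    then have "U = insert w U" using max by blast
    then show False using uw(3) by blast
  qed
  moreover have "{e \<in> ?E. e \<subseteq> ?V} = ?E" using E by (auto simp: all_edges_def)
  ultimately show ?thesis using gU by simp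
qed

section \<open>Repeats as families of embeddings\<close>

lemma graph_iso_edge_image:
  assumes "graph_iso f G H" "finite_graph G" "e \<in> edges G"
  shows "f ` e \<in> edges H"
proof -
  have "e \<subseteq> verts G" "card e = 2" using assms by (auto simp: finite_graph_def all_edges_def)
  then obtain u v where "e = {u, v}" "u \<in> verts G" "v \<in> verts G" by (auto simp: card_2_iff)
  then show ?thesis using assms by (auto simp: graph_iso_def)
qed

definition image_graph :: "('a \<Rightarrow> 'b) \<Rightarrow> 'a graph \<Rightarrow> 'b graph" where
  "image_graph f G = (f ` verts G, (`) f ` edges G)"

lemma graph_iso_image_graph:
  assumes "inj_on f (verts G)" "finite_graph G"
  shows "graph_iso f G (image_graph f G)"
  unfolding graph_iso_def image_graph_def
proof (intro conjI ballI)
  fix u v assume uv: "u \<in> verts G" "v \<in> verts G"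
  have "{f u, f v} \<in> (`) f ` edges G \<longleftrightarrow> f ` {u, v} \<in> (`) f ` edges G" by simp
  also have "\<dots> \<longleftrightarrow> {u, v} \<in> edges G"
    using uv assms(2) by (intro inj_on_image_mem_iff[OF inj_on_image_Pow[OF assms(1)]])
      (auto simp: finite_graph_def all_edges_def)
  finally show "{u, v} \<in> edges G \<longleftrightarrow> {f u, f v} \<in> edges (f ` verts G, (`) f ` edges G)" by simp
qed (use assms in \<open>auto simp: inj_on_imp_bij_betw\<close>)

text \<open>The colour isomorphism between two copies is \<open>\<psi> j\<close> after the inverse
  of \<open>\<psi> i\<close>. Since \<open>verts H\<close> is nonempty, copies with disjoint vertex
  sets are different, so the set really has \<open>k\<close> members.\<close>

lemma is_repeatI:
  fixes H :: "'a graph"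
  assumes H: "finite_graph H" "verts H \<noteq> {}"
    and inj: "\<And>i. i < k \<Longrightarrow> inj_on (\<psi> i) (verts H)" and ran: "\<And>i. i < k \<Longrightarrow> \<psi> i ` verts H \<subseteq> {..<n}"
    and disj: "\<And>i j. i < k \<Longrightarrow> j < k \<Longrightarrow> i \<noteq> j \<Longrightarrow> \<psi> i ` verts H \<inter> \<psi> j ` verts H = {}"
    and col: "\<And>i j e. i < k \<Longrightarrow> j < k \<Longrightarrow> e \<in> edges H \<Longrightarrow> c (\<psi> i ` e) = c (\<psi> j ` e)"
  shows "is_repeat k H n c ((\<lambda>i. image_graph (\<psi> i) H) ` {..<k})"
proof -
  let ?G = "\<lambda>i. image_graph (\<psi> i) H"
  have vG: "verts (?G i) = \<psi> i ` verts H" and eG: "edges (?G i) = (`) (\<psi> i) ` edges H" for i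
    by (simp_all add: image_graph_def)
  have eH: "e \<subseteq> verts H" "card e = 2" if "e \<in> edges H" for e
    using that H by (auto simp: finite_graph_def all_edges_def)
  have disjG: "verts (?G i) \<inter> verts (?G j) = {}" if "i < k" "j < k" "i \<noteq> j" for i j
    using disj that by (simp add: vG)
  have injG: "inj_on ?G {..<k}"
  proof (rule inj_onI)
    fix i j assume ij: "i \<in> {..<k}" "j \<in> {..<k}" "?G i = ?G j"
    then show "i = j" using disjG[of i j] H(2) by (cases "i = j") (auto simp: vG)
  qed
  have card2: "card (\<psi> i ` e) = 2" if "i < k" "e \<in> edges H" for i e
    using card_image[OF inj_on_subset[OF inj[OF that(1)] eH(1)[OF that(2)]]] eH(2)[OF that(2)] by simp
  have copy: "copy_of H n (?G i)" if i: "i < k" for i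
    unfolding copy_of_def subgraph_def
  proof (intro conjI exI[of _ "\<psi> i"])
    have sub: "edges (?G i) \<subseteq> all_edges (verts (?G i))"
      using eH card2[OF i] by (auto simp: eG vG all_edges_def)
    then show "finite_graph (?G i)" using H by (simp add: finite_graph_def vG)
    show "verts (?G i) \<subseteq> verts (complete_graph n)" using ran[OF i] by (simp add: vG complete_graph_def)
    then show "edges (?G i) \<subseteq> edges (complete_graph n)"
      using sub by (auto simp: complete_graph_def all_edges_def)
    show "graph_iso (\<psi> i) H (?G i)" by (rule graph_iso_image_graph[OF inj[OF i] H(1)])
  qed
  have iso: "colour_isomorphic c (?G i) (?G j)" if i: "i < k" and j: "j < k" for i j
  proof -
    define \<theta> where "\<theta> x = \<psi> j (the_inv_into (verts H) (\<psi> i) x)" for x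
    have \<theta>: "\<theta> (\<psi> i x) = \<psi> j x" if "x \<in> verts H" for x
      using that the_inv_into_f_f[OF inj[OF i]] by (simp add: \<theta>_def)
    have \<theta>e: "\<theta> ` \<psi> i ` e = \<psi> j ` e" if "e \<subseteq> verts H" for e
      unfolding image_image using that \<theta> by (intro image_cong) auto
    have "inj_on (\<theta> \<circ> \<psi> i) (verts H)"
      using inj[OF j] by (rule inj_on_cong[THEN iffD1, rotated]) (simp add: \<theta>)
    then have "bij_betw \<theta> (verts (?G i)) (verts (?G j))"
      unfolding vG bij_betw_def \<theta>e[OF subset_refl] by (simp add: inj_on_imageI)
    moreover have "{u, v} \<in> edges (?G i) \<longleftrightarrow> {\<theta> u, \<theta> v} \<in> edges (?G j)"
      if uv: "u \<in> verts (?G i)" "v \<in> verts (?G i)" for u v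
    proof -
      obtain u' v' where u'v': "u = \<psi> i u'" "v = \<psi> i v'" "u' \<in> verts H" "v' \<in> verts H"
        using uv by (auto simp: vG)
      have "{u, v} \<in> edges (?G i) \<longleftrightarrow> {u', v'} \<in> edges H"
        using graph_iso_image_graph[OF inj[OF i] H(1)] u'v' by (simp add: graph_iso_def)
      also have "\<dots> \<longleftrightarrow> {\<psi> j u', \<psi> j v'} \<in> edges (?G j)"
        using graph_iso_image_graph[OF inj[OF j] H(1)] u'v' by (simp add: graph_iso_def)
      finally show ?thesis using u'v' \<theta> by simp
    qed
    moreover have "c (\<theta> ` e) = c e" if "e \<in> edges (?G i)" for e
    proof -
      obtain e' where "e' \<in> edges H" "e = \<psi> i ` e'" using \<open>e \<in> edges (?G i)\<close> by (auto simp: eG)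
      then show ?thesis using \<theta>e[OF eH(1)] col[OF j i] by simp
    qed
    ultimately show ?thesis unfolding colour_isomorphic_def graph_iso_def by blast
  qed
  show ?thesis
    unfolding is_repeat_def
  proof (intro conjI ballI)
    show "card (?G ` {..<k}) = k" using card_image[OF injG] by simp
    show "disjoint_family_on verts (?G ` {..<k})"
      unfolding disjoint_family_on_def
    proof (intro ballI impI)
      fix G G' assume "G \<in> ?G ` {..<k}" "G' \<in> ?G ` {..<k}" "G \<noteq> G'"
      then obtain i j where "i < k" "j < k" "G = ?G i" "G' = ?G j" "i \<noteq> j" by auto
      then show "verts G \<inter> verts G' = {}" using disjG by simp
    qed
    show "pairwise (colour_isomorphic c) (?G ` {..<k})"
      unfolding pairwise_def using iso by blast
  qed (use copy in auto)
qed

text \<open>All copies are parametrised through one of them: an isomorphism from \<open>H\<close> to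
  \<open>G0\<close> is followed by colour isomorphisms starting at \<open>G0\<close>. Isomorphisms
  from \<open>H\<close> chosen independently need not give an edge of \<open>H\<close> the same
  colour in all copies.\<close>

lemma is_repeatD:
  fixes H :: "'a graph"
  assumes rep: "is_repeat k H n c S" and H: "finite_graph H" and "k \<ge> 1"
  shows "\<exists>\<psi> :: nat graph \<Rightarrow> 'a \<Rightarrow> nat.
    (\<forall>G\<in>S. inj_on (\<psi> G) (verts H) \<and> \<psi> G ` verts H \<subseteq> {..<n}) \<and>
    (\<forall>G\<in>S. \<forall>G'\<in>S. (G \<noteq> G' \<longrightarrow> \<psi> G ` verts H \<inter> \<psi> G' ` verts H = {}) \<and>
      (\<forall>e\<in>edges H. c (\<psi> G ` e) = c (\<psi> G' ` e)))"
proof -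
  have S: "finite S" "card S = k" "\<And>G. G \<in> S \<Longrightarrow> copy_of H n G"
    "disjoint_family_on verts S" "pairwise (colour_isomorphic c) S"
    using rep by (auto simp: is_repeat_def)
  have "S \<noteq> {}" using S(2) \<open>k \<ge> 1\<close> by auto
  then obtain G0 where G0: "G0 \<in> S" by blast
  obtain \<phi> where \<phi>: "graph_iso \<phi> H G0" using S(3)[OF G0] by (auto simp: copy_of_def)
  \<comment> \<open>\<open>pairwise\<close> says nothing about a member and itself, hence the
    identity for \<open>G0\<close>.\<close>
  have "\<exists>\<theta>. bij_betw \<theta> (verts G0) (verts G) \<and> (\<forall>e\<in>edges G0. c (\<theta> ` e) = c e)" if "G \<in> S" for G
  proof (cases "G = G0")
    case True
    then show ?thesis by (intro exI[of _ id]) auto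
  next
    case False
    then have "colour_isomorphic c G0 G" using S(5) G0 that by (auto simp: pairwise_def)
    then show ?thesis by (auto simp: colour_isomorphic_def graph_iso_def)
  qed
  then obtain \<theta> where \<theta>: "\<And>G. G \<in> S \<Longrightarrow> bij_betw (\<theta> G) (verts G0) (verts G)"
    "\<And>G e. G \<in> S \<Longrightarrow> e \<in> edges G0 \<Longrightarrow> c (\<theta> G ` e) = c e" by metis
  have bij: "bij_betw (\<theta> G \<circ> \<phi>) (verts H) (verts G)" if "G \<in> S" for G
    using \<phi> \<theta>(1)[OF that] unfolding graph_iso_def by (blast intro: bij_betw_trans)
  show ?thesis
  proof (intro exI[of _ "\<lambda>G. \<theta> G \<circ> \<phi>"] conjI ballI impI)
    fix G assume G: "G \<in> S"
    show "inj_on (\<theta> G \<circ> \<phi>) (verts H)" using bij[OF G] by (simp add: bij_betw_def)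
    show "(\<theta> G \<circ> \<phi>) ` verts H \<subseteq> {..<n}"
      using bij[OF G] S(3)[OF G] by (auto simp: bij_betw_def copy_of_def subgraph_def complete_graph_def)
    fix G' assume G': "G' \<in> S"
    show "(\<theta> G \<circ> \<phi>) ` verts H \<inter> (\<theta> G' \<circ> \<phi>) ` verts H = {}" if "G \<noteq> G'"
      using bij[OF G] bij[OF G'] S(4) that G G' by (simp add: bij_betw_def disjoint_family_on_def)
    show "c ((\<theta> G \<circ> \<phi>) ` e) = c ((\<theta> G' \<circ> \<phi>) ` e)" if "e \<in> edges H" for e
    proof -
      have "\<phi> ` e \<in> edges G0" by (rule graph_iso_edge_image[OF \<phi> H that])
      then have "c (\<theta> G ` (\<phi> ` e)) = c (\<theta> G' ` (\<phi> ` e))" using \<theta>(2) G G' by simp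
      then show ?thesis by (simp only: image_comp)
    qed
  qed
qed

lemma proper_colouringD:
  assumes "proper_colouring n C c" "x < n" "y < n" "y' < n" "x \<noteq> y" "x \<noteq> y'" "c {x, y} = c {x, y'}"
  shows "y = y'"
proof (rule ccontr)
  assume "y \<noteq> y'"
  then have "{x, y} \<noteq> {x, y'} \<and> {x, y} \<inter> {x, y'} \<noteq> {}" by (auto simp: doubleton_eq_iff)
  moreover have "{x, y} \<in> edges (complete_graph n)" "{x, y'} \<in> edges (complete_graph n)"
    using assms by (auto simp: complete_graph_def all_edges_def)
  moreover have "\<forall>e\<in>edges (complete_graph n). \<forall>e'\<in>edges (complete_graph n). e \<noteq> e' \<and> e \<inter> e' \<noteq> {} \<longrightarrow> c e \<noteq> c e'"
    using assms(1) by (simp add: proper_colouring_def)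
  ultimately have "c {x, y} \<noteq> c {x, y'}" by (meson)
  then show False using assms(7) by contradiction
qed

lemma proper_colouring_less:
  assumes "proper_colouring n C c" "x < n" "y < n" "x \<noteq> y"
  shows "c {x, y} < C"
  using assms by (auto simp: proper_colouring_def complete_graph_def all_edges_def Pi_def)

section \<open>Lower bounds\<close>

text \<open>In a proper colouring the image of one endpoint and the colour of an edge determine the
  image of the other endpoint, so agreement at a single vertex spreads over the whole tree.\<close>

lemma grows_determined:
  assumes "grows U F" and c: "proper_colouring n C c"
    and "inj_on f U" "f ` U \<subseteq> {..<n}" "inj_on g U" "g ` U \<subseteq> {..<n}"
    and "\<And>e. e \<in> F \<Longrightarrow> c (f ` e) = c (g ` e)"
    and "u0 \<in> U" "f u0 = g u0" "v \<in> U"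
  shows "f v = g v"
  using assms(1,3-)
proof (induction arbitrary: u0 v rule: grows.induct)
  case (extend U F u w)
  have uw: "u \<noteq> w" "f u < n" "f w < n" "g u < n" "g w < n" using extend.hyps extend.prems(2,4) by auto
  have ne: "f u \<noteq> f w" "g u \<noteq> g w"
    using extend.hyps extend.prems(1,3) by (auto simp: inj_on_def)
  have ceq: "c {f u, f w} = c {g u, g w}" using extend.prems(5)[of "{u, w}"] by simp
  have IH: "f v = g v" if "u1 \<in> U" "f u1 = g u1" "v \<in> U" for u1 v
    by (rule extend.IH[OF _ _ _ _ _ that]) (use extend.prems in \<open>auto intro: inj_on_subset\<close>)
  \<comment> \<open>If the given point of agreement is the new leaf \<open>w\<close>, it is first
    carried back along the new edge to \<open>u\<close>.\<close>
  have u_eq: "f u = g u"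
  proof (cases "u0 = w")
    case True
    then have "f w = g w" using extend.prems(7) by simp
    then show ?thesis
      using proper_colouringD[OF c, of "f w" "f u" "g u"] uw ne ceq by (simp add: insert_commute)
  next
    case False
    then show ?thesis using IH[of u0 u] extend.prems(6,7) extend.hyps by auto
  qed
  then have "f w = g w"
    using proper_colouringD[OF c, of "f u" "f w" "g w"] uw ne ceq by simp
  then show ?case using IH[of u v] u_eq extend.hyps extend.prems(8) by auto
qed auto

text \<open>Greedy choice: pick an element and discard everything in conflict with it, itself
  included. This costs at most \<open>d\<close> elements, so it can be done \<open>k\<close>
  times.\<close>

lemma ex_disjoint_subfamily:
  assumes "finite \<Phi>" "k * d \<le> card \<Phi>" "d \<ge> 1"
    and "\<And>x y. conf x y \<Longrightarrow> conf y x"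
    and "\<And>x. x \<in> \<Phi> \<Longrightarrow> conf x x"
    and "\<And>x. x \<in> \<Phi> \<Longrightarrow> card {y \<in> \<Phi>. conf x y} \<le> d"
  shows "\<exists>A \<subseteq> \<Phi>. card A = k \<and> (\<forall>x\<in>A. \<forall>y\<in>A. x \<noteq> y \<longrightarrow> \<not> conf x y)"
  using assms
proof (induction k arbitrary: \<Phi>)
  case 0
  then show ?case by (intro exI[of _ "{}"]) auto
next
  case (Suc k)
  then have "card \<Phi> \<noteq> 0" by auto
  then have "\<Phi> \<noteq> {}" by auto
  then obtain x where x: "x \<in> \<Phi>" by blast
  define \<Psi> where "\<Psi> = \<Phi> - {y \<in> \<Phi>. conf x y}"
  have "k * d \<le> card \<Psi>"
    unfolding \<Psi>_def using Suc.prems(1,2) Suc.prems(6)[OF x] by (subst card_Diff_subset) auto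
  moreover have "card {z \<in> \<Psi>. conf y z} \<le> d" if "y \<in> \<Psi>" for y
  proof -
    have "card {z \<in> \<Psi>. conf y z} \<le> card {z \<in> \<Phi>. conf y z}"
      using Suc.prems(1) by (intro card_mono) (auto simp: \<Psi>_def)
    then show ?thesis using Suc.prems(6)[of y] that by (auto simp: \<Psi>_def)
  qed
  ultimately obtain A where A: "A \<subseteq> \<Psi>" "card A = k" "\<forall>x\<in>A. \<forall>y\<in>A. x \<noteq> y \<longrightarrow> \<not> conf x y"
    using Suc.IH[of \<Psi>] Suc.prems by (auto simp: \<Psi>_def)
  have "x \<notin> A" using A(1) Suc.prems(5)[OF x] x by (auto simp: \<Psi>_def)
  moreover have "finite A" using A(1) Suc.prems(1) by (auto simp: \<Psi>_def intro: finite_subset)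
  ultimately have "card (insert x A) = Suc k" using A(2) by simp
  moreover have "\<not> conf x y" "\<not> conf y x" if "y \<in> A" for y
    using that A(1) Suc.prems(4) by (auto simp: \<Psi>_def)
  ultimately show ?case using A x
    by (intro exI[of _ "insert x A"]) (auto simp: \<Psi>_def)
qed

lemma card_le_of_fibres:
  assumes "finite A" "finite B" "f ` A \<subseteq> B" "\<And>y. y \<in> B \<Longrightarrow> card {x \<in> A. f x = y} \<le> c"
  shows "card A \<le> c * card B"
proof -
  have "card A = card (\<Union>y\<in>B. {x \<in> A. f x = y})" using assms(3) by (intro arg_cong[where f = card]) auto
  also have "\<dots> \<le> (\<Sum>y\<in>B. card {x \<in> A. f x = y})" using assms by (intro card_UN_le)
  also have "\<dots> \<le> (\<Sum>y\<in>B. c)" by (rule sum_mono) (use assms in auto)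
  finally show ?thesis by (simp add: mult.commute)
qed

text \<open>The injections of the vertices of \<open>T\<close> are sorted by their colour pattern.
  There are at most \<open>C ^ m\<close> patterns, and a pattern with at least
  \<open>k * (m + 1) ^ 2\<close> injections would contain \<open>k\<close> disjoint ones, that is, a
  repeat.\<close>

lemma repeat_free_tree_size_bound:
  fixes T :: "'a graph"
  assumes T: "is_tree T" and m: "card (edges T) = m"
    and c: "proper_colouring n C c" and norep: "\<nexists>S. is_repeat k T n c S" and k: "k \<ge> 1"
  shows "(n - Suc m) ^ Suc m \<le> k * (Suc m * Suc m) * C ^ m"
proof -
  let ?V = "verts T" and ?E = "edges T"
  have gr: "grows ?V ?E" by (rule tree_grows[OF T])
  have fgT: "finite_graph T" using T by (simp add: is_tree_def)
  have fV: "finite ?V" "?V \<noteq> {}" "finite ?E" "card ?V = Suc m" using grows_facts[OF gr] m by auto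
  have eE: "e \<subseteq> ?V" "card e = 2" if "e \<in> ?E" for e
    using that fgT by (auto simp: finite_graph_def all_edges_def)
  define I where "I = {f \<in> ?V \<rightarrow>\<^sub>E {..<n}. inj_on f ?V}"
  define pat where "pat f = restrict (\<lambda>e. c (f ` e)) ?E" for f :: "'a \<Rightarrow> nat"
  have fI: "finite I" 
  proof (rule finite_subset)
    show "I \<subseteq> ?V \<rightarrow>\<^sub>E {..<n}" unfolding I_def by blast
    show "finite (?V \<rightarrow>\<^sub>E {..<n})" by (intro finite_PiE fV finite_lessThan)
  qed
  have ran: "f ` ?V \<subseteq> {..<n}" "inj_on f ?V" if "f \<in> I" for f using that by (auto simp: I_def PiE_iff)
  have "card I \<le> (k * (Suc m * Suc m)) * card (?E \<rightarrow>\<^sub>E {..<C})"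
  proof (rule card_le_of_fibres[OF fI, where f = pat])
    show "finite (?E \<rightarrow>\<^sub>E {..<C})" using fV by (intro finite_PiE) auto
    show "pat ` I \<subseteq> ?E \<rightarrow>\<^sub>E {..<C}"
    proof
      fix p assume "p \<in> pat ` I"
      then obtain f where f: "f \<in> I" "p = pat f" by blast
      have "c (f ` e) < C" if e: "e \<in> ?E" for e
      proof -
        obtain x y where xy: "e = {x, y}" "x \<noteq> y" using eE(2)[OF e] unfolding card_2_iff by blast
        then have "f x < n" "f y < n" "f x \<noteq> f y"
          using ran[OF f(1)] eE(1)[OF e] by (auto dest: inj_onD)
        then have "c {f x, f y} < C" by (rule proper_colouring_less[OF c])
        then show ?thesis unfolding xy(1) by simp
      qed
      then show "p \<in> ?E \<rightarrow>\<^sub>E {..<C}" unfolding f(2) pat_def restrict_PiE_iff by blast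
    qed
    fix p
    define \<Phi> where "\<Phi> = {f \<in> I. pat f = p}"
    have f\<Phi>: "finite \<Phi>" using fI by (simp add: \<Phi>_def)
    have col: "c (f ` e) = c (g ` e)" if "f \<in> \<Phi>" "g \<in> \<Phi>" "e \<in> ?E" for f g e
    proof -
      have "pat f = pat g" using that by (simp add: \<Phi>_def)
      from fun_cong[OF this, of e] show ?thesis using that by (simp add: pat_def)
    qed
    define conf where "conf f g \<longleftrightarrow> f ` ?V \<inter> g ` ?V \<noteq> {}" for f g :: "'a \<Rightarrow> nat"
    show "card {f \<in> I. pat f = p} \<le> k * (Suc m * Suc m)"
    proof (rule ccontr)
      assume "\<not> ?thesis"
      then have big: "k * (Suc m * Suc m) \<le> card \<Phi>" by (simp add: \<Phi>_def)
      have "\<exists>A \<subseteq> \<Phi>. card A = k \<and> (\<forall>x\<in>A. \<forall>y\<in>A. x \<noteq> y \<longrightarrow> \<not> conf x y)"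
      proof (rule ex_disjoint_subfamily[OF f\<Phi> big])
        fix f assume f: "f \<in> \<Phi>"
        show "conf f f" using fV by (auto simp: conf_def)
        \<comment> \<open>Records one pair of vertices at which \<open>g\<close> meets
          \<open>f\<close>. By rigidity this pair determines \<open>g\<close>, so at most
          \<open>(m + 1) ^ 2\<close> embeddings conflict with \<open>f\<close>.\<close>
        define h where "h g = (SOME uv. uv \<in> ?V \<times> ?V \<and> g (fst uv) = f (snd uv))" for g
        have h: "h g \<in> ?V \<times> ?V \<and> g (fst (h g)) = f (snd (h g))" if fg: "conf f g" for g
        proof -
          obtain x where "x \<in> f ` ?V" "x \<in> g ` ?V" using fg unfolding conf_def by blast
          then obtain u v where "u \<in> ?V" "v \<in> ?V" "g u = f v" by fastforce
          then have "(u, v) \<in> ?V \<times> ?V \<and> g (fst (u, v)) = f (snd (u, v))" by simp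
          then show ?thesis unfolding h_def by (rule someI)
        qed
        have "card {g \<in> \<Phi>. conf f g} \<le> card (?V \<times> ?V)"
        proof (rule card_inj_on_le[of h])
          show "h ` {g \<in> \<Phi>. conf f g} \<subseteq> ?V \<times> ?V" using h by blast
          show "inj_on h {g \<in> \<Phi>. conf f g}"
          proof (rule inj_onI)
            fix g g' assume g: "g \<in> {g \<in> \<Phi>. conf f g}" "g' \<in> {g \<in> \<Phi>. conf f g}" "h g = h g'"
            have gI: "g \<in> I" "g' \<in> I" using g by (auto simp: \<Phi>_def)
            have confg: "conf f g" "conf f g'" using g(1,2) by simp_all
            have "g' (fst (h g')) = f (snd (h g'))" using h[OF confg(2)] by blast
            then have "g' (fst (h g)) = f (snd (h g))" unfolding g(3) .
            then have 1: "fst (h g) \<in> ?V" "g (fst (h g)) = g' (fst (h g))"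
              using h[OF confg(1)] by (auto simp only: mem_Times_iff)
            have g\<Phi>: "g \<in> \<Phi>" "g' \<in> \<Phi>" using g by simp_all
            have eq: "g x = g' x" if "x \<in> ?V" for x
              using grows_determined[OF gr c ran(2)[OF gI(1)] ran(1)[OF gI(1)] ran(2)[OF gI(2)] ran(1)[OF gI(2)]
                  col[OF g\<Phi>] 1 that] .
            have "g \<in> ?V \<rightarrow>\<^sub>E {..<n}" "g' \<in> ?V \<rightarrow>\<^sub>E {..<n}" using gI by (simp_all add: I_def)
            then show "g = g'" by (rule PiE_ext) (rule eq)
          qed
        qed (use fV in auto)
        then show "card {g \<in> \<Phi>. conf f g} \<le> Suc m * Suc m" unfolding card_cartesian_product fV(4) .
      next
        show "conf g f" if "conf f g" for f g using that unfolding conf_def by blast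
      qed simp
      then obtain A where A: "A \<subseteq> \<Phi>" "card A = k"
        and disj: "\<forall>x\<in>A. \<forall>y\<in>A. x \<noteq> y \<longrightarrow> \<not> conf x y" by blast
      obtain \<psi> where \<psi>: "bij_betw \<psi> {..<k} A"
        using ex_bij_betw_nat_finite[OF finite_subset[OF A(1) f\<Phi>]] A(2) by (metis atLeast0LessThan)
      have \<psi>A: "\<psi> i \<in> A" if "i < k" for i using bij_betwE[OF \<psi>] that by simp
      have \<psi>I: "\<psi> i \<in> I" "\<psi> i \<in> \<Phi>" if "i < k" for i using \<psi>A[OF that] A(1) by (auto simp: \<Phi>_def)
      have "is_repeat k T n c ((\<lambda>i. image_graph (\<psi> i) T) ` {..<k})"
      proof (rule is_repeatI[OF fgT fV(2)])
        fix i j assume ij: "i < k" "j < k"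
        show "\<psi> i ` ?V \<inter> \<psi> j ` ?V = {}" if "i \<noteq> j"
        proof -
          have "\<psi> i \<noteq> \<psi> j" using inj_onD[OF bij_betw_imp_inj_on[OF \<psi>], of i j] that ij by auto
          then have "\<not> conf (\<psi> i) (\<psi> j)" using disj \<psi>A ij by blast
          then show ?thesis unfolding conf_def by blast
        qed
        show "c (\<psi> i ` e) = c (\<psi> j ` e)" if "e \<in> ?E" for e
          by (rule col[OF \<psi>I(2)[OF ij(1)] \<psi>I(2)[OF ij(2)] that])
      qed (use ran \<psi>I in auto)
      then show False using norep by blast
    qed
  qed
  moreover have "(n - Suc m) ^ Suc m \<le> card I"
    using card_injections_ge[OF fV(1), of "{..<n}"] fV(4) by (simp add: I_def)
  ultimately show ?thesis using fV(3) m by (simp add: card_funcsetE)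
qed

section \<open>The exponent k / (k - 1): the graph on tuples\<close>

text \<open>Deleting a vertex of degree below \<open>D\<close> removes one vertex and at most
  \<open>2 * D\<close> ordered pairs, so the density inequality survives. As it is strict, the
  deletions stop before the set is empty.\<close>

lemma ex_min_degree_subset:
  assumes "finite A" "2 * D * card A < card {(x, y). x \<in> A \<and> y \<in> A \<and> R x y}"
    and sym: "\<And>x y. R x y \<Longrightarrow> R y x"
  shows "\<exists>Y\<subseteq>A. Y \<noteq> {} \<and> (\<forall>x\<in>Y. D \<le> card {y \<in> Y. R x y})"
  using assms(1,2)
proof (induction A rule: finite_psubset_induct)
  case (psubset A)
  show ?case
  proof (cases "\<forall>x\<in>A. D \<le> card {y \<in> A. R x y}")
    case True
    have "A \<noteq> {}" using psubset.prems by auto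
    then show ?thesis using True by blast
  next
    case False
    then obtain x where x: "x \<in> A" "card {y \<in> A. R x y} < D" by (auto simp: not_le)
    define P where "P Z = {(x, y). x \<in> Z \<and> y \<in> Z \<and> R x y}" for Z
    let ?N = "{y \<in> A. R x y}"
    have fin: "finite (A - {x})" "finite ?N" using psubset.hyps by auto
    have finP: "finite (P (A - {x}))"
      using finite_cartesian_product[OF fin(1) fin(1)] by (rule finite_subset[rotated]) (auto simp: P_def)
    have "P A \<subseteq> P (A - {x}) \<union> ({x} \<times> ?N \<union> ?N \<times> {x})" using sym by (auto simp: P_def)
    then have "card (P A) \<le> card (P (A - {x}) \<union> ({x} \<times> ?N \<union> ?N \<times> {x}))"
      using fin finP by (intro card_mono) auto
    also have "\<dots> \<le> card (P (A - {x})) + (card ({x} \<times> ?N) + card (?N \<times> {x}))"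
      by (intro order.trans[OF card_Un_le] add_left_mono card_Un_le)
    also have "\<dots> \<le> card (P (A - {x})) + 2 * D" using x(2) by (simp add: card_cartesian_product)
    finally have "card (P A) \<le> card (P (A - {x})) + 2 * D" .
    moreover have "2 * D * card A < card (P A)" using psubset.prems by (simp add: P_def)
    moreover have "card A = Suc (card (A - {x}))" using psubset.hyps x(1) by (metis card_Suc_Diff1)
    ultimately have "2 * D * card (A - {x}) < card (P (A - {x}))" by simp
    then have "\<exists>Y\<subseteq>A - {x}. Y \<noteq> {} \<and> (\<forall>x\<in>Y. D \<le> card {y \<in> Y. R x y})"
      using psubset.IH[of "A - {x}"] x(1) by (auto simp: P_def)
    then show ?thesis by blast
  qed
qed

text \<open>The condition \<open>x i \<noteq> y i\<close> keeps out singletons, on which a colouring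
  may take any value.\<close>

definition tuple_adjacent :: "(nat set \<Rightarrow> nat) \<Rightarrow> nat \<Rightarrow> (nat \<Rightarrow> nat) \<Rightarrow> (nat \<Rightarrow> nat) \<Rightarrow> bool" where
  "tuple_adjacent c k x y \<longleftrightarrow> (\<forall>i<k. x i \<noteq> y i) \<and> (\<forall>i<k. \<forall>j<k. c {x i, y i} = c {x j, y j})"

lemma tuple_adjacent_sym: "tuple_adjacent c k x y \<Longrightarrow> tuple_adjacent c k y x"
  unfolding tuple_adjacent_def by (metis insert_commute)

text \<open>One coordinate of \<open>y\<close> gives the common colour of the \<open>k\<close>
  edges, and this colour gives all other coordinates. Hence a forbidden value in one coordinate
  excludes at most one neighbour.\<close>

lemma tuple_adjacent_unique:
  assumes c: "proper_colouring n C c" and x: "x \<in> {..<k} \<rightarrow>\<^sub>E {..<n}"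
    and y: "y \<in> {..<k} \<rightarrow>\<^sub>E {..<n}" "y' \<in> {..<k} \<rightarrow>\<^sub>E {..<n}"
    and R: "tuple_adjacent c k x y" "tuple_adjacent c k x y'" and i: "i < k" "y i = y' i"
  shows "y = y'"
  using y
proof (rule PiE_ext)
  fix j assume "j \<in> {..<k}"
  then have j: "j < k" by simp
  have "c {x j, y j} = c {x i, y i}" using R(1) i(1) j unfolding tuple_adjacent_def by blast
  also have "\<dots> = c {x i, y' i}" unfolding i(2) ..
  also have "\<dots> = c {x j, y' j}" using R(2) i(1) j unfolding tuple_adjacent_def by blast
  finally have eq: "c {x j, y j} = c {x j, y' j}" .
  have "x j < n" "y j < n" "y' j < n" using PiE_mem[OF x] PiE_mem[OF y(1)] PiE_mem[OF y(2)] j by auto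
  moreover have "x j \<noteq> y j" "x j \<noteq> y' j" using R j unfolding tuple_adjacent_def by blast+
  ultimately show "y j = y' j" using eq by (rule proper_colouringD[OF c])
qed

text \<open>Greedy, leaf by leaf. The last clause, that all entries of all chosen tuples differ,
  makes the \<open>k\<close> coordinate maps injective with disjoint images.\<close>

lemma grows_embed_tuples:
  assumes gr: "grows U F" and c: "proper_colouring n C c" and k: "k \<ge> 1" and Y: "finite Y" "Y \<noteq> {}"
    and Y_sub: "\<And>x. x \<in> Y \<Longrightarrow> x \<in> {..<k} \<rightarrow>\<^sub>E {..<n} \<and> inj_on x {..<k}"
    and deg: "\<And>x. x \<in> Y \<Longrightarrow> k * k * card U \<le> card {y \<in> Y. tuple_adjacent c k x y}"
  shows "\<exists>\<phi>. (\<forall>u\<in>U. \<phi> u \<in> Y) \<and> (\<forall>u\<in>U. \<forall>w\<in>U. {u, w} \<in> F \<longrightarrow> tuple_adjacent c k (\<phi> u) (\<phi> w)) \<and>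
    (\<forall>u\<in>U. \<forall>w\<in>U. \<forall>i<k. \<forall>j<k. \<phi> u i = \<phi> w j \<longrightarrow> u = w \<and> i = j)"
  using gr deg
proof (induction rule: grows.induct)
  case (single v)
  obtain x where x: "x \<in> Y" using Y by blast
  show ?case
    by (rule exI[of _ "\<lambda>_. x"]) (use x Y_sub[OF x] in \<open>auto dest: inj_onD\<close>)
next
  case (extend U F u w)
  have fU: "finite U" and FU: "F \<subseteq> all_edges U" using grows_facts[OF extend.hyps(1)] by auto
  have cardU: "card (insert w U) = Suc (card U)" using fU extend.hyps by simp
  have "k * k * card U \<le> card {y \<in> Y. tuple_adjacent c k x y}" if "x \<in> Y" for x
    using extend.prems[OF that] unfolding cardU by simp
  from extend.IH[OF this] obtain \<phi> where \<phi>: "\<forall>u\<in>U. \<phi> u \<in> Y"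
    "\<forall>u\<in>U. \<forall>w\<in>U. {u, w} \<in> F \<longrightarrow> tuple_adjacent c k (\<phi> u) (\<phi> w)"
    "\<forall>u\<in>U. \<forall>w\<in>U. \<forall>i<k. \<forall>j<k. \<phi> u i = \<phi> w j \<longrightarrow> u = w \<and> i = j" by blast
  define N where "N = {y \<in> Y. tuple_adjacent c k (\<phi> u) y}"
  have fN: "finite N" using Y(1) by (simp add: N_def)
  define I where "I = {..<k} \<times> U \<times> {..<k}"
  \<comment> \<open>The neighbours of \<open>\<phi> u\<close> that reuse an old entry. Each of the
    \<open>k * k * card U\<close> possible coincidences excludes at most one neighbour, and the
    degree is larger.\<close>
  define Bad where "Bad = (\<Union>(i, v, j)\<in>I. {y \<in> N. y i = \<phi> v j})"
  have uY: "\<phi> u \<in> Y" using \<phi>(1) extend.hyps by blast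
  have "card Bad \<le> (\<Sum>(i, v, j)\<in>I. card {y \<in> N. y i = \<phi> v j})"
    unfolding Bad_def case_prod_unfold by (rule card_UN_le) (simp add: I_def fU)
  also have "\<dots> \<le> (\<Sum>p\<in>I. 1)"
  proof (rule sum_mono)
    fix p assume "p \<in> I"
    then obtain i v j where p: "p = (i, v, j)" "i < k" by (auto simp: I_def)
    have "y = y'" if "y \<in> N" "y i = \<phi> v j" "y' \<in> N" "y' i = \<phi> v j" for y y'
      by (rule tuple_adjacent_unique[OF c _ _ _ _ _ p(2)])
        (use that Y_sub uY in \<open>auto simp: N_def\<close>)
    then have "card {y \<in> N. y i = \<phi> v j} \<le> Suc 0" using fN by (subst card_le_Suc0_iff_eq) auto
    then show "(case p of (i, v, j) \<Rightarrow> card {y \<in> N. y i = \<phi> v j}) \<le> 1" using p by simp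
  qed
  also have "\<dots> = k * k * card U" by (simp add: I_def card_cartesian_product)
  also have "\<dots> < k * k * card (insert w U)" unfolding cardU using k by simp
  also have "\<dots> \<le> card N" unfolding N_def by (rule extend.prems[OF uY])
  finally have "card Bad < card N" .
  moreover have "Bad \<subseteq> N" by (auto simp: Bad_def)
  ultimately obtain y where y: "y \<in> N" "y \<notin> Bad" by (metis nless_le subsetI subset_antisym)
  have yY: "y \<in> Y" "tuple_adjacent c k (\<phi> u) y" using y(1) by (simp_all add: N_def)
  have new: "y i \<noteq> \<phi> v j" if "i < k" "v \<in> U" "j < k" for i v j
    using y that unfolding Bad_def I_def by blast
  have injy: "i = j" if "i < k" "j < k" "y i = y j" for i j
    using Y_sub[OF yY(1)] that by (auto dest: inj_onD)
  define \<phi>' where "\<phi>' = \<phi>(w := y)"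
  have \<phi>': "\<phi>' w = y" "\<And>v. v \<in> U \<Longrightarrow> \<phi>' v = \<phi> v" using extend.hyps by (auto simp: \<phi>'_def)
  show ?case
  proof (intro exI[of _ \<phi>'] conjI ballI allI impI)
    fix v assume "v \<in> insert w U"
    then show "\<phi>' v \<in> Y" using \<phi>(1) yY \<phi>' by auto
  next
    fix a b assume ab: "a \<in> insert w U" "b \<in> insert w U" "{a, b} \<in> insert {u, w} F"
    show "tuple_adjacent c k (\<phi>' a) (\<phi>' b)"
    proof (cases "{a, b} = {u, w}")
      case True
      then have "a = u \<and> b = w \<or> a = w \<and> b = u" by (auto simp: doubleton_eq_iff)
      then show ?thesis using yY(2) tuple_adjacent_sym[OF yY(2)] \<phi>'(1) \<phi>'(2)[OF extend.hyps(2)] by auto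
    next
      case False
      then have "{a, b} \<in> F" using ab(3) by simp
      moreover from this have "a \<in> U" "b \<in> U" using FU by (auto simp: all_edges_def)
      ultimately show ?thesis using \<phi>(2) \<phi>'(2) by simp
    qed
  next
    fix a b i j assume ab: "a \<in> insert w U" "b \<in> insert w U" "i < k" "j < k" "\<phi>' a i = \<phi>' b j"
    consider "a = w" "b = w" | "a = w" "b \<in> U" | "a \<in> U" "b = w" | "a \<in> U" "b \<in> U" using ab(1,2) by blast
    then have "a = b \<and> i = j"
    proof cases
      case 1
      then show ?thesis using injy ab(3-5) \<phi>'(1) by simp
    next
      case 2
      then show ?thesis using new[OF ab(3) 2(2) ab(4)] ab(5) \<phi>'(1) \<phi>'(2)[OF 2(2)] by simp
    next
      case 3
      then show ?thesis using new[OF ab(4) 3(1) ab(3)] ab(5) \<phi>'(1) \<phi>'(2)[OF 3(1)] by simp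
    next
      case 4
      then have "\<phi> a i = \<phi> b j" using ab(5) \<phi>'(2)[OF 4(1)] \<phi>'(2)[OF 4(2)] by simp
      then show ?thesis using \<phi>(3) 4 ab(3,4) by blast
    qed
    then show "a = b" "i = j" by simp_all
  qed
qed

text \<open>Applied with \<open>v a\<close> the number of vertices touched by colour
  \<open>a\<close>. The first alternative covers the case where a typical \<open>v a\<close> may be
  comparable to \<open>k\<close>, so that subtracting \<open>k\<close> matters. Otherwise colours
  with \<open>v a < M\<close> are dropped, and on the others \<open>v a - k\<close> is at least
  \<open>v a / 2\<close>.\<close>

lemma power_mean_dichotomy:
  fixes v :: "nat \<Rightarrow> nat"
  assumes n: "2 \<le> n" and k: "1 \<le> k" and sum1: "n * (n - 1) \<le> (\<Sum>a<C. v a)"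
    and sumk: "(\<Sum>a<C. (v a - k) ^ k) \<le> K * n ^ k"
  shows "n\<^sup>2 \<le> 8 * k * C \<or> n ^ k \<le> 8 ^ k * K * C ^ (k - 1)"
proof (cases "n\<^sup>2 \<le> 8 * k * C")
  case False
  have C0: "C > 0"
  proof (rule ccontr)
    assume "\<not> C > 0"
    then show False using sum1 n by simp
  qed
  define N where "N = (real n)\<^sup>2"
  \<comment> \<open>Half of the lower bound \<open>N / (2 * C)\<close> for the average of
    \<open>v\<close>: the light colours account for at most \<open>N / 4\<close> out of at least
    \<open>N / 2\<close>.\<close>
  define M where "M = N / (4 * real C)"
  have "real (8 * k * C) < real (n\<^sup>2)" using False unfolding of_nat_less_iff by simp
  then have M2k: "2 * real k < M" using C0 by (simp add: M_def N_def field_simps)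
  have M0: "M > 0" using M2k by linarith
  have "real (n * (n - 1)) = real n * (real n - 1)" using n by (simp add: of_nat_diff)
  also have "\<dots> \<ge> real n * (real n / 2)" using n by (intro mult_left_mono) auto
  finally have half: "N / 2 \<le> (\<Sum>a<C. real (v a))"
    using sum1 unfolding N_def power2_eq_square by (metis of_nat_mono of_nat_sum order_trans times_divide_eq_right)
  define Hv where "Hv = {a \<in> {..<C}. M \<le> real (v a)}"
  have "(\<Sum>a<C. real (v a)) = (\<Sum>a\<in>Hv. real (v a)) + (\<Sum>a\<in>{..<C} - Hv. real (v a))"
  proof -
    have "Hv \<subseteq> {..<C}" by (auto simp: Hv_def)
    from sum.subset_diff[OF this finite_lessThan, of "\<lambda>a. real (v a)"] show ?thesis by (simp only: add.commute)
  qed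
  also have "(\<Sum>a\<in>{..<C} - Hv. real (v a)) \<le> (\<Sum>a\<in>{..<C} - Hv. M)"
    by (rule sum_mono) (auto simp: Hv_def)
  also have "\<dots> \<le> real C * M"
    using M0 card_mono[of "{..<C}" "{..<C} - Hv"] by (simp add: mult_right_mono)
  also have "real C * M = N / 4" using C0 by (simp add: M_def)
  finally have heavy: "N / 4 \<le> (\<Sum>a\<in>Hv. real (v a))" using half by linarith
  \<comment> \<open>For heavy colours one factor \<open>v a / 2\<close> of the power is kept and the
    other \<open>k - 1\<close> are bounded below by \<open>M / 2\<close>, so that only the linear
    sum over \<open>v a\<close> is needed.\<close>
  have "N / 8 * (M / 2) ^ (k - 1) = (N / 4) * ((M / 2) ^ (k - 1) / 2)" by simp
  also have "\<dots> \<le> (\<Sum>a\<in>Hv. real (v a)) * ((M / 2) ^ (k - 1) / 2)"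
    using M0 by (intro mult_right_mono heavy) auto
  also have "\<dots> = (\<Sum>a\<in>Hv. real (v a) * ((M / 2) ^ (k - 1) / 2))" by (rule sum_distrib_right)
  also have "\<dots> \<le> (\<Sum>a\<in>Hv. real ((v a - k) ^ k))"
  proof (rule sum_mono)
    fix a assume "a \<in> Hv"
    then have a: "M \<le> real (v a)" by (simp add: Hv_def)
    have le: "real (v a) / 2 \<le> real (v a - k)" using a M2k by simp
    have "real (v a) * ((M / 2) ^ (k - 1) / 2) = (real (v a) / 2) * (M / 2) ^ (k - 1)" by simp
    also have "\<dots> \<le> (real (v a) / 2) * (real (v a) / 2) ^ (k - 1)"
      using a M0 by (intro mult_left_mono power_mono) auto
    also have "\<dots> = (real (v a) / 2) ^ k" using k by (cases k) auto
    also have "\<dots> \<le> real (v a - k) ^ k" using le by (intro power_mono) auto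
    finally show "real (v a) * ((M / 2) ^ (k - 1) / 2) \<le> real ((v a - k) ^ k)" by simp
  qed
  also have "\<dots> \<le> (\<Sum>a<C. real ((v a - k) ^ k))" by (rule sum_mono2) (auto simp: Hv_def)
  also have "\<dots> = real (\<Sum>a<C. (v a - k) ^ k)" by simp
  also have "\<dots> \<le> real (K * n ^ k)" using sumk by (simp only: of_nat_le_iff)
  finally have main: "N / 8 * (M / 2) ^ (k - 1) \<le> real K * real n ^ k" by simp
  have "M / 2 = N / (8 * real C)" by (simp add: M_def)
  then have "N / 8 * (M / 2) ^ (k - 1) = N ^ Suc (k - 1) / (8 ^ Suc (k - 1) * real C ^ (k - 1))"
    by (simp add: power_divide power_mult_distrib)
  also have "Suc (k - 1) = k" using k by simp
  finally have "N ^ k / (8 ^ k * real C ^ (k - 1)) \<le> real K * real n ^ k" using main by simp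
  then have "N ^ k \<le> real K * real n ^ k * (8 ^ k * real C ^ (k - 1))"
    using C0 by (simp add: pos_divide_le_eq)
  moreover have "N ^ k = real n ^ k * real n ^ k" by (simp add: N_def power2_eq_square power_mult_distrib)
  ultimately have "real n ^ k * real n ^ k \<le> real n ^ k * (8 ^ k * real K * real C ^ (k - 1))"
    by (simp add: mult_ac)
  then have "real n ^ k \<le> 8 ^ k * real K * real C ^ (k - 1)"
    using n by (subst (asm) mult_le_cancel_left_pos) auto
  then have "real (n ^ k) \<le> real (8 ^ k * K * C ^ (k - 1))" by simp
  then show ?thesis unfolding of_nat_le_iff by (rule disjI2)
qed simp

text \<open>The set \<open>P\<close> of adjacent ordered pairs of injective tuples is counted twice.
  If it is large, a subset of large minimum degree contains \<open>T\<close> as a tree of tuples,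
  whose coordinates form a repeat. From below, each colour contributes all injective tuples of
  vertices that it touches.\<close>

lemma repeat_free_tree_tuple_bound:
  fixes T :: "'a graph"
  assumes T: "is_tree T" and c: "proper_colouring n C c" and norep: "\<nexists>S. is_repeat k T n c S"
    and k: "k \<ge> 1" and n: "n \<ge> 2"
  shows "n\<^sup>2 \<le> 8 * k * C \<or> n ^ k \<le> 8 ^ k * (2 * (k * k * card (verts T))) * C ^ (k - 1)"
proof -
  define D where "D = k * k * card (verts T)"
  have gr: "grows (verts T) (edges T)" by (rule tree_grows[OF T])
  have fgT: "finite_graph T" using T by (simp add: is_tree_def)
  have neV: "verts T \<noteq> {}" using grows_facts[OF gr] by blast
  define A where "A = {x \<in> {..<k} \<rightarrow>\<^sub>E {..<n}. inj_on x {..<k}}"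
  have finT: "finite ({..<k} \<rightarrow>\<^sub>E {..<n})" by (intro finite_PiE) auto
  have finA: "finite A" using finT by (rule finite_subset[rotated]) (auto simp: A_def)
  define P where "P = {(x, y). x \<in> A \<and> y \<in> A \<and> tuple_adjacent c k x y}"
  have finP: "finite P" using finite_cartesian_product[OF finA finA]
    by (rule finite_subset[rotated]) (auto simp: P_def)
  have upper: "card P \<le> 2 * D * card A"
  proof (rule ccontr)
    assume "\<not> ?thesis"
    then have "2 * D * card A < card {(x, y). x \<in> A \<and> y \<in> A \<and> tuple_adjacent c k x y}" by (simp add: P_def)
    from ex_min_degree_subset[OF finA this tuple_adjacent_sym]
    obtain Y where Y: "Y \<subseteq> A" "Y \<noteq> {}" "\<forall>x\<in>Y. D \<le> card {y \<in> Y. tuple_adjacent c k x y}" by blast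
    have "finite Y" using Y(1) finA by (rule finite_subset)
    from grows_embed_tuples[OF gr c k this Y(2)] Y(1,3)
    obtain \<phi> where \<phi>: "\<forall>u\<in>verts T. \<phi> u \<in> Y"
      "\<forall>u\<in>verts T. \<forall>w\<in>verts T. {u, w} \<in> edges T \<longrightarrow> tuple_adjacent c k (\<phi> u) (\<phi> w)"
      "\<forall>u\<in>verts T. \<forall>w\<in>verts T. \<forall>i<k. \<forall>j<k. \<phi> u i = \<phi> w j \<longrightarrow> u = w \<and> i = j"
      unfolding D_def A_def by blast
    have "is_repeat k T n c ((\<lambda>i. image_graph (\<lambda>u. \<phi> u i) T) ` {..<k})"
    proof (rule is_repeatI[OF fgT neV])
      fix i assume i: "i < k"
      show "inj_on (\<lambda>u. \<phi> u i) (verts T)" using \<phi>(3) i by (intro inj_onI) blast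
      show "(\<lambda>u. \<phi> u i) ` verts T \<subseteq> {..<n}"
      proof (rule image_subsetI)
        fix u assume "u \<in> verts T"
        then have "\<phi> u \<in> A" using \<phi>(1) Y(1) by blast
        then show "\<phi> u i \<in> {..<n}" using i unfolding A_def by blast
      qed
      fix j assume j: "j < k"
      show "(\<lambda>u. \<phi> u i) ` verts T \<inter> (\<lambda>u. \<phi> u j) ` verts T = {}" if "i \<noteq> j"
        using \<phi>(3) i j that by blast
      show "c ((\<lambda>u. \<phi> u i) ` e) = c ((\<lambda>u. \<phi> u j) ` e)" if e: "e \<in> edges T" for e
      proof -
        have e2: "card e = 2" "e \<subseteq> verts T" using e fgT by (auto simp: finite_graph_def all_edges_def)
        then obtain u w where uw: "e = {u, w}" unfolding card_2_iff by blast
        have "tuple_adjacent c k (\<phi> u) (\<phi> w)" using \<phi>(2) e e2(2) unfolding uw by blast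
        then have "c {\<phi> u i, \<phi> w i} = c {\<phi> u j, \<phi> w j}" using i j unfolding tuple_adjacent_def by blast
        then show ?thesis unfolding uw by simp
      qed
    qed
    then show False using norep by blast
  qed
  \<comment> \<open>\<open>V a\<close> consists of the vertices touched by colour \<open>a\<close>.
    The edges of this colour form a matching, and \<open>p a\<close> sends a vertex to its
    partner.\<close>
  define V where "V a = {v. v < n \<and> (\<exists>w<n. w \<noteq> v \<and> c {v, w} = a)}" for a
  define p where "p a v = (SOME w. w < n \<and> w \<noteq> v \<and> c {v, w} = a)" for a v
  have finV: "finite (V a)" for a by (simp add: V_def)
  have p: "p a v < n" "p a v \<noteq> v" "c {v, p a v} = a" if v: "v \<in> V a" for a v
  proof -
    obtain w where "w < n \<and> w \<noteq> v \<and> c {v, w} = a" using v by (auto simp: V_def)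
    then have "p a v < n \<and> p a v \<noteq> v \<and> c {v, p a v} = a" unfolding p_def by (rule someI)
    then show "p a v < n" "p a v \<noteq> v" "c {v, p a v} = a" by simp_all
  qed
  have p_inj: "v = v'" if v: "v \<in> V a" "v' \<in> V a" "p a v = p a v'" for a v v'
  proof -
    have less: "v < n" "v' < n" using v by (simp_all add: V_def)
    have "c {p a v, v} = a" using p(3)[OF v(1)] by (simp add: insert_commute)
    moreover have "c {p a v, v'} = a" using p(3)[OF v(2)] v(3) by (simp add: insert_commute)
    ultimately have "c {p a v, v} = c {p a v, v'}" by simp
    moreover have "p a v \<noteq> v'" using p(2)[OF v(2)] v(3) by simp
    ultimately show ?thesis using proper_colouringD[OF c p(1)[OF v(1)] less p(2)[OF v(1)]] by blast
  qed
  define Q where "Q a = {x \<in> {..<k} \<rightarrow>\<^sub>E V a. inj_on x {..<k}}" for a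
  have finQ: "finite (Q a)" for a
  proof -
    have "finite ({..<k} \<rightarrow>\<^sub>E V a)" using finV by (intro finite_PiE) auto
    then show ?thesis by (rule finite_subset[rotated]) (auto simp: Q_def)
  qed
  have "(\<Sum>a<C. (card (V a) - k) ^ k) \<le> (\<Sum>a<C. card (Q a))"
  proof (rule sum_mono)
    fix a
    show "(card (V a) - k) ^ k \<le> card (Q a)"
      using card_injections_ge[OF finite_lessThan[of k] finV[of a]] by (simp add: Q_def)
  qed
  also have "\<dots> = card (Sigma {..<C} Q)" using finQ by simp
  also have "\<dots> \<le> card P"
  proof (rule card_inj_on_le[OF _ _ finP])
    let ?f = "\<lambda>(a, x). (x, restrict (\<lambda>i. p a (x i)) {..<k})"
    have x: "x i \<in> V a" if "x \<in> Q a" "i < k" for x a i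
      using that unfolding Q_def by blast
    show "?f ` Sigma {..<C} Q \<subseteq> P"
    proof (rule image_subsetI)
      fix z assume "z \<in> Sigma {..<C} Q"
      then obtain a x where z: "z = (a, x)" "x \<in> Q a" by blast
      define y where "y = restrict (\<lambda>i. p a (x i)) {..<k}"
      have yi: "y i = p a (x i)" if "i < k" for i using that by (simp add: y_def)
      have "V a \<subseteq> {..<n}" by (auto simp: V_def)
      then have "x \<in> A" using z(2) unfolding Q_def A_def by (blast intro: PiE_mono[THEN subsetD, rotated])
      moreover have "y \<in> A"
      proof -
        have "y \<in> {..<k} \<rightarrow>\<^sub>E {..<n}" unfolding y_def using p(1)[OF x[OF z(2)]] by auto
        moreover have "inj_on y {..<k}"
        proof (rule inj_onI)
          fix i j assume ij: "i \<in> {..<k}" "j \<in> {..<k}" "y i = y j"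
          then have ik: "i < k" "j < k" by simp_all
          have "x i = x j" by (rule p_inj[OF x[OF z(2) ik(1)] x[OF z(2) ik(2)]]) (use ij(3) yi ik in simp)
          then show "i = j" using z(2) ij(1,2) unfolding Q_def by (auto dest: inj_onD)
        qed
        ultimately show ?thesis unfolding A_def by blast
      qed
      moreover have "tuple_adjacent c k x y"
        unfolding tuple_adjacent_def
      proof (intro conjI allI impI)
        fix i assume i: "i < k"
        show "x i \<noteq> y i" using p(2)[OF x[OF z(2) i]] yi[OF i] by simp
        fix j assume j: "j < k"
        show "c {x i, y i} = c {x j, y j}"
          unfolding yi[OF i] yi[OF j] p(3)[OF x[OF z(2) i]] p(3)[OF x[OF z(2) j]] ..
      qed
      ultimately show "?f z \<in> P" unfolding z(1) P_def y_def by simp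
    qed
    show "inj_on ?f (Sigma {..<C} Q)"
    proof (rule inj_onI)
      fix z z' assume zz: "z \<in> Sigma {..<C} Q" "z' \<in> Sigma {..<C} Q" "?f z = ?f z'"
      obtain a x where z: "z = (a, x)" "x \<in> Q a" using zz(1) by blast
      obtain a' x' where z': "z' = (a', x')" "x' \<in> Q a'" using zz(2) by blast
      have xx: "x = x'" "restrict (\<lambda>i. p a (x i)) {..<k} = restrict (\<lambda>i. p a' (x' i)) {..<k}"
        using zz(3) unfolding z(1) z'(1) prod.case prod.inject by blast+
      \<comment> \<open>The colour is recovered from the edge joining the entries with index 0,
        which exist because \<open>k \<ge> 1\<close>.\<close>
      have 0: "0 < k" using k by simp
      have "p a (x 0) = p a' (x' 0)" using fun_cong[OF xx(2), of 0] 0 by simp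
      moreover have "c {x 0, p a (x 0)} = a" by (rule p(3)[OF x[OF z(2) 0]])
      moreover have "c {x' 0, p a' (x' 0)} = a'" by (rule p(3)[OF x[OF z'(2) 0]])
      ultimately have "a = a'" using xx(1) by metis
      then show "z = z'" unfolding z(1) z'(1) using xx(1) by simp
    qed
  qed
  also have "\<dots> \<le> 2 * D * card A" by (rule upper)
  also have "\<dots> \<le> 2 * D * n ^ k"
  proof -
    have "card A \<le> card ({..<k} \<rightarrow>\<^sub>E {..<n})" by (rule card_mono[OF finT]) (auto simp: A_def)
    then show ?thesis by (intro mult_le_mono2) (simp add: card_funcsetE)
  qed
  finally have sumk: "(\<Sum>a<C. (card (V a) - k) ^ k) \<le> 2 * D * n ^ k" .
  \<comment> \<open>An ordered pair of distinct vertices is sent to its colour and its first vertex;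
    properness recovers the second vertex.\<close>
  have "n * (n - 1) = card (Sigma {..<n} (\<lambda>v. {..<n} - {v}))" by simp
  also have "\<dots> \<le> card (Sigma {..<C} V)"
  proof (rule card_inj_on_le[of "\<lambda>(v, w). (c {v, w}, v)"])
    show "finite (Sigma {..<C} V)" using finV by auto
    show "(\<lambda>(v, w). (c {v, w}, v)) ` Sigma {..<n} (\<lambda>v. {..<n} - {v}) \<subseteq> Sigma {..<C} V"
      using proper_colouring_less[OF c] by (auto simp: V_def)
    show "inj_on (\<lambda>(v, w). (c {v, w}, v)) (Sigma {..<n} (\<lambda>v. {..<n} - {v}))"
    proof (rule inj_onI)
      fix z z' assume zz: "z \<in> Sigma {..<n} (\<lambda>v. {..<n} - {v})" "z' \<in> Sigma {..<n} (\<lambda>v. {..<n} - {v})"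
        "(\<lambda>(v, w). (c {v, w}, v)) z = (\<lambda>(v, w). (c {v, w}, v)) z'"
      obtain v w where z: "z = (v, w)" "v < n" "w < n" "v \<noteq> w" using zz(1) by auto
      obtain v' w' where z': "z' = (v', w')" "v' < n" "w' < n" "v' \<noteq> w'" using zz(2) by auto
      have eq: "v = v'" "c {v, w} = c {v', w'}" using zz(3) unfolding z(1) z'(1) prod.case prod.inject by blast+
      have "c {v, w} = c {v, w'}" using eq(2) unfolding eq(1) .
      then have "w = w'" using proper_colouringD[OF c z(2,3) z'(3) z(4)] z'(4) eq(1) by blast
      then show "z = z'" using eq(1) unfolding z(1) z'(1) by simp
    qed
  qed
  also have "\<dots> = (\<Sum>a<C. card (V a))" using finV by simp
  finally have "n * (n - 1) \<le> (\<Sum>a<C. card (V a))" .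
  from power_mean_dichotomy[OF n k this sumk] show ?thesis unfolding D_def by simp
qed

section \<open>From finite bounds to lower growth rates\<close>

text \<open>In a colouring with all colours distinct, two disjoint copies with the same colours
  would share an edge. This makes the \<open>LEAST\<close> in \<open>repeat_number\<close>
  meaningful.\<close>

lemma ex_repeat_free_colouring:
  fixes T :: "'a graph"
  assumes T: "finite_graph T" "edges T \<noteq> {}" and k: "k \<ge> 2"
  shows "\<exists>C c. proper_colouring n C c \<and> (\<nexists>S. is_repeat k T n c S)"
proof -
  have fin: "finite (all_edges {..<n})" by (rule finite_subset[of _ "Pow {..<n}"]) (auto simp: all_edges_def)
  obtain c where c: "bij_betw c (all_edges {..<n}) {..<card (all_edges {..<n})}"
    using ex_bij_betw_finite_nat[OF fin] by (metis atLeast0LessThan)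
  then have inj: "inj_on c (all_edges {..<n})" by (rule bij_betw_imp_inj_on)
  have "proper_colouring n (card (all_edges {..<n})) c"
    unfolding proper_colouring_def complete_graph_def snd_conv
  proof (intro conjI ballI impI)
    show "c \<in> all_edges {..<n} \<rightarrow> {..<card (all_edges {..<n})}" using bij_betwE[OF c] by blast
    show "c e \<noteq> c e'" if "e \<in> all_edges {..<n}" "e' \<in> all_edges {..<n}" "e \<noteq> e' \<and> e \<inter> e' \<noteq> {}" for e e'
      using inj_onD[OF inj _ that(1,2)] that(3) by argo
  qed
  moreover have "\<not> is_repeat k T n c S" for S
  proof
    assume rep: "is_repeat k T n c S"
    have "k \<ge> 1" using k by simp
    from is_repeatD[OF rep T(1) this] obtain \<psi> where
      "(\<forall>G\<in>S. inj_on (\<psi> G) (verts T) \<and> \<psi> G ` verts T \<subseteq> {..<n}) \<and>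
       (\<forall>G\<in>S. \<forall>G'\<in>S. (G \<noteq> G' \<longrightarrow> \<psi> G ` verts T \<inter> \<psi> G' ` verts T = {}) \<and>
        (\<forall>e\<in>edges T. c (\<psi> G ` e) = c (\<psi> G' ` e)))" ..
    note \<psi> = this[THEN conjunct1] this[THEN conjunct2]
    obtain e where e: "e \<in> edges T" using T(2) by blast
    have e2: "e \<subseteq> verts T" "card e = 2" using e T(1) by (auto simp: finite_graph_def all_edges_def)
    have "card S \<ge> 2" using rep k by (simp add: is_repeat_def)
    then obtain S2 where "S2 \<subseteq> S" "card S2 = 2" by (metis obtain_subset_with_card_n)
    then obtain G G' where G: "G \<in> S" "G' \<in> S" "G \<noteq> G'" unfolding card_2_iff by blast
    have mem: "\<psi> H ` e \<in> all_edges {..<n}" if "H \<in> S" for H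
    proof -
      have H: "inj_on (\<psi> H) (verts T)" "\<psi> H ` verts T \<subseteq> {..<n}"
        using bspec[OF \<psi>(1) that] by simp_all
      have "card (\<psi> H ` e) = 2" using card_image[OF inj_on_subset[OF H(1) e2(1)]] e2(2) by simp
      moreover have "\<psi> H ` e \<subseteq> {..<n}" using H(2) e2(1) by blast
      ultimately show ?thesis unfolding all_edges_def by blast
    qed
    note GG' = bspec[OF bspec[OF \<psi>(2) G(1)] G(2)]
    have "c (\<psi> G ` e) = c (\<psi> G' ` e)" using GG' e by blast
    then have "\<psi> G ` e = \<psi> G' ` e" by (rule inj_onD[OF inj _ mem[OF G(1)] mem[OF G(2)]])
    moreover have "\<psi> G ` e \<inter> \<psi> G' ` e = {}" using GG' G(3) e2(1) by blast
    ultimately show False using e2(2) by auto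
  qed
  ultimately show ?thesis by blast
qed

lemma repeat_number_attained:
  fixes T :: "'a graph"
  assumes "finite_graph T" "edges T \<noteq> {}" "k \<ge> 2"
  shows "\<exists>c. proper_colouring n (repeat_number k n T) c \<and> (\<nexists>S. is_repeat k T n c S)"
  unfolding repeat_number_def by (rule LeastI_ex[OF ex_repeat_free_colouring[OF assms]])

lemma repeat_number_le:
  assumes "proper_colouring n C c" "\<nexists>S. is_repeat k T n c S"
  shows "repeat_number k n T \<le> C"
  unfolding repeat_number_def using assms by (intro Least_le exI[of _ c] conjI)

lemma bigomega_powr_of_power_bound:
  fixes f :: "nat \<Rightarrow> nat"
  assumes b: "b \<ge> 1" and ev: "eventually (\<lambda>n. n ^ a \<le> K * f n ^ b) at_top"
  shows "(\<lambda>n. real (f n)) \<in> \<Omega>(\<lambda>n. real n powr (real a / real b))"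
proof (rule landau_omega.bigI)
  \<comment> \<open>\<open>K + 1\<close> in place of \<open>K\<close> avoids a division by zero when
    \<open>K = 0\<close>.\<close>
  define c where "c = (1 / (real K + 1)) powr (1 / real b)"
  show "c > 0" by (simp add: c_def)
  show "eventually (\<lambda>n. norm (real (f n)) \<ge> c * norm (real n powr (real a / real b))) at_top"
    using ev eventually_gt_at_top[of 0]
  proof eventually_elim
    case (elim n)
    have "real (n ^ a) \<le> real (K * f n ^ b)" using elim(1) by (simp only: of_nat_le_iff)
    also have "\<dots> \<le> (real K + 1) * real (f n) ^ b" by (simp add: algebra_simps)
    finally have "real n ^ a / (real K + 1) \<le> real (f n) ^ b" by (simp add: pos_divide_le_eq mult.commute)
    then have "(real n ^ a / (real K + 1)) powr (1 / real b) \<le> (real (f n) ^ b) powr (1 / real b)"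
      by (intro powr_mono2) auto
    also have "(real (f n) ^ b) powr (1 / real b) = real (f n)"
    proof (cases "f n = 0")
      case True
      then show ?thesis using b by (simp add: power_0_left)
    next
      case False
      then show ?thesis using b by (simp add: powr_powr flip: powr_realpow)
    qed
    also have "(real n ^ a / (real K + 1)) powr (1 / real b) = c * real n powr (real a / real b)"
      using elim(2) by (simp add: c_def powr_divide powr_powr flip: powr_realpow)
    finally show ?case by simp
  qed
qed

lemma repeat_number_bigomega_size:
  fixes T :: "'a graph"
  assumes T: "is_tree T" "card (edges T) = m" "m \<ge> 1" and k: "k \<ge> 2"
  shows "(\<lambda>n. real (repeat_number k n T)) \<in> \<Omega>(\<lambda>n. real n powr ((real m + 1) / real m))"
proof -
  have "(\<lambda>n. real (repeat_number k n T)) \<in> \<Omega>(\<lambda>n. real n powr (real (Suc m) / real m))"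
  proof (rule bigomega_powr_of_power_bound[OF T(3), where K = "2 ^ Suc m * (k * (Suc m * Suc m))"])
    have fgT: "finite_graph T" using T(1) by (simp add: is_tree_def)
    have ne: "edges T \<noteq> {}" using T(2,3) by auto
    show "eventually (\<lambda>n. n ^ Suc m \<le> 2 ^ Suc m * (k * (Suc m * Suc m)) * repeat_number k n T ^ m) at_top"
      \<comment> \<open>For such \<open>n\<close> the difference \<open>n - Suc m\<close> is at
        least half of \<open>n\<close>, which costs the factor \<open>2 ^ Suc m\<close>.\<close>
      using eventually_ge_at_top[of "2 * Suc m"]
    proof eventually_elim
      case (elim n)
      obtain c where c: "proper_colouring n (repeat_number k n T) c" "\<nexists>S. is_repeat k T n c S"
        using repeat_number_attained[OF fgT ne k] by blast
      have "k \<ge> 1" using k by simp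
      note bound = repeat_free_tree_size_bound[OF T(1,2) c this]
      have "n ^ Suc m \<le> (2 * (n - Suc m)) ^ Suc m" using elim by (intro power_mono) auto
      also have "\<dots> = 2 ^ Suc m * (n - Suc m) ^ Suc m" by (rule power_mult_distrib)
      also have "\<dots> \<le> 2 ^ Suc m * (k * (Suc m * Suc m) * repeat_number k n T ^ m)"
        by (rule mult_le_mono2[OF bound])
      finally show ?case by (simp only: mult.assoc)
    qed
  qed
  then show ?thesis by (simp add: add.commute)
qed

lemma repeat_number_bigomega_copies:
  fixes T :: "'a graph"
  assumes T: "is_tree T" "edges T \<noteq> {}" and k: "k \<ge> 2"
  shows "(\<lambda>n. real (repeat_number k n T)) \<in> \<Omega>(\<lambda>n. real n powr (real k / (real k - 1)))"
proof -
  define K where "K = 8 ^ k * (2 * (k * k * card (verts T))) + (8 * k) ^ (k - 1)"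
  have k1: "k - 1 \<ge> 1" "k \<ge> 1" using k by auto
  have "(\<lambda>n. real (repeat_number k n T)) \<in> \<Omega>(\<lambda>n. real n powr (real k / real (k - 1)))"
  proof (rule bigomega_powr_of_power_bound[OF k1(1), where K = K])
    have fgT: "finite_graph T" using T(1) by (simp add: is_tree_def)
    show "eventually (\<lambda>n. n ^ k \<le> K * repeat_number k n T ^ (k - 1)) at_top"
      using eventually_ge_at_top[of 2]
    proof eventually_elim
      case (elim n)
      let ?C = "repeat_number k n T"
      obtain c where c: "proper_colouring n ?C c" "\<nexists>S. is_repeat k T n c S"
        using repeat_number_attained[OF fgT T(2) k] by blast
      from repeat_free_tree_tuple_bound[OF T(1) c k1(2) elim]
      show ?case
      proof
        \<comment> \<open>Raised to the power \<open>k - 1\<close> this bounds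
          \<open>n ^ (2 * (k - 1))\<close>, and \<open>k \<le> 2 * (k - 1)\<close> because
          \<open>k \<ge> 2\<close>.\<close>
        assume "n\<^sup>2 \<le> 8 * k * ?C"
        then have "(n\<^sup>2) ^ (k - 1) \<le> (8 * k * ?C) ^ (k - 1)" by (rule power_mono) simp
        also have "\<dots> = (8 * k) ^ (k - 1) * ?C ^ (k - 1)" by (rule power_mult_distrib)
        also have "\<dots> \<le> K * ?C ^ (k - 1)" by (intro mult_le_mono1) (simp add: K_def)
        finally have "n ^ (2 * (k - 1)) \<le> K * ?C ^ (k - 1)" by (simp only: power_mult)
        moreover have "n ^ k \<le> n ^ (2 * (k - 1))" using k elim by (intro power_increasing) auto
        ultimately show ?thesis by (rule order_trans[rotated])
      next
        assume "n ^ k \<le> 8 ^ k * (2 * (k * k * card (verts T))) * ?C ^ (k - 1)"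
        also have "\<dots> \<le> K * ?C ^ (k - 1)" by (intro mult_le_mono1) (simp add: K_def)
        finally show ?thesis .
      qed
    qed
  qed
  then show ?thesis using k by (simp add: of_nat_diff)
qed

section \<open>Bounding the number of solutions of a system of product equations\<close>

text \<open>Comaximality, given by an explicit identity, since such identities are multiplied
  together and expanded below.\<close>

definition bezout_coprime :: "'k::comm_ring_1 \<Rightarrow> 'k \<Rightarrow> bool" where
  "bezout_coprime a b \<longleftrightarrow> (\<exists>u v. u * a + v * b = 1)"

lemma bezout_coprime_prod:
  assumes "finite E" "\<And>e. e \<in> E \<Longrightarrow> bezout_coprime (h e) b"
  shows "bezout_coprime (prod h E) b"
  using assms
proof (induction E)
  case empty
  show ?case unfolding bezout_coprime_def by (intro exI[of _ 1] exI[of _ 0]) simp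
next
  case (insert e E)
  obtain u v where 1: "u * h e + v * b = 1"
    using insert.prems[of e] unfolding bezout_coprime_def by auto
  obtain u' v' where 2: "u' * prod h E + v' * b = 1"
    using insert.IH insert.prems unfolding bezout_coprime_def by blast
  have "(u * h e + v * b) * (u' * prod h E + v' * b) = 1"
    using 1 2 by simp
  then have "(u * u') * (h e * prod h E) + (u * h e * v' + v * u' * prod h E + v * b * v') * b = 1"
    by (simp add: algebra_simps)
  then show ?case unfolding bezout_coprime_def using insert.hyps by auto
qed

text \<open>When \<open>h f\<close> joins the family, take
  \<open>u * prod h E + v * h f = 1\<close>. Its first term is the new summand; the second is
  rewritten as the old identity multiplied by \<open>v * h f\<close>.\<close>

lemma partial_fractions:
  assumes "finite E" "E \<noteq> {}"
    and "\<And>e e'. e \<in> E \<Longrightarrow> e' \<in> E \<Longrightarrow> e \<noteq> e' \<Longrightarrow> bezout_coprime (h e) (h e')"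
  shows "\<exists>A. (\<Sum>e\<in>E. A e * prod h (E - {e})) = (1::'k::comm_ring_1)"
  using assms
proof (induction E rule: finite_ne_induct)
  case (singleton x)
  show ?case by (rule exI[of _ "\<lambda>_. 1"]) simp
next
  case (insert f E)
  obtain A where A: "(\<Sum>e\<in>E. A e * prod h (E - {e})) = 1"
    using insert.IH insert.prems by blast
  have "bezout_coprime (prod h E) (h f)"
    by (rule bezout_coprime_prod) (use insert in auto)
  then obtain u v where uv: "u * prod h E + v * h f = 1"
    unfolding bezout_coprime_def by auto
  let ?A = "\<lambda>e. if e = f then u else v * A e"
  have "(\<Sum>e\<in>insert f E. ?A e * prod h (insert f E - {e}))
      = u * prod h (insert f E - {f}) + (\<Sum>e\<in>E. ?A e * prod h (insert f E - {e}))"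
    using insert.hyps by simp
  also have "insert f E - {f} = E" using insert.hyps by auto
  also have "(\<Sum>e\<in>E. ?A e * prod h (insert f E - {e})) = (\<Sum>e\<in>E. v * h f * (A e * prod h (E - {e})))"
  proof (rule sum.cong)
    fix e assume e: "e \<in> E"
    then have "insert f E - {e} = insert f (E - {e})" using insert.hyps by auto
    then show "?A e * prod h (insert f E - {e}) = v * h f * (A e * prod h (E - {e}))"
      using insert.hyps e by (auto simp: algebra_simps)
  qed simp
  also have "\<dots> = v * h f" using A by (simp flip: sum_distrib_left)
  finally show ?case using uv by metis
qed

lemma degree_prod_const:
  fixes h :: "'e \<Rightarrow> 'k::field poly"
  assumes "\<And>e. e \<in> E \<Longrightarrow> degree (h e) = d" "\<And>e. e \<in> E \<Longrightarrow> h e \<noteq> 0"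
  shows "degree (prod h E) = d * card E"
  using assms by (simp add: degree_prod_eq_sum_degree)

text \<open>Reducing each numerator modulo \<open>h e\<close> changes the sum by a multiple of
  \<open>prod h E\<close>. Both 1 and the reduced sum have degree below \<open>d * card E\<close>,
  so this multiple is zero.\<close>

lemma partial_fractions_degree:
  fixes h :: "'e \<Rightarrow> 'k::field poly"
  assumes fin: "finite E" "E \<noteq> {}"
    and cop: "\<And>e e'. e \<in> E \<Longrightarrow> e' \<in> E \<Longrightarrow> e \<noteq> e' \<Longrightarrow> bezout_coprime (h e) (h e')"
    and deg: "\<And>e. e \<in> E \<Longrightarrow> degree (h e) = d" and "d \<ge> 1"
  shows "\<exists>A. (\<Sum>e\<in>E. A e * prod h (E - {e})) = 1 \<and> (\<forall>e\<in>E. degree (A e) < d)"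
proof -
  obtain A where A: "(\<Sum>e\<in>E. A e * prod h (E - {e})) = 1"
    using partial_fractions[of E h] fin cop by blast
  have nz: "h e \<noteq> 0" if "e \<in> E" for e using deg[OF that] \<open>d \<ge> 1\<close> by auto
  define A' where "A' e = A e mod h e" for e
  define q where "q = (\<Sum>e\<in>E. A e div h e)"
  have dA': "degree (A' e) < d" if "e \<in> E" for e
    using degree_mod_less'[of "h e" "A e"] nz[OF that] deg[OF that] \<open>d \<ge> 1\<close>
    unfolding A'_def by (cases "A e mod h e = 0") auto
  define Z where "Z = (\<Sum>e\<in>E. A' e * prod h (E - {e}))"
  have "1 = (\<Sum>e\<in>E. (A e div h e) * prod h E + A' e * prod h (E - {e}))"
  proof -
    have "A e * prod h (E - {e}) = (A e div h e) * prod h E + A' e * prod h (E - {e})" if "e \<in> E" for e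
    proof -
      have "prod h E = h e * prod h (E - {e})" using fin that by (simp add: prod.remove)
      then have "(A e div h e) * prod h E + A' e * prod h (E - {e}) = (A e div h e * h e + A' e) * prod h (E - {e})"
        by (simp add: algebra_simps)
      then show ?thesis unfolding A'_def by simp
    qed
    then show ?thesis using A by (metis (mono_tags, lifting) sum.cong)
  qed
  also have "\<dots> = q * prod h E + Z"
    unfolding q_def Z_def by (simp add: sum.distrib sum_distrib_right)
  finally have 1: "1 - Z = q * prod h E" by (simp add: diff_eq_eq)
  have cE: "card E \<ge> 1" using fin by (simp add: card_gt_0_iff Suc_leI)
  have dZ: "degree Z < d * card E"
    unfolding Z_def
  proof (rule degree_sum_less)
    fix e assume e: "e \<in> E"
    have "degree (A' e * prod h (E - {e})) \<le> degree (A' e) + degree (prod h (E - {e}))"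
      by (rule degree_mult_le)
    also have "degree (prod h (E - {e})) = d * card (E - {e})"
      by (rule degree_prod_const) (use deg nz in auto)
    also have "degree (A' e) + d * card (E - {e}) < d + d * card (E - {e})"
      using dA'[OF e] by simp
    also have "\<dots> = d * card E" using e fin cE by (simp add: card_Diff_singleton algebra_simps)
    finally show "degree (A' e * prod h (E - {e})) < d * card E" .
  qed (use \<open>d \<ge> 1\<close> cE in auto)
  have "q = 0"
  proof (rule ccontr)
    assume "q \<noteq> 0"
    have "prod h E \<noteq> 0" using nz fin by simp
    then have "degree (q * prod h E) = degree q + d * card E"
      using \<open>q \<noteq> 0\<close> degree_prod_const[of E h d] deg nz by (simp add: degree_mult_eq)
    moreover have "degree (1 - Z) < d * card E"
      using dZ \<open>d \<ge> 1\<close> cE by (intro degree_diff_less) auto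
    ultimately show False using 1 by simp
  qed
  then have "Z = 1" using 1 by simp
  then show ?thesis using dA' unfolding Z_def by blast
qed


section \<open>The space of functions on the solution set\<close>

lemma sum_fun_apply: "(\<Sum>x\<in>A. f x) p = (\<Sum>x\<in>A. f x p)"
  by (induction A rule: infinite_finite_induct) auto

text \<open>Pointwise operations on functions. What is used is the span and the bound of an
  independent set by a finite spanning set.\<close>

interpretation funspace: vector_space "\<lambda>(c::'k::field) (f :: 'p \<Rightarrow> 'k) p. c * f p"
  by standard (auto simp: algebra_simps fun_eq_iff)

abbreviation fun_span :: "('p \<Rightarrow> 'k::field) set \<Rightarrow> ('p \<Rightarrow> 'k) set" where
  "fun_span \<equiv> funspace.span"

text \<open>\<open>\<xi> j p\<close> is coordinate \<open>j\<close> of the point \<open>p\<close>.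
  The value 0 outside \<open>S\<close> turns identities valid on the solution set into equalities of
  functions.\<close>

definition monomial_on :: "nat \<Rightarrow> (nat \<Rightarrow> 'p \<Rightarrow> 'k::field) \<Rightarrow> 'p set \<Rightarrow> (nat \<Rightarrow> nat) \<Rightarrow> 'p \<Rightarrow> 'k" where
  "monomial_on m \<xi> S a = (\<lambda>p. if p \<in> S then \<Prod>j<m. \<xi> j p ^ a j else 0)"

definition poly_prod_on :: "nat \<Rightarrow> (nat \<Rightarrow> 'p \<Rightarrow> 'k::field) \<Rightarrow> 'p set \<Rightarrow> (nat \<Rightarrow> 'k poly) \<Rightarrow> 'p \<Rightarrow> 'k" where
  "poly_prod_on m \<xi> S P = (\<lambda>p. if p \<in> S then \<Prod>j<m. poly (P j) (\<xi> j p) else 0)"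

lemma monomial_on_cong: "(\<And>j. j < m \<Longrightarrow> a j = b j) \<Longrightarrow> monomial_on m \<xi> S a = monomial_on m \<xi> S b"
  by (auto simp: monomial_on_def fun_eq_iff intro: prod.cong)

lemma poly_prod_on_expand:
  "poly_prod_on m \<xi> S P = (\<Sum>g\<in>(\<Pi>\<^sub>E j\<in>{..<m}. {..degree (P j)}).
     (\<lambda>p. (\<Prod>j<m. coeff (P j) (g j)) * monomial_on m \<xi> S g p))"
proof
  fix p
  show "poly_prod_on m \<xi> S P p = (\<Sum>g\<in>(\<Pi>\<^sub>E j\<in>{..<m}. {..degree (P j)}).
     (\<lambda>p. (\<Prod>j<m. coeff (P j) (g j)) * monomial_on m \<xi> S g p)) p"
    by (simp add: poly_prod_on_def monomial_on_def poly_altdef prod_sum_PiE prod.distrib sum_fun_apply)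
qed

lemma poly_prod_on_in_span:
  assumes "\<And>b. (\<And>j. j < m \<Longrightarrow> b j \<le> degree (P j)) \<Longrightarrow> monomial_on m \<xi> S b \<in> V"
  shows "poly_prod_on m \<xi> S P \<in> fun_span V"
  unfolding poly_prod_on_expand
proof (intro funspace.span_sum funspace.span_scale funspace.span_base assms)
  fix g j assume "g \<in> (\<Pi>\<^sub>E j\<in>{..<m}. {..degree (P j)})" "j < m"
  then show "g j \<le> degree (P j)" by (auto simp: PiE_iff)
qed

text \<open>In the expanded product the monomial \<open>a\<close> has coefficient 1, and every other
  monomial has exponents at most those of \<open>a\<close> and one that is smaller. So a monomial
  can be traded for a product of monic polynomials.\<close>

lemma poly_prod_on_diff_leading_in_span:
  assumes lead: "\<And>j. j < m \<Longrightarrow> lead_coeff (P j) = 1" "\<And>j. j < m \<Longrightarrow> degree (P j) = a j"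
    and V: "\<And>b. (\<And>j. j < m \<Longrightarrow> b j \<le> a j) \<Longrightarrow> (\<exists>j<m. b j < a j) \<Longrightarrow> monomial_on m \<xi> S b \<in> V"
  shows "poly_prod_on m \<xi> S P - monomial_on m \<xi> S a \<in> fun_span V"
proof -
  define G where "G = (\<Pi>\<^sub>E j\<in>{..<m}. {..degree (P j)})"
  define a' where "a' = restrict a {..<m}"
  have a': "a' \<in> G" using lead(2) by (auto simp: a'_def G_def)
  have [simp]: "finite G" unfolding G_def by (intro finite_PiE) auto
  have "(\<Prod>j<m. coeff (P j) (a' j)) = 1"
    by (rule prod.neutral) (use lead in \<open>auto simp: a'_def\<close>)
  then have "poly_prod_on m \<xi> S P = (\<lambda>p. 1 * monomial_on m \<xi> S a' p) +
      (\<Sum>g\<in>G - {a'}. (\<lambda>p. (\<Prod>j<m. coeff (P j) (g j)) * monomial_on m \<xi> S g p))"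
    unfolding poly_prod_on_expand G_def[symmetric] using a' by (simp add: sum.remove)
  also have "(\<lambda>p. 1 * monomial_on m \<xi> S a' p) = monomial_on m \<xi> S a"
    by (simp add: a'_def) (rule monomial_on_cong, simp)
  finally have "poly_prod_on m \<xi> S P - monomial_on m \<xi> S a =
     (\<Sum>g\<in>G - {a'}. (\<lambda>p. (\<Prod>j<m. coeff (P j) (g j)) * monomial_on m \<xi> S g p))"
    by (simp only: add_diff_cancel_left')
  also have "\<dots> \<in> fun_span V"
  proof (intro funspace.span_sum funspace.span_scale funspace.span_base V)
    fix g j assume g: "g \<in> G - {a'}" and "j < m"
    then show "g j \<le> a j" using lead(2) by (auto simp: G_def PiE_iff)
  next
    fix g assume g: "g \<in> G - {a'}"
    have le: "g j \<le> a j" if "j < m" for j using g lead(2) that by (auto simp: G_def PiE_iff)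
    show "\<exists>j<m. g j < a j"
    proof (rule ccontr)
      assume "\<not> (\<exists>j<m. g j < a j)"
      then have "g j = a' j" if "j < m" for j using le[OF that] that by (force simp: a'_def)
      then have "g = a'" using g a' unfolding G_def
        by (intro PiE_ext[of g "{..<m}" _ a']) auto
      then show False using g by simp
    qed
  qed
  finally show ?thesis .
qed

text \<open>The indicators of the points of \<open>S\<close> are linearly independent: evaluating a
  relation at \<open>s\<close> isolates one coefficient.\<close>

lemma card_le_of_indicators_in_span:
  fixes V :: "('p \<Rightarrow> 'k::field) set"
  assumes "finite V" "\<And>s. s \<in> S \<Longrightarrow> (\<lambda>p. if p = s then 1 else 0) \<in> fun_span V"
  shows "finite S \<and> card S \<le> card V"
proof -
  define \<delta> :: "'p \<Rightarrow> 'p \<Rightarrow> 'k" where "\<delta> s = (\<lambda>p. if p = s then 1 else 0)" for s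
  have inj: "inj \<delta>" by (rule injI) (metis \<delta>_def zero_neq_one)
  have "funspace.independent (\<delta> ` S)"
    unfolding funspace.independent_explicit_finite_subsets
  proof (intro allI impI ballI)
    fix A u v
    assume A: "A \<subseteq> \<delta> ` S" "finite A" and 0: "(\<Sum>v\<in>A. (\<lambda>p. u v * v p)) = 0" and "v \<in> A"
    then obtain s where s: "v = \<delta> s" by auto
    have "0 = (\<Sum>v\<in>A. u v * v s)" using fun_cong[OF 0, of s] by (simp add: sum_fun_apply)
    also have "\<dots> = (\<Sum>w\<in>A. if w = v then u v else 0)"
    proof (rule sum.cong)
      fix w assume "w \<in> A"
      then obtain r where r: "w = \<delta> r" using A by auto
      then have "w = v \<longleftrightarrow> r = s" using s inj by (simp add: inj_eq)
      moreover have "w s = (if r = s then 1 else 0)" using r by (auto simp: \<delta>_def)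
      ultimately show "u w * w s = (if w = v then u v else 0)" by auto
    qed simp
    also have "\<dots> = u v" using \<open>v \<in> A\<close> A by simp
    finally show "u v = 0" by simp
  qed
  moreover have "\<delta> ` S \<subseteq> fun_span V" using assms(2) by (auto simp: \<delta>_def)
  ultimately have "finite (\<delta> ` S) \<and> card (\<delta> ` S) \<le> card V"
    using funspace.independent_span_bound[OF assms(1)] by blast
  moreover have "inj_on \<delta> S" using inj by (rule inj_on_subset) simp
  ultimately show ?thesis by (simp add: card_image finite_image_iff)
qed


section \<open>Reduction of exponents and the solution count\<close>

text \<open>Pigeonhole: the other \<open>m - 1\<close> exponents meet at most \<open>m - 1\<close>
  of the first \<open>m\<close> blocks of length \<open>g\<close>. A free block is the gap, and
  \<open>a j0\<close> lies above all of them.\<close>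

lemma ex_gap:
  fixes a :: "nat \<Rightarrow> nat"
  assumes "j0 < m" "m * g \<le> a j0"
  obtains \<theta> where "\<theta> + g \<le> a j0" "\<And>j. j < m \<Longrightarrow> a j < \<theta> \<or> \<theta> + g \<le> a j"
proof -
  have "card ((\<lambda>j. a j div g) ` ({..<m} - {j0})) \<le> card ({..<m} - {j0})"
    by (rule card_image_le) simp
  also have "\<dots> < card {..<m}" using assms(1) by simp
  finally have "\<not> {..<m} \<subseteq> (\<lambda>j. a j div g) ` ({..<m} - {j0})"
    by (meson card_mono finite_Diff finite_imageI finite_lessThan not_le)
  then obtain i where i: "i < m" "\<And>j. j < m \<Longrightarrow> j \<noteq> j0 \<Longrightarrow> a j div g \<noteq> i" by blast
  have 0: "i * g + g \<le> a j0"
    using assms(2) mult_le_mono1[of "Suc i" m g] i(1) by simp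
  show thesis
  proof (rule that[of "i * g"])
    fix j assume "j < m"
    show "a j < i * g \<or> i * g + g \<le> a j"
    proof (cases "j = j0 \<or> g = 0")
      case True then show ?thesis using 0 by auto
    next
      case False
      then have "a j div g < i \<or> a j div g \<ge> Suc i" using i(2)[OF \<open>j < m\<close>] by linarith
      then show ?thesis
        using False by (auto simp: div_less_iff_less_mult less_eq_div_iff_mult_less_eq)
    qed
  qed (fact 0)
qed

text \<open>The termination measure of \<open>monomial_on_in_span\<close> decreases. With base
  \<open>m + 1\<close>, one old exponent above \<open>N\<close> outweighs all new exponents below
  \<open>N\<close> together, however much these have grown.\<close>

lemma sum_powers_less:
  fixes a b :: "nat \<Rightarrow> nat"
  assumes J: "J \<subseteq> {..<m}" "J \<noteq> {}"
    and "\<And>j. j \<in> J \<Longrightarrow> b j < a j" "\<And>j. j \<in> J \<Longrightarrow> N < a j"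
    and "\<And>j. j < m \<Longrightarrow> j \<notin> J \<Longrightarrow> b j < N"
  shows "(\<Sum>j<m. (m + 1) ^ b j) < (\<Sum>j<m. (m + 1) ^ a j)"
proof -
  let ?R = "m + 1"
  have fJ: "finite J" using J finite_subset by blast
  have m: "m \<ge> 1" using J by (cases m) auto
  have split: "(\<Sum>j<m. f j) = (\<Sum>j\<in>J. f j) + (\<Sum>j\<in>{..<m} - J. f j)" for f :: "nat \<Rightarrow> nat"
    using J by (metis add.commute finite_lessThan sum.subset_diff)
  have 1: "?R * (\<Sum>j\<in>J. ?R ^ b j) \<le> (\<Sum>j\<in>J. ?R ^ a j)"
    unfolding sum_distrib_left
  proof (rule sum_mono)
    fix j assume "j \<in> J"
    then have "?R ^ Suc (b j) \<le> ?R ^ a j" using assms(3) by (intro power_increasing) (auto simp: Suc_le_eq)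
    then show "?R * ?R ^ b j \<le> ?R ^ a j" by simp
  qed
  have "?R * (\<Sum>j\<in>{..<m} - J. ?R ^ b j) \<le> (\<Sum>j\<in>{..<m} - J. ?R ^ N)"
    unfolding sum_distrib_left
  proof (rule sum_mono)
    fix j assume "j \<in> {..<m} - J"
    then have "?R ^ Suc (b j) \<le> ?R ^ N" using assms(5) by (intro power_increasing) (auto simp: Suc_le_eq)
    then show "?R * ?R ^ b j \<le> ?R ^ N" by simp
  qed
  also have "\<dots> = card ({..<m} - J) * ?R ^ N" by simp
  also have "\<dots> \<le> m * ?R ^ N" using card_mono[of "{..<m}" "{..<m} - J"] by simp
  also have "\<dots> < ?R * ?R ^ N" by simp
  also have "\<dots> \<le> (\<Sum>j\<in>J. ?R ^ a j)"
  proof -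
    obtain j where j: "j \<in> J" using J by blast
    have "?R ^ Suc N \<le> ?R ^ a j" using assms(4)[OF j] by (intro power_increasing) auto
    also have "\<dots> \<le> (\<Sum>j\<in>J. ?R ^ a j)" using fJ j by (intro member_le_sum) auto
    finally show ?thesis by simp
  qed
  finally have "?R * (\<Sum>j<m. ?R ^ b j) < 2 * (\<Sum>j\<in>J. ?R ^ a j)"
    using 1 unfolding split[of "\<lambda>j. ?R ^ b j"] by (simp only: distrib_left)
  also have "\<dots> \<le> ?R * (\<Sum>j<m. ?R ^ a j)"
    using m split[of "\<lambda>j. ?R ^ a j"] by (intro mult_mono) auto
  finally show ?thesis by (simp only: mult_less_cancel1)
qed

text \<open>
  On the solution set every monomial reduces to monomials with small exponents. Choose a gap in the
  exponents and let \<open>J\<close> be the set of coordinates above it. For the coordinates outside \<open>J\<close> multiply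
  the partial fraction identities \<open>\<Sum>\<^sub>e A\<^sub>e \<Prod>\<^bsub>e' \<noteq> e\<^esub> h\<^sub>e\<^sub>' = 1\<close>. Each term of the expansion singles out at most
  \<open>m - 1\<close> equations, so it contains all factors of some other equation outside \<open>J\<close>; together with the
  factors of that equation inside \<open>J\<close> they are replaced by the constant \<open>t\<close>. This lowers all exponents
  in \<open>J\<close> and raises the others by less than the gap.
\<close>

lemma monomial_on_in_span:
  fixes \<xi> :: "nat \<Rightarrow> 'p \<Rightarrow> 'k::field" and h :: "nat \<Rightarrow> nat \<Rightarrow> 'k poly"
  assumes d: "d \<ge> 1"
    and deg: "\<And>e j. e < m \<Longrightarrow> j < m \<Longrightarrow> degree (h e j) = d"
    and lead: "\<And>e j. e < m \<Longrightarrow> j < m \<Longrightarrow> lead_coeff (h e j) = 1"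
    and cop: "\<And>e e' j. e < m \<Longrightarrow> e' < m \<Longrightarrow> j < m \<Longrightarrow> e \<noteq> e' \<Longrightarrow> bezout_coprime (h e j) (h e' j)"
    and sol: "\<And>p e. p \<in> S \<Longrightarrow> e < m \<Longrightarrow> (\<Prod>j<m. poly (h e j) (\<xi> j p)) = t e"
  shows "monomial_on m \<xi> S a \<in> fun_span (monomial_on m \<xi> S ` (\<Pi>\<^sub>E j\<in>{..<m}. {..<m * (d * m + 1)}))"
    (is "_ \<in> fun_span ?V")
proof (induction a rule: measure_induct_rule[of "\<lambda>a. \<Sum>j<m. (m + 1) ^ a j"])
  case (less a)
  define g where "g = d * m + 1"
  show ?case
  proof (cases "\<forall>j<m. a j < m * g")
    case True
    have "monomial_on m \<xi> S a = monomial_on m \<xi> S (restrict a {..<m})"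
      by (rule monomial_on_cong) simp
    also have "\<dots> \<in> ?V" using True by (auto simp: g_def)
    finally show ?thesis by (rule funspace.span_base)
  next
    case False
    then obtain j0 where j0: "j0 < m" "m * g \<le> a j0" by auto
    obtain \<theta> where \<theta>: "\<theta> + g \<le> a j0" "\<And>j. j < m \<Longrightarrow> a j < \<theta> \<or> \<theta> + g \<le> a j"
      using ex_gap[of j0 m g a] j0 by metis
    define J where "J = {j. j < m \<and> \<theta> + g \<le> a j}"
    have J: "J \<subseteq> {..<m}" "J \<noteq> {}" using j0 \<theta> by (auto simp: J_def)
    have notJ: "a j < \<theta>" if "j < m" "j \<notin> J" for j using that \<theta>(2) by (auto simp: J_def)
    have inJ: "\<theta> + g \<le> a j" "j < m" if "j \<in> J" for j using that by (auto simp: J_def)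
    have hnz: "h e j \<noteq> 0" if "e < m" "j < m" for e j using lead[OF that] by auto
    \<comment> \<open>Each \<open>P j\<close> is monic of degree \<open>a j\<close>. Inside
      \<open>J\<close> it carries the factors of all \<open>m\<close> equations, for which
      \<open>g > d * m\<close> leaves room.\<close>
    define P where "P j = (if j \<in> J then monom 1 (a j - d * m) * (\<Prod>e<m. h e j) else monom 1 (a j))" for j
    have degprod: "degree (\<Prod>e\<in>E. h e j) = d * card E" if "E \<subseteq> {..<m}" "j < m" for E j
      by (rule degree_prod_const) (use that deg hnz in auto)
    have prodnz: "(\<Prod>e\<in>E. h e j) \<noteq> 0" if "E \<subseteq> {..<m}" "j < m" for E j
      using hnz that finite_subset[OF that(1)] by auto
    have degP: "degree (P j) = a j" if "j < m" for j
      using that inJ[of j] degprod[of "{..<m}" j] prodnz[of "{..<m}" j]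
      by (cases "j \<in> J") (simp_all add: P_def degree_mult_eq monom_eq_0_iff degree_monom_eq g_def)
    have leadP: "lead_coeff (P j) = 1" if "j < m" for j
      using that lead by (simp add: P_def lead_coeff_mult lead_coeff_prod degree_monom_eq)
    have "poly_prod_on m \<xi> S P - monomial_on m \<xi> S a \<in> fun_span (fun_span ?V)"
    proof (rule poly_prod_on_diff_leading_in_span[OF leadP degP])
      fix b assume b: "\<And>j. j < m \<Longrightarrow> b j \<le> a j" "\<exists>j<m. b j < a j"
      show "monomial_on m \<xi> S b \<in> fun_span ?V"
      proof (rule less.IH, rule sum_strict_mono_ex1)
        show "\<forall>j\<in>{..<m}. (m + 1) ^ b j \<le> (m + 1) ^ a j"
          using b(1) by (auto intro: power_increasing)
        show "\<exists>j\<in>{..<m}. (m + 1) ^ b j < (m + 1) ^ a j"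
          using b(2) j0(1) by (auto intro!: power_strict_increasing)
      qed simp
    qed
    moreover have "poly_prod_on m \<xi> S P \<in> fun_span ?V"
    proof -
      have "\<exists>A. (\<Sum>e<m. A e * (\<Prod>e'\<in>{..<m} - {e}. h e' j)) = 1 \<and> (\<forall>e\<in>{..<m}. degree (A e) < d)"
        if "j < m" for j
        using partial_fractions_degree[of "{..<m}" "\<lambda>e. h e j" d] cop deg d that by auto
      then obtain A where A: "\<And>j. j < m \<Longrightarrow> (\<Sum>e<m. A j e * (\<Prod>e'\<in>{..<m} - {e}. h e' j)) = 1"
          "\<And>j e. j < m \<Longrightarrow> e < m \<Longrightarrow> degree (A j e) < d"
        by (metis lessThan_iff)
      \<comment> \<open>The index \<open>m\<close>, which belongs to no equation, marks the
        coordinates in \<open>J\<close>, where nothing is expanded.\<close>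
      define D where "D j = (if j \<in> J then {m} else {..<m})" for j
      define f where "f j e = (if j \<in> J then P j else P j * (A j e * (\<Prod>e'\<in>{..<m} - {e}. h e' j)))" for j e
      have sumf: "(\<Sum>e\<in>D j. poly (f j e) x) = poly (P j) x" if "j < m" for j x
      proof (cases "j \<in> J")
        case False
        have "(\<Sum>e<m. P j * (A j e * (\<Prod>e'\<in>{..<m} - {e}. h e' j))) = P j"
          using A(1)[OF that] by (simp flip: sum_distrib_left)
        from arg_cong[OF this, of "\<lambda>P. poly P x"] show ?thesis using False
          by (simp add: D_def f_def poly_sum)
      qed (simp add: D_def f_def)
      define T where "T = (\<Pi>\<^sub>E j\<in>{..<m}. D j)"
      have "\<exists>e<m. e \<notin> \<tau> ` {..<m}" if "\<tau> \<in> T" for \<tau>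
      proof -
        have "card (\<tau> ` ({..<m} - J)) \<le> card ({..<m} - J)" by (rule card_image_le) simp
        also have "\<dots> < card {..<m}" using J by (intro psubset_card_mono) auto
        finally have "\<not> {..<m} \<subseteq> \<tau> ` ({..<m} - J)"
          by (meson card_mono finite_Diff finite_imageI finite_lessThan not_le)
        then obtain e where "e < m" "e \<notin> \<tau> ` ({..<m} - J)" by auto
        moreover have "\<tau> j = m" if "j \<in> J" for j
          using \<open>\<tau> \<in> T\<close> inJ(2)[OF that] that by (force simp: T_def D_def PiE_iff)
        ultimately have "e \<notin> \<tau> ` {..<m}" by (fastforce simp: image_iff)
        with \<open>e < m\<close> show ?thesis by blast
      qed
      then obtain \<epsilon> where \<epsilon>: "\<And>\<tau>. \<tau> \<in> T \<Longrightarrow> \<epsilon> \<tau> < m" "\<And>\<tau>. \<tau> \<in> T \<Longrightarrow> \<epsilon> \<tau> \<notin> \<tau> ` {..<m}" by metis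
      \<comment> \<open>The rest of the term \<open>\<tau>\<close> after removal of one factor of
        equation \<open>\<epsilon> \<tau>\<close> in every coordinate; on \<open>S\<close> the
        removed factors multiply to \<open>t (\<epsilon> \<tau>)\<close>.\<close>
      define Q where "Q \<tau> j = (if j \<in> J then monom 1 (a j - d * m) * (\<Prod>e\<in>{..<m} - {\<epsilon> \<tau>}. h e j)
         else monom 1 (a j) * (A j (\<tau> j) * (\<Prod>e\<in>{..<m} - {\<tau> j} - {\<epsilon> \<tau>}. h e j)))" for \<tau> j
      have fQ: "f j (\<tau> j) = h (\<epsilon> \<tau>) j * Q \<tau> j" if "\<tau> \<in> T" "j < m" for \<tau> j
      proof (cases "j \<in> J")
        case True
        have "(\<Prod>e<m. h e j) = h (\<epsilon> \<tau>) j * (\<Prod>e\<in>{..<m} - {\<epsilon> \<tau>}. h e j)"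
          using \<epsilon>(1)[OF that(1)] by (intro prod.remove) auto
        then show ?thesis using True by (simp add: f_def Q_def P_def algebra_simps)
      next
        case False
        have "\<epsilon> \<tau> \<noteq> \<tau> j" using \<epsilon>(2)[OF that(1)] that(2) by auto
        then have "(\<Prod>e\<in>{..<m} - {\<tau> j}. h e j) = h (\<epsilon> \<tau>) j * (\<Prod>e\<in>{..<m} - {\<tau> j} - {\<epsilon> \<tau>}. h e j)"
          using \<epsilon>(1)[OF that(1)] by (intro prod.remove) auto
        then show ?thesis using False by (simp add: f_def Q_def P_def algebra_simps)
      qed
      have "poly_prod_on m \<xi> S P = (\<Sum>\<tau>\<in>T. (\<lambda>p. t (\<epsilon> \<tau>) * poly_prod_on m \<xi> S (Q \<tau>) p))"
      proof
        fix p
        show "poly_prod_on m \<xi> S P p = (\<Sum>\<tau>\<in>T. (\<lambda>p. t (\<epsilon> \<tau>) * poly_prod_on m \<xi> S (Q \<tau>) p)) p"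
        proof (cases "p \<in> S")
          case True
          have "(\<Prod>j<m. poly (P j) (\<xi> j p)) = (\<Prod>j<m. \<Sum>e\<in>D j. poly (f j e) (\<xi> j p))"
            using sumf by (intro prod.cong) auto
          also have "\<dots> = (\<Sum>\<tau>\<in>T. \<Prod>j<m. poly (f j (\<tau> j)) (\<xi> j p))"
            unfolding T_def by (rule prod_sum_PiE) (auto simp: D_def)
          also have "\<dots> = (\<Sum>\<tau>\<in>T. t (\<epsilon> \<tau>) * (\<Prod>j<m. poly (Q \<tau> j) (\<xi> j p)))"
          proof (rule sum.cong)
            fix \<tau> assume \<tau>: "\<tau> \<in> T"
            have "(\<Prod>j<m. poly (f j (\<tau> j)) (\<xi> j p)) = (\<Prod>j<m. poly (h (\<epsilon> \<tau>) j) (\<xi> j p) * poly (Q \<tau> j) (\<xi> j p))"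
              using fQ[OF \<tau>] by (intro prod.cong) auto
            then show "(\<Prod>j<m. poly (f j (\<tau> j)) (\<xi> j p)) = t (\<epsilon> \<tau>) * (\<Prod>j<m. poly (Q \<tau> j) (\<xi> j p))"
              using sol[OF True \<epsilon>(1)[OF \<tau>]] by (simp add: prod.distrib)
          qed simp
          finally show ?thesis using True by (simp add: poly_prod_on_def sum_fun_apply)
        qed (simp add: poly_prod_on_def sum_fun_apply)
      qed
      also have "\<dots> \<in> fun_span (fun_span ?V)"
      proof (intro funspace.span_sum funspace.span_scale poly_prod_on_in_span)
        fix \<tau> b assume \<tau>: "\<tau> \<in> T" and b: "\<And>j. j < m \<Longrightarrow> b j \<le> degree (Q \<tau> j)"
        \<comment> \<open>The threshold is \<open>\<theta> + d * m\<close>. Outside \<open>J\<close>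
          the degree is at most \<open>a j + (d - 1) + d * (m - 1)\<close> with
          \<open>a j < \<theta>\<close>, hence below it; inside \<open>J\<close> the old exponents
          are above it and all have dropped.\<close>
        show "monomial_on m \<xi> S b \<in> fun_span ?V"
        proof (rule less.IH, rule sum_powers_less[OF J])
          fix j assume j: "j \<in> J"
          have "degree (Q \<tau> j) \<le> (a j - d * m) + d * card ({..<m} - {\<epsilon> \<tau>})"
            unfolding Q_def using j degprod[of "{..<m} - {\<epsilon> \<tau>}" j] inJ[OF j]
            by (auto intro!: order.trans[OF degree_mult_le] simp: degree_monom_eq)
          also have "card ({..<m} - {\<epsilon> \<tau>}) = m - 1" using \<epsilon>(1)[OF \<tau>] by simp
          also have "(a j - d * m) + d * (m - 1) < a j"
          proof -
            have "d * (m - 1) < d * m" using d j0(1) by simp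
            then show ?thesis using inJ(1)[OF j] unfolding g_def by linarith
          qed
          finally show "b j < a j" using b[of j] inJ[OF j] by simp
          show "\<theta> + d * m < a j" using inJ[OF j] by (simp add: g_def)
        next
          fix j assume j: "j < m" "j \<notin> J"
          have \<tau>j: "\<tau> j < m" using \<tau> j by (force simp: T_def D_def PiE_iff)
          have "degree (Q \<tau> j) \<le> a j + (degree (A j (\<tau> j)) + d * card ({..<m} - {\<tau> j} - {\<epsilon> \<tau>}))"
            unfolding Q_def using j degprod[of "{..<m} - {\<tau> j} - {\<epsilon> \<tau>}" j, OF _ j(1)]
            by (force intro!: order.trans[OF degree_mult_le] simp: degree_monom_eq)
          also have "\<dots> \<le> a j + ((d - 1) + d * (m - 1))"
          proof -
            have "card ({..<m} - {\<tau> j} - {\<epsilon> \<tau>}) \<le> card ({..<m} - {\<tau> j})" by (rule card_mono) auto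
            then have "card ({..<m} - {\<tau> j} - {\<epsilon> \<tau>}) \<le> m - 1" using \<tau>j by simp
            then show ?thesis using A(2)[OF j(1) \<tau>j] by (intro add_mono mult_le_mono2) auto
          qed
          also have "\<dots> < \<theta> + d * m"
          proof -
            have "d * m = d * (m - 1) + d" using j by (cases m) auto
            then show ?thesis using notJ[OF j] d by simp
          qed
          finally show "b j < \<theta> + d * m" using b[OF j(1)] by simp
        qed
      qed
      finally show ?thesis by (simp add: funspace.span_span)
    qed
    ultimately have "poly_prod_on m \<xi> S P - (poly_prod_on m \<xi> S P - monomial_on m \<xi> S a) \<in> fun_span ?V"
      by (simp only: funspace.span_span funspace.span_diff)
    then show ?thesis by (simp add: fun_eq_iff)
  qed
qed

text \<open>By Lagrange interpolation in the injective coordinate \<open>\<xi> 0\<close>, the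
  indicator of each point of \<open>S\<close> is a polynomial in the coordinates. By the reduction
  it lies in the span of the monomials with exponents below \<open>m * (d * m + 1)\<close>, and
  these are counted.\<close>

lemma card_common_solutions_le:
  fixes \<xi> :: "nat \<Rightarrow> 'p \<Rightarrow> 'k::field" and h :: "nat \<Rightarrow> nat \<Rightarrow> 'k poly"
  assumes m: "m \<ge> 1" and d: "d \<ge> 1"
    and deg: "\<And>e j. e < m \<Longrightarrow> j < m \<Longrightarrow> degree (h e j) = d"
    and lead: "\<And>e j. e < m \<Longrightarrow> j < m \<Longrightarrow> lead_coeff (h e j) = 1"
    and cop: "\<And>e e' j. e < m \<Longrightarrow> e' < m \<Longrightarrow> j < m \<Longrightarrow> e \<noteq> e' \<Longrightarrow> bezout_coprime (h e j) (h e' j)"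
    and sol: "\<And>p e. p \<in> S \<Longrightarrow> e < m \<Longrightarrow> (\<Prod>j<m. poly (h e j) (\<xi> j p)) = t e"
    and inj: "inj_on (\<xi> 0) S" and fin: "finite S"
  shows "card S \<le> (m * (d * m + 1)) ^ m"
proof -
  define I where "I = (\<Pi>\<^sub>E j\<in>{..<m}. {..<m * (d * m + 1)})"
  define V where "V = monomial_on m \<xi> S ` I"
  have fI: "finite I" unfolding I_def by (intro finite_PiE) auto
  have span: "monomial_on m \<xi> S a \<in> fun_span V" for a
    unfolding V_def I_def using d deg lead cop sol by (rule monomial_on_in_span)
  have "finite S \<and> card S \<le> card V"
  proof (rule card_le_of_indicators_in_span)
    show "finite V" unfolding V_def using fI by simp
    fix s assume s: "s \<in> S"
    define L where "L = (\<Prod>y\<in>S - {s}. smult (inverse (\<xi> 0 s - \<xi> 0 y)) [:- \<xi> 0 y, 1:])"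
    have L: "poly L (\<xi> 0 p) = (if p = s then 1 else 0)" if p: "p \<in> S" for p
    proof (cases "p = s")
      case True
      have "poly L (\<xi> 0 s) = (\<Prod>y\<in>S - {s}. inverse (\<xi> 0 s - \<xi> 0 y) * (\<xi> 0 s - \<xi> 0 y))"
        by (simp add: L_def poly_prod algebra_simps)
      also have "\<dots> = 1"
        by (rule prod.neutral) (use s inj in \<open>auto simp: inj_on_eq_iff intro!: left_inverse\<close>)
      finally show ?thesis using True by simp
    next
      case False
      then show ?thesis using p fin by (auto simp: L_def poly_prod intro!: prod_zero)
    qed
    have "(\<lambda>p. if p = s then 1 else 0) = poly_prod_on m \<xi> S (\<lambda>j. if j = 0 then L else 1)"
    proof
      fix p
      show "(if p = s then 1 else 0) = poly_prod_on m \<xi> S (\<lambda>j. if j = 0 then L else 1) p"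
      proof (cases "p \<in> S")
        case True
        have "(\<Prod>j<m. poly (if j = 0 then L else 1) (\<xi> j p)) = (\<Prod>j<m. if j = 0 then poly L (\<xi> 0 p) else 1)"
          by (intro prod.cong) auto
        also have "\<dots> = poly L (\<xi> 0 p)" using m by (simp add: prod.delta)
        finally show ?thesis using True L by (simp add: poly_prod_on_def)
      qed (use s in \<open>auto simp: poly_prod_on_def\<close>)
    qed
    also have "\<dots> \<in> fun_span (fun_span V)" by (rule poly_prod_on_in_span) (rule span)
    finally show "(\<lambda>p. if p = s then 1 else 0) \<in> fun_span V" by (simp add: funspace.span_span)
  qed
  then have "card S \<le> card V" by simp
  also have "card V \<le> card I" unfolding V_def by (rule card_image_le[OF fI])
  also have "card I = (m * (d * m + 1)) ^ m" unfolding I_def by (simp add: card_PiE)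
  finally show ?thesis by simp
qed

section \<open>Finite fields of characteristic three\<close>

lemma frobenius_add:
  fixes x y :: "'k::field"
  assumes "CHAR('k) = 3"
  shows "(x + y) ^ (3 ^ r) = x ^ (3 ^ r) + y ^ (3 ^ r)"
proof (induction r)
  case (Suc r)
  have 3: "(3::'k) = 0" using of_nat_CHAR[where 'a='k] assms by simp
  have *: "(a + b) ^ 3 = a ^ 3 + b ^ 3" for a b :: 'k
  proof -
    have "(a + b) ^ 3 = a ^ 3 + b ^ 3 + 3 * (a^2 * b + a * b^2)"
      by (simp add: power3_eq_cube power2_eq_square algebra_simps)
    then show ?thesis using 3 by simp
  qed
  have "(x + y) ^ (3 ^ Suc r) = ((x + y) ^ (3 ^ r)) ^ 3"
    by (simp add: power_mult[symmetric] mult.commute)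
  also have "\<dots> = (x ^ (3 ^ r)) ^ 3 + (y ^ (3 ^ r)) ^ 3" by (simp add: Suc *)
  also have "\<dots> = x ^ (3 ^ Suc r) + y ^ (3 ^ Suc r)"
    by (simp add: power_mult[symmetric] mult.commute)
  finally show ?case .
qed simp

lemma frobenius_minus:
  fixes x :: "'k::field"
  shows "(- x) ^ (3 ^ r) = - (x ^ (3 ^ r))"
  by (simp add: power_minus_odd)

lemma frobenius_diff:
  fixes x y :: "'k::field"
  assumes "CHAR('k) = 3"
  shows "(x - y) ^ (3 ^ r) = x ^ (3 ^ r) - y ^ (3 ^ r)"
  using frobenius_add[OF assms, of x "- y" r] frobenius_minus[of y r] by simp

text \<open>For \<open>Q = 3 ^ r\<close> with \<open>r \<ge> 1\<close>, in an algebraically closed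
  field of characteristic 3, this is the subfield with \<open>Q\<close> elements. As a set inside
  one type it can vary with \<open>r\<close>.\<close>

definition frob_field :: "nat \<Rightarrow> 'k::field set" where
  "frob_field Q = {x. x ^ Q = x}"

lemma frob_field_power: "x \<in> frob_field Q \<Longrightarrow> x ^ k \<in> frob_field Q"
  unfolding frob_field_def by (metis (mono_tags, lifting) mem_Collect_eq mult.commute power_mult)

lemma frob_field_uminus: "x \<in> frob_field (3 ^ r) \<Longrightarrow> - x \<in> frob_field (3 ^ r)"
  by (simp add: frob_field_def frobenius_minus)

lemma frob_field_closed:
  fixes x y :: "'k::field"
  assumes "CHAR('k) = 3" "x \<in> frob_field (3 ^ r)" "y \<in> frob_field (3 ^ r)"
  shows "x + y \<in> frob_field (3 ^ r)" "x - y \<in> frob_field (3 ^ r)"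
    "x * y \<in> frob_field (3 ^ r)" "x / y \<in> frob_field (3 ^ r)"
  using assms(2,3)
  by (simp_all add: frob_field_def frobenius_add[OF assms(1)] frobenius_diff[OF assms(1)]
      power_mult_distrib power_divide)

text \<open>The polynomial \<open>p\<close> splits into linear factors. They are distinct, because a
  double root would be a root of the derivative, which is the constant -1.\<close>

lemma card_frob_field:
  assumes char: "CHAR('k::alg_closed_field) = 3" and r: "r \<ge> 1"
  shows "finite (frob_field (3 ^ r) :: 'k set)" "card (frob_field (3 ^ r) :: 'k set) = 3 ^ r"
proof -
  define p :: "'k poly" where "p = monom 1 (3 ^ r) - monom 1 1"
  have r3: "(3::nat) ^ r > 1" using r one_less_power[of "3::nat" r] by simp
  have degp: "degree p = 3 ^ r"
  proof -
    have "degree p = degree (monom (1::'k) (3 ^ r))"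
      unfolding p_def diff_conv_add_uminus
      by (rule degree_add_eq_left) (use r3 in \<open>simp add: degree_monom_eq\<close>)
    then show ?thesis by (simp add: degree_monom_eq)
  qed
  have lc: "lead_coeff p = 1" unfolding degp using r3 by (simp add: p_def)
  have roots: "{x. poly p x = 0} = frob_field (3 ^ r)"
    by (auto simp: p_def frob_field_def poly_monom)
  have p0: "p \<noteq> 0" using degp by auto
  have "of_nat (3 ^ r) = (0::'k)"
    unfolding of_nat_eq_0_iff_char_dvd char using r by (intro dvd_power) simp
  note zero = this
  have "pderiv p = monom (of_nat (3 ^ r) * 1) (3 ^ r - 1) - monom (of_nat 1 * 1) (1 - 1)"
    unfolding p_def pderiv_diff pderiv_monom ..
  also have "\<dots> = [:- 1:]" unfolding zero mult_zero_left monom_eq_0 by (simp add: monom_0)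
  finally have pd: "pderiv p = [:- 1:]" .
  obtain A where A: "size A = degree p" "p = smult (lead_coeff p) (\<Prod>x\<in>#A. [:- x, 1:])"
    using alg_closed_imp_factorization[OF p0] by (elim exE conjE) (rule that)
  have pA: "p = (\<Prod>x\<in>#A. [:- x, 1:])" by (subst A(2)) (simp only: lc smult_1_left)
  have setA: "set_mset A = frob_field (3 ^ r)"
  proof -
    have "x \<in># A \<longleftrightarrow> poly p x = 0" for x
      unfolding pA poly_prod_mset prod_mset_zero_iff by auto
    then show ?thesis using roots by auto
  qed
  have cnt: "count A x = 1" if x: "x \<in># A" for x
  proof (rule ccontr)
    assume "count A x \<noteq> 1"
    obtain B where B: "A = add_mset x B" using multi_member_split[OF x] by blast
    have "x \<in># B"
    proof (rule ccontr)
      assume "x \<notin># B"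
      then have "count B x = 0" by (rule count_eq_zero_iff[THEN iffD2])
      then have "count A x = 1" unfolding B by simp
      then show False using \<open>count A x \<noteq> 1\<close> by simp
    qed
    then obtain C where C: "B = add_mset x C" using multi_member_split by metis
    define R where "R = (\<Prod>x\<in>#C. [:- x, 1:])"
    have "p = [:- x, 1:] * ([:- x, 1:] * R)"
      unfolding pA R_def unfolding B C by (simp only: image_mset_add_mset prod_mset.add_mset)
    then have "pderiv p = [:- x, 1:] * pderiv ([:- x, 1:] * R) + [:- x, 1:] * R * pderiv [:- x, 1:]"
      using pderiv_mult by metis
    then have "poly (pderiv p) x = 0" by (simp only: poly_add poly_mult) simp
    then show False unfolding pd by simp
  qed
  show "finite (frob_field (3 ^ r) :: 'k set)" unfolding setA[symmetric] by (rule finite_set_mset)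
  have "size A = (\<Sum>x\<in>set_mset A. count A x)" by (rule size_multiset_overloaded_eq)
  also have "\<dots> = card (set_mset A)" using cnt by simp
  finally show "card (frob_field (3 ^ r) :: 'k set) = 3 ^ r" using A(1) degp setA by simp
qed

section \<open>Norms and systems of norm equations\<close>

text \<open>For \<open>q\<close> a power of 3, on \<open>frob_field (q ^ m)\<close>, this is the
  norm to \<open>frob_field q\<close>, written as the product of the conjugates.\<close>

definition conj_norm :: "nat \<Rightarrow> nat \<Rightarrow> 'k::field \<Rightarrow> 'k" where
  "conj_norm q m z = (\<Prod>j<m. z ^ (q ^ j))"

text \<open>Raising to the power \<open>q\<close> permutes the conjugates cyclically.\<close>

lemma conj_norm_in_frob_field:
  assumes "z \<in> frob_field (q ^ m)"
  shows "conj_norm q m z \<in> frob_field q"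
proof (cases m)
  case (Suc n)
  have z: "z ^ (q ^ Suc n) = z" using assms Suc by (simp add: frob_field_def)
  have "conj_norm q m z ^ q = (\<Prod>j<Suc n. z ^ (q ^ Suc j))"
    by (simp add: conj_norm_def Suc prod_power_distrib power_mult[symmetric] mult.commute del: prod.lessThan_Suc)
  also have "\<dots> = (\<Prod>j<n. z ^ (q ^ Suc j)) * z ^ (q ^ 0)" using z by simp
  also have "\<dots> = (\<Prod>j<Suc n. z ^ (q ^ j))" by (simp only: prod.lessThan_Suc_shift mult.commute)
  finally show ?thesis by (simp add: frob_field_def conj_norm_def Suc)
qed (simp add: conj_norm_def frob_field_def)

text \<open>The difference puts the linear polynomial with root \<open>x0\<close> into the ideal
  generated by \<open>h\<close> and \<open>h'\<close>. Modulo it \<open>h\<close> is the nonzero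
  constant \<open>poly h x0\<close>, so the ideal contains 1.\<close>

lemma bezout_coprime_of_diff:
  fixes h h' :: "'k::field poly"
  assumes "h - h' = smult \<delta> [:- x0, 1:]" "\<delta> \<noteq> 0" "poly h x0 \<noteq> 0"
  shows "bezout_coprime h h'"
proof -
  define c where "c = poly h x0"
  have "[:- x0, 1:] dvd h - [:c:]" by (simp add: poly_eq_0_iff_dvd[symmetric] c_def)
  then obtain k where k: "h - [:c:] = [:- x0, 1:] * k" by auto
  have "[:c:] = h - [:- x0, 1:] * k" by (simp only: k[symmetric]) simp
  also have "[:- x0, 1:] * k = smult (inverse \<delta>) k * (h - h')"
    unfolding assms(1) mult_smult_left mult_smult_right smult_smult using assms(2)
    by (simp add: mult.commute[of k] del: mult_pCons_left mult_pCons_right)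
  finally have "[:c:] = h - smult (inverse \<delta>) k * (h - h')" .
  then have "smult (inverse c) [:c:] = smult (inverse c) (h - smult (inverse \<delta>) k * (h - h'))" by simp
  then have "1 = smult (inverse c) (1 - smult (inverse \<delta>) k) * h + smult (inverse c) (smult (inverse \<delta>) k) * h'"
    using assms(3) by (simp add: c_def algebra_simps smult_diff_right smult_add_right one_pCons)
  then show ?thesis unfolding bezout_coprime_def by metis
qed

text \<open>For \<open>a = a'\<close> the difference is a nonzero constant. Otherwise, the
  characteristic not being 2, it is linear with its root \<open>x0\<close> in the field, and the
  first quadratic does not vanish there, since \<open>g\<close> would be the square of
  \<open>a + x0\<close>.\<close>

lemma bezout_coprime_quadratics:
  fixes a g a' g' :: "'k::field"
  assumes char: "CHAR('k) = 3"
    and F: "a \<in> frob_field (3 ^ r)" "g \<in> frob_field (3 ^ r)" "a' \<in> frob_field (3 ^ r)" "g' \<in> frob_field (3 ^ r)"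
    and nsq: "\<And>x. x \<in> frob_field (3 ^ r) \<Longrightarrow> x\<^sup>2 \<noteq> g"
    and ne: "(a, g) \<noteq> (a', g')"
  shows "bezout_coprime ([:a, 1:]\<^sup>2 - [:g:]) ([:a', 1:]\<^sup>2 - [:g':])"
proof (cases "a = a'")
  case True
  then have "g' - g \<noteq> 0" using ne by auto
  have *: "i * (A - B) + (- i) * (A - D) = i * (D - B)" for i A B D :: "'k poly"
    by (simp add: algebra_simps)
  have "[:inverse (g' - g):] * ([:a, 1:]\<^sup>2 - [:g:]) + (- [:inverse (g' - g):]) * ([:a', 1:]\<^sup>2 - [:g':]) = 1"
    using \<open>g' - g \<noteq> 0\<close> by (simp only: True *) (simp add: one_pCons)
  then show ?thesis unfolding bezout_coprime_def by blast
next
  case False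
  have two: "(2::'k) \<noteq> 0" 
    using of_nat_eq_0_iff_char_dvd[where 'a='k, of 2] char by simp
  have [simp]: "(2::'k) \<in> frob_field (3 ^ r)" 
    using frob_field_closed(1)[OF char, of 1 r 1] by (simp add: frob_field_def)
  define \<delta> where "\<delta> = 2 * (a - a')"
  define x0 where "x0 = (a'\<^sup>2 - a\<^sup>2 + g - g') / \<delta>"
  have \<delta>: "\<delta> \<noteq> 0" using two False by (simp add: \<delta>_def)
  have x0: "x0 \<in> frob_field (3 ^ r)" unfolding x0_def \<delta>_def
    by (intro frob_field_closed[OF char] frob_field_power F) (simp_all add: F)
  show ?thesis
  proof (rule bezout_coprime_of_diff[OF _ \<delta>])
    have "\<delta> * x0 = a'\<^sup>2 - a\<^sup>2 + g - g'" using \<delta> by (simp add: x0_def)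
    then show "[:a, 1:]\<^sup>2 - [:g:] - ([:a', 1:]\<^sup>2 - [:g':]) = smult \<delta> [:- x0, 1:]"
      by (simp add: power2_eq_square \<delta>_def algebra_simps)
    show "poly ([:a, 1:]\<^sup>2 - [:g:]) x0 \<noteq> 0"
      using nsq[of "a + x0"] frob_field_closed(1)[OF char F(1) x0] by simp
  qed
qed

text \<open>As Frobenius is additive, each norm is a product of conjugate quadratics, one in each of
  the coordinates \<open>x ^ (q ^ j)\<close>, so \<open>card_common_solutions_le\<close> applies
  with \<open>d = 2\<close>.\<close>

lemma card_norm_system_le:
  fixes a g t :: "'e \<Rightarrow> 'k::field"
  assumes char: "CHAR('k) = 3" and E: "finite E" "card E = m" "m \<ge> 1"
    and q: "q = 3 ^ r"
    and F: "\<And>e. e \<in> E \<Longrightarrow> a e \<in> frob_field (q ^ m)" "\<And>e. e \<in> E \<Longrightarrow> g e \<in> frob_field (q ^ m)"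
    and nsq: "\<And>e x. e \<in> E \<Longrightarrow> x \<in> frob_field (q ^ m) \<Longrightarrow> x\<^sup>2 \<noteq> g e"
    and inj: "inj_on (\<lambda>e. (a e, g e)) E"
    and S: "finite S" "\<And>x e. x \<in> S \<Longrightarrow> e \<in> E \<Longrightarrow> conj_norm q m ((x + a e)\<^sup>2 - g e) = t e"
  shows "card S \<le> (m * (2 * m + 1)) ^ m"
proof -
  obtain \<eta> where \<eta>: "bij_betw \<eta> {..<m} E"
    using ex_bij_betw_nat_finite[OF E(1)] E(2) by (metis atLeast0LessThan)
  have \<eta>E: "\<eta> i \<in> E" if "i < m" for i using \<eta> that by (auto simp: bij_betw_def)
  have qj: "q ^ j = 3 ^ (r * j)" for j unfolding q by (rule power_mult[symmetric])
  define h where "h i j = [:a (\<eta> i) ^ (q ^ j), 1:]\<^sup>2 - [:g (\<eta> i) ^ (q ^ j):]" for i j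
  have h: "h i j = [:(a (\<eta> i) ^ (q ^ j))\<^sup>2 - g (\<eta> i) ^ (q ^ j), 2 * a (\<eta> i) ^ (q ^ j), 1:]" for i j
    by (simp add: h_def power2_eq_square)
  \<comment> \<open>Conjugation is invertible on the field, so it keeps the pairs
    \<open>(a e, g e)\<close> distinct and nonsquares nonsquare.\<close>
  have unfrob: "(x ^ (q ^ j)) ^ (q ^ (m - j)) = x" if "j < m" "x \<in> frob_field (q ^ m)" for j x
  proof -
    have "q ^ j * q ^ (m - j) = q ^ m" using that by (simp flip: power_add)
    then show ?thesis using that by (simp add: frob_field_def flip: power_mult)
  qed
  have mem: "a (\<eta> i) ^ q ^ j \<in> frob_field (3 ^ (r * m))" "g (\<eta> i) ^ q ^ j \<in> frob_field (3 ^ (r * m))"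
    if "i < m" for i j
    unfolding qj[symmetric] by (intro frob_field_power F \<eta>E that)+
  show ?thesis
  proof (rule card_common_solutions_le[where \<xi> = "\<lambda>j x. x ^ (q ^ j)" and h = h and t = "t \<circ> \<eta>"])
    fix i j assume "i < m" "j < m"
    show "degree (h i j) = 2" "lead_coeff (h i j) = 1" by (simp_all add: h)
  next
    fix i i' j assume i: "i < m" "i' < m" "j < m" "i \<noteq> i'"
    show "bezout_coprime (h i j) (h i' j)"
      unfolding h_def
    proof (rule bezout_coprime_quadratics[OF char, where r = "r * m"])
      have False if eq: "a (\<eta> i) ^ q ^ j = a (\<eta> i') ^ q ^ j" "g (\<eta> i) ^ q ^ j = g (\<eta> i') ^ q ^ j"
      proof -
        have "a (\<eta> i) = a (\<eta> i')"
          by (metis eq(1) unfrob[OF i(3) F(1)[OF \<eta>E[OF i(1)]]] unfrob[OF i(3) F(1)[OF \<eta>E[OF i(2)]]])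
        moreover have "g (\<eta> i) = g (\<eta> i')"
          by (metis eq(2) unfrob[OF i(3) F(2)[OF \<eta>E[OF i(1)]]] unfrob[OF i(3) F(2)[OF \<eta>E[OF i(2)]]])
        ultimately have "\<eta> i = \<eta> i'"
          by (intro inj_onD[OF inj] \<eta>E i) simp
        then show False using inj_onD[OF bij_betw_imp_inj_on[OF \<eta>], of i i'] i by simp
      qed
      then show "(a (\<eta> i) ^ q ^ j, g (\<eta> i) ^ q ^ j) \<noteq> (a (\<eta> i') ^ q ^ j, g (\<eta> i') ^ q ^ j)"
        unfolding prod.inject by blast
    next
      fix x :: 'k assume x: "x \<in> frob_field (3 ^ (r * m))"
      show "x\<^sup>2 \<noteq> g (\<eta> i) ^ q ^ j"
      proof
        assume "x\<^sup>2 = g (\<eta> i) ^ q ^ j"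
        moreover have "(x ^ (q ^ (m - j)))\<^sup>2 = (x\<^sup>2) ^ (q ^ (m - j))"
          by (simp only: power_mult[symmetric] mult.commute)
        ultimately have "(x ^ (q ^ (m - j)))\<^sup>2 = g (\<eta> i)"
          using unfrob[OF i(3) F(2)[OF \<eta>E[OF i(1)]]] by (simp only:)
        moreover have "x ^ (q ^ (m - j)) \<in> frob_field (q ^ m)"
          unfolding qj[of m] using frob_field_power[OF x] .
        ultimately show False using nsq \<eta>E[OF i(1)] by blast
      qed
    qed (fact mem[OF i(1)] mem[OF i(2)])+
  next
    fix x i assume x: "x \<in> S" and i: "i < m"
    have "(\<Prod>j<m. poly (h i j) (x ^ q ^ j)) = conj_norm q m ((x + a (\<eta> i))\<^sup>2 - g (\<eta> i))"
      unfolding conj_norm_def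
    proof (rule prod.cong)
      fix j
      have "((x + a (\<eta> i))\<^sup>2 - g (\<eta> i)) ^ q ^ j = ((x + a (\<eta> i)) ^ q ^ j)\<^sup>2 - g (\<eta> i) ^ q ^ j"
        unfolding qj frobenius_diff[OF char] by (simp only: power_mult[symmetric] mult.commute)
      also have "(x + a (\<eta> i)) ^ q ^ j = x ^ q ^ j + a (\<eta> i) ^ q ^ j"
        unfolding qj by (rule frobenius_add[OF char])
      finally show "poly (h i j) (x ^ q ^ j) = ((x + a (\<eta> i))\<^sup>2 - g (\<eta> i)) ^ q ^ j"
        by (simp add: h_def add.commute)
    qed simp
    then show "(\<Prod>j<m. poly (h i j) (x ^ q ^ j)) = (t \<circ> \<eta>) i" using S(2)[OF x \<eta>E[OF i]] by simp
  qed (use E S in auto)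
qed

text \<open>Put \<open>z = 2 * x - s1\<close> and \<open>d = s1 - s2\<close>. Subtracting
  \<open>z * z ^ q = t1\<close> from \<open>(z + d) * (z + d) ^ q = t2\<close> gives
  \<open>z * d ^ q + d * z ^ q = \<kappa>\<close>. Multiplied by \<open>z\<close>, this becomes a
  quadratic equation for \<open>z\<close>.\<close>

lemma card_cherry_centres_le:
  fixes s1 s2 :: "'k::field"
  assumes char: "CHAR('k) = 3" and q: "q = 3 ^ r"
    and s: "s1 \<in> frob_field (q\<^sup>2)" "s2 \<in> frob_field (q\<^sup>2)" "s1 \<noteq> s2"
    and S: "S \<subseteq> frob_field (q\<^sup>2)"
      "\<And>x. x \<in> S \<Longrightarrow> conj_norm q 2 (2 * x - s1) = t1" "\<And>x. x \<in> S \<Longrightarrow> conj_norm q 2 (2 * x - s2) = t2"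
  shows "card S \<le> 2"
proof -
  have N: "conj_norm q 2 z = z * z ^ q" for z :: 'k
    by (simp add: conj_norm_def numeral_2_eq_2)
  define d where "d = s1 - s2"
  define \<kappa> where "\<kappa> = t2 - t1 - d * d ^ q"
  define p where "p = [:t1 * d, - \<kappa>, d ^ q:]"
  have d: "d \<noteq> 0" using s by (simp add: d_def)
  have two: "(2::'k) \<noteq> 0"
    using of_nat_eq_0_iff_char_dvd[where 'a='k, of 2] char by simp
  have p0: "p \<noteq> 0" using d by (simp add: p_def)
  have "poly p (2 * x - s1) = 0" if "x \<in> S" for x
  proof -
    define z where "z = 2 * x - s1"
    have 1: "z * z ^ q = t1" using S(2)[OF that] by (simp add: N z_def)
    have zd: "2 * x - s2 = z + d" by (simp add: z_def d_def)
    have "(z + d) * (z + d) ^ q = t2" using S(3)[OF that] unfolding N zd .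
    moreover have "(z + d) ^ q = z ^ q + d ^ q" unfolding q by (rule frobenius_add[OF char])
    ultimately have 2: "(z + d) * (z ^ q + d ^ q) = t2" by simp
    have "z * d ^ q + d * z ^ q = \<kappa>" using 1 2 by (simp add: \<kappa>_def algebra_simps)
    then have "\<kappa> * z = z * (z * d ^ q) + d * (z * z ^ q)" by (auto simp: algebra_simps)
    then have "poly p z = 0" using 1 by (simp add: p_def algebra_simps)
    then show ?thesis by (simp add: z_def)
  qed
  then have "(\<lambda>x. 2 * x - s1) ` S \<subseteq> {z. poly p z = 0}" by auto
  then have "card ((\<lambda>x. 2 * x - s1) ` S) \<le> card {z. poly p z = 0}"
    by (intro card_mono poly_roots_finite p0)
  also have "\<dots> \<le> degree p" by (rule card_poly_roots_bound[OF p0])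
  also have "\<dots> = 2" using d by (simp add: p_def)
  also have "card ((\<lambda>x. 2 * x - s1) ` S) = card S"
    using two by (intro card_image) (auto simp: inj_on_def)
  finally show ?thesis .
qed

section \<open>Nonsquares and a set with few sums\<close>

lemma card_le_card_times_fibre:
  assumes "finite A" "\<And>y. y \<in> f ` A \<Longrightarrow> card {x \<in> A. f x = y} \<le> c"
  shows "card A \<le> c * card (f ` A)"
  using assms by (intro card_le_of_fibres[of A _ f]) auto

lemma card_ge_card_times_fibre:
  assumes "finite A" "\<And>y. y \<in> f ` A \<Longrightarrow> c \<le> card {x \<in> A. f x = y}"
  shows "c * card (f ` A) \<le> card A"
proof -
  have "card A = card (\<Union>y\<in>f ` A. {x \<in> A. f x = y})" by (rule arg_cong[where f = card]) auto
  also have "\<dots> = (\<Sum>y\<in>f ` A. card {x \<in> A. f x = y})"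
    by (rule card_UN_disjoint) (use assms in auto)
  also have "\<dots> \<ge> (\<Sum>y\<in>f ` A. c)" by (rule sum_mono) (use assms in auto)
  finally show ?thesis by (simp add: mult.commute)
qed

text \<open>Opposite elements have equal squares, so at most half of the nonzero elements are
  squares; the summand 1 accounts for 0.\<close>

lemma card_nonsquares_ge:
  assumes char: "CHAR('k::alg_closed_field) = 3" and r: "r \<ge> 1"
  defines "F \<equiv> (frob_field (3 ^ r) :: 'k set)"
  shows "3 ^ r \<le> 2 * card {y \<in> F. \<forall>x\<in>F. x\<^sup>2 \<noteq> y} + 1"
proof -
  have F: "finite F" "card F = 3 ^ r" unfolding F_def by (rule card_frob_field[OF char r])+
  have two: "(2::'k) \<noteq> 0"
    using of_nat_eq_0_iff_char_dvd[where 'a='k, of 2] char by simp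
  have neg: "- x \<in> F" if "x \<in> F" for x
    using that frob_field_uminus unfolding F_def by blast
  have sq: "x\<^sup>2 \<in> F" if "x \<in> F" for x
    using that frob_field_power unfolding F_def by blast
  have 0: "0 \<in> F" by (simp add: F_def frob_field_def)
  let ?s = "\<lambda>x. x\<^sup>2 :: 'k"
  have "2 * card (?s ` (F - {0})) \<le> card (F - {0})"
  proof (rule card_ge_card_times_fibre)
    fix y assume "y \<in> ?s ` (F - {0})"
    then obtain x where x: "x \<in> F" "x \<noteq> 0" "y = x\<^sup>2" by auto
    have "- x \<noteq> x" using two x(2) by (metis add.right_inverse mult_2 mult_eq_0_iff)
    have "card {x, - x} \<le> card {z \<in> F - {0}. z\<^sup>2 = y}"
      using x F neg by (intro card_mono) auto
    moreover have "card {x, - x} = 2" using \<open>- x \<noteq> x\<close> by simp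
    ultimately show "2 \<le> card {z \<in> F - {0}. z\<^sup>2 = y}" by simp
  qed (use F in auto)
  moreover have "card (F - {0}) = 3 ^ r - 1" using F 0 by simp
  moreover have "card (?s ` F) \<le> card (?s ` (F - {0})) + 1"
  proof -
    have "?s ` F \<subseteq> insert 0 (?s ` (F - {0}))" by auto
    then have "card (?s ` F) \<le> card (insert 0 (?s ` (F - {0})))" using F by (intro card_mono) auto
    then show ?thesis using F card_insert_le_m1 by (metis (no_types, lifting) Suc_eq_plus1 card_insert_if finite_Diff finite_imageI le_SucI)
  qed
  moreover have "{y \<in> F. \<forall>x\<in>F. x\<^sup>2 \<noteq> y} = F - ?s ` F" by auto
  moreover have "card (F - ?s ` F) = 3 ^ r - card (?s ` F)"
    using F sq by (subst card_Diff_subset) auto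
  ultimately have *: "2 * card (?s ` (F - {0})) \<le> 3 ^ r - 1" "card (?s ` F) \<le> card (?s ` (F - {0})) + 1"
    "card {y \<in> F. \<forall>x\<in>F. x\<^sup>2 \<noteq> y} = 3 ^ r - card (?s ` F)" by simp_all
  have "(3::nat) ^ r \<ge> 1" by simp
  then show ?thesis using * by linarith
qed

text \<open>A coset of the index-three subgroup of all \<open>x\<^sup>3 - x\<close>.\<close>

lemma ex_half_sumset:
  assumes char: "CHAR('k::alg_closed_field) = 3" and r: "r \<ge> 1"
  defines "F \<equiv> (frob_field (3 ^ r) :: 'k set)"
  obtains V where "V \<subseteq> F" "3 ^ r \<le> 3 * card V" "\<And>x y. x \<in> V \<Longrightarrow> y \<in> V \<Longrightarrow> x \<noteq> - y"
    "2 * card {x + y |x y. x \<in> V \<and> y \<in> V} < 3 ^ r"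
proof -
  have F: "finite F" "card F = 3 ^ r" unfolding F_def by (rule card_frob_field[OF char r])+
  have closed: "x + y \<in> F" "x - y \<in> F" "- x \<in> F" "x ^ 3 \<in> F" if "x \<in> F" "y \<in> F" for x y
    using that frob_field_closed(1,2)[OF char, of x r y] frob_field_uminus[of x r]
      frob_field_power[of x "3 ^ r" 3] unfolding F_def by simp_all
  have 3: "(3::'k) = 0" using of_nat_CHAR[where 'a='k] char by simp
  define w :: "'k \<Rightarrow> 'k" where "w x = x ^ 3 - x" for x
  have w_add: "w (x + y) = w x + w y" for x y
    using frobenius_add[OF char, of x y 1] by (simp add: w_def)
  have w_diff: "w (x - y) = w x - w y" for x y
    using frobenius_diff[OF char, of x y 1] by (simp add: w_def)
  have w1: "w 1 = 0" by (simp add: w_def)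
  define W where "W = w ` F"
  have W: "finite W" "W \<subseteq> F" unfolding W_def using F closed by (auto simp: w_def)
  have "3 ^ r \<le> 3 * card W" unfolding W_def F(2)[symmetric]
  proof (rule card_le_card_times_fibre[OF F(1)])
    fix y
    let ?p = "[:- y, - 1, 0, 1:] :: 'k poly"
    have "poly ?p x = w x - y" for x by (simp add: w_def power3_eq_cube algebra_simps)
    then have "{x \<in> F. w x = y} \<subseteq> {x. poly ?p x = 0}" by auto
    then have "card {x \<in> F. w x = y} \<le> card {x. poly ?p x = 0}"
      by (intro card_mono poly_roots_finite) auto
    also have "\<dots> \<le> degree ?p" by (rule card_poly_roots_bound) simp
    finally show "card {x \<in> F. w x = y} \<le> 3" by simp
  qed
  \<comment> \<open>\<open>w\<close> takes the same value at \<open>x\<close> and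
    \<open>x + 1\<close>. The inequality becomes strict below because \<open>3 ^ r\<close> is
    odd.\<close>
  have "2 * card W \<le> 3 ^ r" unfolding W_def F(2)[symmetric]
  proof (rule card_ge_card_times_fibre[OF F(1)])
    fix y assume "y \<in> w ` F"
    then obtain x where x: "x \<in> F" "y = w x" by auto
    have "1 \<in> F" by (simp add: F_def frob_field_def)
    have "card {x, x + 1} \<le> card {z \<in> F. w z = y}"
      using x F closed(1)[OF x(1) \<open>1 \<in> F\<close>] by (intro card_mono) (auto simp: w_add w1)
    moreover have "card {x, x + 1} = 2" by simp
    ultimately show "2 \<le> card {z \<in> F. w z = y}" by simp
  qed
  moreover have "odd ((3::nat) ^ r)" by simp
  moreover have "even (2 * card W)" by simp
  ultimately have W2: "2 * card W < 3 ^ r" by (metis le_neq_implies_less)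
  have W_diff: "x - y \<in> W" if xy: "x \<in> W" "y \<in> W" for x y
  proof -
    obtain u v where "u \<in> F" "v \<in> F" "x = w u" "y = w v" using xy by (auto simp: W_def)
    then show ?thesis using closed(2)[of u v] w_diff[of u v] unfolding W_def by (metis imageI)
  qed
  have W0: "0 \<in> W" unfolding W_def by (rule image_eqI[of _ _ 0]) (auto simp: w_def F_def frob_field_def)
  have W_add: "x + y \<in> W" if "x \<in> W" "y \<in> W" for x y
    using W_diff[OF that(1) W_diff[OF W0 that(2)]] by simp
  have "card W < card F" using W2 F by simp
  then obtain c where c: "c \<in> F" "c \<notin> W" using card_mono[OF W(1), of F] by (meson not_le subsetI)
  \<comment> \<open>With \<open>c\<close> outside the subgroup \<open>W\<close>, all sums lie in one
    coset of \<open>W\<close>, and \<open>x = - y\<close> would put \<open>- 2 * c\<close>, which is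
    \<open>c\<close> in characteristic 3, into \<open>W\<close>.\<close>
  define V where "V = (+) c ` W"
  show thesis
  proof (rule that[of V])
    show "V \<subseteq> F" using W c closed(1) by (auto simp: V_def)
    have "card V = card W" unfolding V_def by (rule card_image) simp
    then show "3 ^ r \<le> 3 * card V" using \<open>3 ^ r \<le> 3 * card W\<close> by simp
    show "x \<noteq> - y" if xy: "x \<in> V" "y \<in> V" for x y
    proof
      assume "x = - y"
      obtain u v where uv: "u \<in> W" "v \<in> W" "x = c + u" "y = c + v" using xy by (auto simp: V_def)
      have "u + v - c = (x + y) - 3 * c" using uv by (simp add: algebra_simps)
      then have "u + v = c" using \<open>x = - y\<close> 3 by simp
      then show False using c W_add uv by auto
    qed
    have "{x + y |x y. x \<in> V \<and> y \<in> V} \<subseteq> (\<lambda>z. c + c + z) ` W"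
    proof
      fix z assume "z \<in> {x + y |x y. x \<in> V \<and> y \<in> V}"
      then obtain u v where "u \<in> W" "v \<in> W" "z = (c + u) + (c + v)" by (auto simp: V_def)
      then have "z = c + c + (u + v)" "u + v \<in> W" using W_add by (simp_all add: algebra_simps)
      then show "z \<in> (\<lambda>z. c + c + z) ` W" by blast
    qed
    then have "card {x + y |x y. x \<in> V \<and> y \<in> V} \<le> card ((\<lambda>z. c + c + z) ` W)"
      using W by (intro card_mono) auto
    also have "\<dots> \<le> card W" by (rule card_image_le[OF W(1)])
    finally show "2 * card {x + y |x y. x \<in> V \<and> y \<in> V} < 3 ^ r" using W2 by simp
  qed
qed

section \<open>Upper bounds\<close>

text \<open>Lets colours be pairs of field elements: \<open>enc\<close> numbers them. What remains
  to be checked is properness and the absence of a repeat, given as embeddings in the form of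
  \<open>is_repeatD\<close>.\<close>

lemma repeat_number_le_card_colours:
  fixes col :: "nat set \<Rightarrow> 'c" and T :: "'a graph"
  assumes T: "finite_graph T" and k: "k \<ge> 1" and R: "finite R" "\<And>e. e \<in> all_edges {..<n} \<Longrightarrow> col e \<in> R"
    and proper: "\<And>x y y'. x < n \<Longrightarrow> y < n \<Longrightarrow> y' < n \<Longrightarrow> x \<noteq> y \<Longrightarrow> x \<noteq> y' \<Longrightarrow> col {x, y} = col {x, y'} \<Longrightarrow> y = y'"
    and norep: "\<And>(S :: nat graph set) \<psi>. finite S \<Longrightarrow> card S = k \<Longrightarrow>
      \<forall>G\<in>S. inj_on (\<psi> G) (verts T) \<and> \<psi> G ` verts T \<subseteq> {..<n} \<Longrightarrow>
      \<forall>G\<in>S. \<forall>G'\<in>S. (G \<noteq> G' \<longrightarrow> \<psi> G ` verts T \<inter> \<psi> G' ` verts T = {}) \<and>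
        (\<forall>e\<in>edges T. col (\<psi> G ` e) = col (\<psi> G' ` e)) \<Longrightarrow> False"
  shows "repeat_number k n T \<le> card R"
proof -
  obtain enc where "bij_betw enc R {..<card R}"
    using ex_bij_betw_finite_nat[OF R(1)] by (metis atLeast0LessThan)
  then have enc: "inj_on enc R" "\<And>z. z \<in> R \<Longrightarrow> enc z < card R"
    using bij_betw_imp_inj_on bij_betwE by blast+
  have "proper_colouring n (card R) (\<lambda>e. enc (col e))"
    unfolding proper_colouring_def complete_graph_def snd_conv
  proof (intro conjI ballI impI)
    show "(\<lambda>e. enc (col e)) \<in> all_edges {..<n} \<rightarrow> {..<card R}" using enc(2) R(2) by blast
    fix e e' assume e: "e \<in> all_edges {..<n}" "e' \<in> all_edges {..<n}" "e \<noteq> e' \<and> e \<inter> e' \<noteq> {}"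
    show "enc (col e) \<noteq> enc (col e')"
    proof
      assume "enc (col e) = enc (col e')"
      then have eq: "col e = col e'" by (rule inj_onD[OF enc(1) _ R(2)[OF e(1)] R(2)[OF e(2)]])
      obtain x where x: "x \<in> e" "x \<in> e'" using e(3) by blast
      have e2: "card e = 2" "card e' = 2" "e \<subseteq> {..<n}" "e' \<subseteq> {..<n}" using e by (auto simp: all_edges_def)
      obtain y where y: "e = {x, y}" "x \<noteq> y" using e2(1) x(1) unfolding card_2_iff by blast
      obtain y' where y': "e' = {x, y'}" "x \<noteq> y'" using e2(2) x(2) unfolding card_2_iff by blast
      have "y = y'"
        by (rule proper[of x]) (use e2 y y' eq in auto)
      then show False using e(3) y(1) y'(1) by blast
    qed
  qed
  moreover have "\<not> is_repeat k T n (\<lambda>e. enc (col e)) S" for S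
  proof
    assume rep: "is_repeat k T n (\<lambda>e. enc (col e)) S"
    then have S: "finite S" "card S = k" by (simp_all add: is_repeat_def)
    from is_repeatD[OF rep T k] obtain \<psi> where
      "(\<forall>G\<in>S. inj_on (\<psi> G) (verts T) \<and> \<psi> G ` verts T \<subseteq> {..<n}) \<and>
       (\<forall>G\<in>S. \<forall>G'\<in>S. (G \<noteq> G' \<longrightarrow> \<psi> G ` verts T \<inter> \<psi> G' ` verts T = {}) \<and>
        (\<forall>e\<in>edges T. enc (col (\<psi> G ` e)) = enc (col (\<psi> G' ` e))))" ..
    note \<psi> = this[THEN conjunct1] this[THEN conjunct2]
    have mem: "col (\<psi> G ` e) \<in> R" if G: "G \<in> S" and e: "e \<in> edges T" for G e
    proof (rule R(2))
      have H: "inj_on (\<psi> G) (verts T)" "\<psi> G ` verts T \<subseteq> {..<n}" using bspec[OF \<psi>(1) G] by simp_all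
      have e2: "e \<subseteq> verts T" "card e = 2" using e T by (auto simp: finite_graph_def all_edges_def)
      have "card (\<psi> G ` e) = 2" using card_image[OF inj_on_subset[OF H(1) e2(1)]] e2(2) by simp
      moreover have "\<psi> G ` e \<subseteq> {..<n}" using H(2) e2(1) by blast
      ultimately show "\<psi> G ` e \<in> all_edges {..<n}" unfolding all_edges_def by blast
    qed
    show False
    proof (rule norep[OF S \<psi>(1)], intro ballI conjI impI)
      fix G G' assume G: "G \<in> S" "G' \<in> S"
      note GG' = bspec[OF bspec[OF \<psi>(2) G(1)] G(2)]
      show "\<psi> G ` verts T \<inter> \<psi> G' ` verts T = {}" if "G \<noteq> G'" using GG' that by blast
      show "col (\<psi> G ` e) = col (\<psi> G' ` e)" if e: "e \<in> edges T" for e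
      proof (rule inj_onD[OF enc(1) _ mem[OF G(1) e] mem[OF G(2) e]])
        show "enc (col (\<psi> G ` e)) = enc (col (\<psi> G' ` e))" using GG' e by blast
      qed
    qed
  qed
  ultimately show ?thesis by (intro repeat_number_le) blast+
qed

text \<open>Crossing an edge replaces a value by \<open>s\<close> minus that value, where
  \<open>s\<close> does not depend on \<open>G\<close>. So the sign flips, and the shift changes by
  the same amount for every \<open>G\<close>.\<close>

lemma ex_signed_translation:
  fixes \<phi> :: "'g \<Rightarrow> 'a \<Rightarrow> 'k::field"
  assumes conn: "connected_graph T" and r0: "r0 \<in> verts T" and u: "u \<in> verts T"
    and fg: "finite_graph T"
    and sum: "\<And>G u w. G \<in> \<Phi> \<Longrightarrow> {u, w} \<in> edges T \<Longrightarrow> \<phi> G u + \<phi> G w = s {u, w}"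
    and A: "\<And>e. e \<in> edges T \<Longrightarrow> s e \<in> A" "0 \<in> A" "\<And>x y. x \<in> A \<Longrightarrow> y \<in> A \<Longrightarrow> x - y \<in> A"
  shows "\<exists>\<epsilon> d. (\<epsilon> = 1 \<or> \<epsilon> = - 1) \<and> d \<in> A \<and> (\<forall>G\<in>\<Phi>. \<phi> G u = \<epsilon> * (\<phi> G r0 + d))"
proof -
  have "(r0, u) \<in> {(x, y). {x, y} \<in> edges T}\<^sup>*"
    using conn r0 u by (auto simp: connected_graph_def)
  then show ?thesis
  proof (induction rule: rtrancl_induct)
    case base
    show ?case by (intro exI[of _ 1] exI[of _ 0]) (simp add: A)
  next
    case (step u w)
    then have uw: "{u, w} \<in> edges T" by simp
    obtain \<epsilon> d where IH: "\<epsilon> = 1 \<or> \<epsilon> = - 1" "d \<in> A" "\<forall>G\<in>\<Phi>. \<phi> G u = \<epsilon> * (\<phi> G r0 + d)"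
      using step.IH by blast
    have neg: "- x \<in> A" if "x \<in> A" for x using A(3)[OF A(2) that] by simp
    have "\<epsilon> * s {u, w} \<in> A" using IH(1) A(1)[OF uw] neg by auto
    then have "d - \<epsilon> * s {u, w} \<in> A" by (rule A(3)[OF IH(2)])
    moreover have "\<phi> G w = - \<epsilon> * (\<phi> G r0 + (d - \<epsilon> * s {u, w}))" if G: "G \<in> \<Phi>" for G
    proof -
      have "\<phi> G w = s {u, w} - \<epsilon> * (\<phi> G r0 + d)"
        using sum[OF G uw] IH(3) G by (simp add: algebra_simps)
      also have "s {u, w} = \<epsilon> * \<epsilon> * s {u, w}" using IH(1) by auto
      finally show ?thesis by (simp add: algebra_simps)
    qed
    ultimately show ?case using IH(1)
      by (intro exI[of _ "- \<epsilon>"] exI[of _ "d - \<epsilon> * s {u, w}"]) auto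
  qed
qed

lemma ex_doubleton:
  assumes e: "card e = 2" and z: "z \<in> e"
  shows "\<exists>w. e = {z, w}"
proof -
  obtain x y where xy: "e = {x, y}" using e unfolding card_2_iff by blast
  then consider "z = x" | "z = y" using z by blast
  then show ?thesis
  proof cases
    case 1
    then show ?thesis using xy by blast
  next
    case 2
    then show ?thesis using xy by (intro exI[of _ x]) auto
  qed
qed

text \<open>There are \<open>q ^ m\<close> possible sums and \<open>q\<close> norms. The copies in a
  repeat are sorted by which endpoint of each edge has the smaller image, giving
  \<open>2 ^ m\<close> classes. In a class the images of the root solve one norm system, and
  disjoint copies have different root images.\<close>

lemma repeat_number_le_power_size:
  fixes T :: "'a graph"
  assumes char: "CHAR('k::alg_closed_field) = 3"
    and T: "finite_graph T" "connected_graph T" "card (edges T) = m" and m: "m \<ge> 1"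
    and r: "r \<ge> 1" and q: "q = 3 ^ r" and n: "3 * n \<le> q ^ m"
    and k: "k > (m * (2 * m + 1)) ^ m * 2 ^ m"
  shows "repeat_number k n T \<le> q ^ Suc m"
proof -
  define F where "F = (frob_field (q ^ m) :: 'k set)"
  have qm: "q ^ m = 3 ^ (r * m)" by (simp add: q power_mult)
  have rm: "r * m \<ge> 1" using r m by simp
  have F: "finite F" "card F = q ^ m" unfolding F_def qm by (rule card_frob_field[OF char rm])+
  have Fq: "finite (frob_field q :: 'k set)" "card (frob_field q :: 'k set) = q"
    unfolding q by (rule card_frob_field[OF char r])+
  have F_diff: "x - y \<in> F" if "x \<in> F" "y \<in> F" for x y
    using frob_field_closed(2)[OF char] that unfolding F_def qm .
  have F_add: "x + y \<in> F" if "x \<in> F" "y \<in> F" for x y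
    using frob_field_closed(1)[OF char] that unfolding F_def qm .
  have F_sq: "x\<^sup>2 \<in> F" if "x \<in> F" for x
    using frob_field_power[of x "q ^ m" 2] that unfolding F_def .
  have F0: "0 \<in> F" unfolding F_def qm frob_field_def by simp
  \<comment> \<open>Having few sums lets \<open>g\<close> map them injectively to nonsquares. Having
    no opposite elements lets a position known up to sign be recovered.\<close>
  obtain V :: "'k set" where V: "V \<subseteq> F" "q ^ m \<le> 3 * card V" "\<And>x y. x \<in> V \<Longrightarrow> y \<in> V \<Longrightarrow> x \<noteq> - y"
    "2 * card {x + y |x y. x \<in> V \<and> y \<in> V} < q ^ m"
  proof (rule ex_half_sumset[OF char rm])
    fix V :: "'k set"
    assume V: "V \<subseteq> frob_field (3 ^ (r * m))" "3 ^ (r * m) \<le> 3 * card V"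
      "\<And>x y. x \<in> V \<Longrightarrow> y \<in> V \<Longrightarrow> x \<noteq> - y" "2 * card {x + y |x y. x \<in> V \<and> y \<in> V} < 3 ^ (r * m)"
    show thesis by (rule that[of V]) (unfold F_def qm, (rule V; assumption)+)
  qed
  have finV: "finite V" using V(1) F(1) by (rule finite_subset)
  have "card {..<n} \<le> card V" using n V(2) by simp
  from card_le_inj[OF _ finV this] obtain \<iota> where \<iota>: "\<iota> ` {..<n} \<subseteq> V" "inj_on \<iota> {..<n}" by auto
  define Sums where "Sums = {x + y |x y. x \<in> V \<and> y \<in> V}"
  define NS where "NS = {y \<in> F. \<forall>x\<in>F. x\<^sup>2 \<noteq> y}"
  have finNS: "finite NS" using F(1) by (simp add: NS_def)
  have "Sums \<subseteq> F" using V(1) F_add by (auto simp: Sums_def)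
  then have finSums: "finite Sums" using F(1) by (rule finite_subset)
  have "q ^ m \<le> 2 * card NS + 1" using card_nonsquares_ge[OF char rm] by (simp only: NS_def F_def qm)
  then have "card Sums \<le> card NS" using V(4) by (simp add: Sums_def)
  from card_le_inj[OF finSums finNS this] obtain g where g: "g ` Sums \<subseteq> NS" "inj_on g Sums" by blast
  define sm where "sm e = (\<Sum>x\<in>e. \<iota> x)" for e
  \<comment> \<open>Only the square of one endpoint enters, so the sign in front of
    \<open>x + a\<close> disappears; the vertex numbers decide which endpoint is used.\<close>
  define col where "col e = (sm e, conj_norm q m ((\<iota> (Min e))\<^sup>2 - g (sm e)))" for e
  have sm2: "sm {x, y} = \<iota> x + \<iota> y" if "x \<noteq> y" for x y using that by (simp add: sm_def)
  have smS: "sm e \<in> Sums" if e: "e \<in> all_edges {..<n}" for e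
  proof -
    have "card e = 2" "e \<subseteq> {..<n}" using e by (auto simp: all_edges_def)
    then obtain x y where xy: "e = {x, y}" "x \<noteq> y" "x < n" "y < n" unfolding card_2_iff by blast
    then have "\<iota> x \<in> V" "\<iota> y \<in> V" using \<iota>(1) by auto
    then show ?thesis unfolding xy(1) sm2[OF xy(2)] Sums_def by blast
  qed
  have "repeat_number k n T \<le> card (F \<times> (frob_field q :: 'k set))"
  proof (rule repeat_number_le_card_colours[OF T(1), where col = col])
    show "k \<ge> 1" using k by simp
    show "finite (F \<times> (frob_field q :: 'k set))" using F Fq by simp
    fix e :: "nat set" assume e: "e \<in> all_edges {..<n}"
    then have "e \<subseteq> {..<n}" "finite e" "e \<noteq> {}" by (auto simp: all_edges_def intro: card_ge_0_finite)
    then have "Min e \<in> {..<n}" using Min_in by blast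
    then have "\<iota> (Min e) \<in> F" using \<iota>(1) V(1) by blast
    moreover have "g (sm e) \<in> F" using g(1) smS[OF e] by (auto simp: NS_def)
    ultimately have "(\<iota> (Min e))\<^sup>2 - g (sm e) \<in> F" by (intro F_diff F_sq)
    then have "conj_norm q m ((\<iota> (Min e))\<^sup>2 - g (sm e)) \<in> frob_field q"
      unfolding F_def by (rule conj_norm_in_frob_field)
    moreover have "sm e \<in> F" using smS[OF e] \<open>Sums \<subseteq> F\<close> by blast
    ultimately show "col e \<in> F \<times> frob_field q" unfolding col_def by simp
  next
    fix x y y' assume xy: "x < n" "y < n" "y' < n" "x \<noteq> y" "x \<noteq> y'" "col {x, y} = col {x, y'}"
    then have "sm {x, y} = sm {x, y'}" unfolding col_def by simp
    then have "\<iota> y = \<iota> y'" unfolding sm2[OF xy(4)] sm2[OF xy(5)] by simp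
    then show "y = y'" by (rule inj_onD[OF \<iota>(2)]) (simp_all add: xy)
  next
    fix S :: "nat graph set" and \<psi>
    assume S: "finite S" "card S = k"
      and \<psi>1: "\<forall>G\<in>S. inj_on (\<psi> G) (verts T) \<and> \<psi> G ` verts T \<subseteq> {..<n}"
      and \<psi>2: "\<forall>G\<in>S. \<forall>G'\<in>S. (G \<noteq> G' \<longrightarrow> \<psi> G ` verts T \<inter> \<psi> G' ` verts T = {}) \<and>
        (\<forall>e\<in>edges T. col (\<psi> G ` e) = col (\<psi> G' ` e))"
    have eT: "e \<subseteq> verts T" "card e = 2" if "e \<in> edges T" for e
      using that T(1) by (auto simp: finite_graph_def all_edges_def)
    have eTf: "finite e" if "e \<in> edges T" for e
      using eT(2)[OF that] by (intro card_ge_0_finite) simp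
    have finE: "finite (edges T)" using T(3) m by (intro card_ge_0_finite) simp
    have \<psi>inj: "inj_on (\<psi> G) (verts T)" and \<psi>ran: "\<psi> G ` verts T \<subseteq> {..<n}" if "G \<in> S" for G
      using bspec[OF \<psi>1 that] by simp_all
    define \<phi> where "\<phi> G u = \<iota> (\<psi> G u)" for G u
    have \<phi>V: "\<phi> G u \<in> V" if "G \<in> S" "u \<in> verts T" for G u
      using \<iota>(1) \<psi>ran[OF that(1)] that(2) unfolding \<phi>_def by blast
    have \<phi>eq: "\<psi> G u = \<psi> G' u'" if "G \<in> S" "G' \<in> S" "u \<in> verts T" "u' \<in> verts T" "\<phi> G u = \<phi> G' u'" for G G' u u'
      by (rule inj_onD[OF \<iota>(2) that(5)[unfolded \<phi>_def]])
        (use \<psi>ran[OF that(1)] \<psi>ran[OF that(2)] that(3,4) in blast)+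
    have \<psi>e: "\<psi> G ` e \<in> all_edges {..<n}" if G: "G \<in> S" and e: "e \<in> edges T" for G e
    proof -
      have "card (\<psi> G ` e) = 2"
        using card_image[OF inj_on_subset[OF \<psi>inj[OF G] eT(1)[OF e]]] eT(2)[OF e] by simp
      moreover have "\<psi> G ` e \<subseteq> {..<n}" using \<psi>ran[OF G] eT(1)[OF e] by blast
      ultimately show ?thesis unfolding all_edges_def by blast
    qed
    obtain r0 where r0: "r0 \<in> verts T" using T(2) unfolding connected_graph_def by blast
    \<comment> \<open>The orientation of a copy: for each edge of \<open>T\<close> the endpoint
      whose image enters the norm.\<close>
    define or where "or G = restrict (\<lambda>e. SOME u. u \<in> e \<and> \<psi> G u = Min (\<psi> G ` e)) (edges T)" for G
    have or: "or G e \<in> e \<and> \<psi> G (or G e) = Min (\<psi> G ` e)" if e: "e \<in> edges T" for G e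
    proof -
      have "Min (\<psi> G ` e) \<in> \<psi> G ` e" using eTf[OF e] eT(2)[OF e] by (intro Min_in) auto
      then obtain u where "u \<in> e \<and> \<psi> G u = Min (\<psi> G ` e)" by (metis imageE)
      then have "(SOME u. u \<in> e \<and> \<psi> G u = Min (\<psi> G ` e)) \<in> e \<and>
         \<psi> G (SOME u. u \<in> e \<and> \<psi> G u = Min (\<psi> G ` e)) = Min (\<psi> G ` e)" by (rule someI)
      then show ?thesis using e by (simp add: or_def)
    qed
    have "card S \<le> (m * (2 * m + 1)) ^ m * card (\<Pi>\<^sub>E e\<in>edges T. e)"
    proof (rule card_le_of_fibres[OF S(1), where f = or])
      show "finite (\<Pi>\<^sub>E e\<in>edges T. e)" using finE eTf by (rule finite_PiE)
      show "or ` S \<subseteq> (\<Pi>\<^sub>E e\<in>edges T. e)"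
      proof (rule image_subsetI, rule PiE_I)
        fix G e assume "e \<in> edges T"
        then show "or G e \<in> e" using or by blast
      qed (simp add: or_def)
      fix \<omega>
      define \<Phi> where "\<Phi> = {G \<in> S. or G = \<omega>}"
      have \<Phi>S: "G \<in> S" if "G \<in> \<Phi>" for G using that by (simp add: \<Phi>_def)
      show "card {G \<in> S. or G = \<omega>} \<le> (m * (2 * m + 1)) ^ m"
      proof (cases "\<Phi> = {}")
        case True
        then show ?thesis unfolding \<Phi>_def by (metis card.empty le0)
      next
        case False
        then obtain G0 where G0: "G0 \<in> \<Phi>" by blast
        define s where "s e = sm (\<psi> G0 ` e)" for e
        define t where "t e = snd (col (\<psi> G0 ` e))" for e
        have colG: "col (\<psi> G ` e) = (s e, t e)" if G: "G \<in> \<Phi>" and e: "e \<in> edges T" for G e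
        proof -
          have "col (\<psi> G ` e) = col (\<psi> G0 ` e)"
            using bspec[OF bspec[OF \<psi>2 \<Phi>S[OF G]] \<Phi>S[OF G0]] e by blast
          also have "\<dots> = (s e, t e)" unfolding s_def t_def col_def by simp
          finally show ?thesis .
        qed
        have sS: "s e \<in> Sums" if "e \<in> edges T" for e unfolding s_def by (rule smS[OF \<psi>e[OF \<Phi>S[OF G0] that]])
        have sum: "\<phi> G u + \<phi> G w = s {u, w}" if G: "G \<in> \<Phi>" and e: "{u, w} \<in> edges T" for G u w
        proof -
          have "u \<noteq> w" using eT(2)[OF e] by auto
          moreover have "u \<in> verts T" "w \<in> verts T" using eT(1)[OF e] by auto
          ultimately have "\<psi> G u \<noteq> \<psi> G w" using inj_onD[OF \<psi>inj[OF \<Phi>S[OF G]]] by blast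
          then have "sm (\<psi> G ` {u, w}) = \<phi> G u + \<phi> G w" by (simp add: sm2 \<phi>_def)
          moreover have "sm (\<psi> G ` {u, w}) = s {u, w}"
            using colG[OF G e] unfolding col_def prod.inject by (rule conjunct1)
          ultimately show ?thesis by simp
        qed
        have "\<forall>u\<in>verts T. \<exists>\<epsilon> d. (\<epsilon> = 1 \<or> \<epsilon> = - 1) \<and> d \<in> F \<and> (\<forall>G\<in>\<Phi>. \<phi> G u = \<epsilon> * (\<phi> G r0 + d))"
        proof
          fix u assume u: "u \<in> verts T"
          show "\<exists>\<epsilon> d. (\<epsilon> = 1 \<or> \<epsilon> = - 1) \<and> d \<in> F \<and> (\<forall>G\<in>\<Phi>. \<phi> G u = \<epsilon> * (\<phi> G r0 + d))"
          proof (rule ex_signed_translation[where \<Phi> = \<Phi> and \<phi> = \<phi> and s = s and A = F, OF T(2) r0 u T(1)])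
            fix G u w assume "G \<in> \<Phi>" "{u, w} \<in> edges T"
            then show "\<phi> G u + \<phi> G w = s {u, w}" by (rule sum)
          next
            fix e assume "e \<in> edges T"
            then show "s e \<in> F" using sS \<open>Sums \<subseteq> F\<close> by blast
          next
            fix x y assume "x \<in> F" "y \<in> F"
            then show "x - y \<in> F" by (rule F_diff)
          qed (rule F0)
        qed
        then obtain \<epsilon> d where \<epsilon>d: "\<forall>u\<in>verts T. (\<epsilon> u = 1 \<or> \<epsilon> u = - 1) \<and> d u \<in> F \<and> (\<forall>G\<in>\<Phi>. \<phi> G u = \<epsilon> u * (\<phi> G r0 + d u))"
          by metis
        have \<omega>: "\<omega> e \<in> e" "\<omega> e \<in> verts T" if e: "e \<in> edges T" for e
          using or[OF e, of G0] eT(1)[OF e] G0 unfolding \<Phi>_def by auto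
        define a where "a e = d (\<omega> e)" for e
        have \<phi>\<omega>: "\<phi> G (\<omega> e) = \<phi> G r0 + a e \<or> \<phi> G (\<omega> e) = - (\<phi> G r0 + a e)"
          if G: "G \<in> \<Phi>" and e: "e \<in> edges T" for G e
        proof -
          have "\<epsilon> (\<omega> e) = 1 \<or> \<epsilon> (\<omega> e) = - 1" "\<phi> G (\<omega> e) = \<epsilon> (\<omega> e) * (\<phi> G r0 + d (\<omega> e))"
            using bspec[OF \<epsilon>d \<omega>(2)[OF e]] G by blast+
          then show ?thesis unfolding a_def by auto
        qed
        have injr: "inj_on (\<lambda>G. \<phi> G r0) \<Phi>"
        proof (rule inj_onI)
          fix G G' assume G: "G \<in> \<Phi>" "G' \<in> \<Phi>" "\<phi> G r0 = \<phi> G' r0"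
          have "\<psi> G r0 = \<psi> G' r0" by (rule \<phi>eq[OF \<Phi>S[OF G(1)] \<Phi>S[OF G(2)] r0 r0 G(3)])
          then have "\<psi> G ` verts T \<inter> \<psi> G' ` verts T \<noteq> {}" using r0 by (metis disjoint_iff imageI)
          then show "G = G'" using bspec[OF bspec[OF \<psi>2 \<Phi>S[OF G(1)]] \<Phi>S[OF G(2)]] by blast
        qed
        have "card ((\<lambda>G. \<phi> G r0) ` \<Phi>) \<le> (m * (2 * m + 1)) ^ m"
        proof (rule card_norm_system_le[OF char finE T(3) m q, where a = a and g = "\<lambda>e. g (s e)" and t = t])
          fix e assume e: "e \<in> edges T"
          show "a e \<in> frob_field (q ^ m)" using bspec[OF \<epsilon>d \<omega>(2)[OF e]] unfolding a_def F_def by blast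
          have gs: "g (s e) \<in> NS" using g(1) sS[OF e] by blast
          then show "g (s e) \<in> frob_field (q ^ m)" by (simp add: NS_def F_def)
          show "x\<^sup>2 \<noteq> g (s e)" if "x \<in> frob_field (q ^ m)" for x
            using gs that unfolding NS_def F_def by blast
          fix x assume "x \<in> (\<lambda>G. \<phi> G r0) ` \<Phi>"
          then obtain G where G: "G \<in> \<Phi>" "x = \<phi> G r0" by blast
          have orG: "or G = \<omega>" using G(1) by (simp add: \<Phi>_def)
          have "\<iota> (Min (\<psi> G ` e)) = \<phi> G (\<omega> e)" using or[OF e, of G] unfolding orG \<phi>_def by simp
          then have sq: "(\<iota> (Min (\<psi> G ` e)))\<^sup>2 = (x + a e)\<^sup>2"
            using \<phi>\<omega>[OF G(1) e] unfolding G(2) by (metis power2_minus)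
          have "sm (\<psi> G ` e) = s e"
            "conj_norm q m ((\<iota> (Min (\<psi> G ` e)))\<^sup>2 - g (sm (\<psi> G ` e))) = t e"
            using colG[OF G(1) e] unfolding col_def prod.inject by blast+
          then show "conj_norm q m ((x + a e)\<^sup>2 - g (s e)) = t e" unfolding sq by simp
        next
          show "finite ((\<lambda>G. \<phi> G r0) ` \<Phi>)" using S(1) by (simp add: \<Phi>_def)
          \<comment> \<open>Different edges give different quadratics: equal shifts give the same
            oriented endpoint, as \<open>V\<close> has no opposite elements, and then equal sums
            give the same other endpoint.\<close>
          show "inj_on (\<lambda>e. (a e, g (s e))) (edges T)"
          proof (rule inj_onI)
            fix e e' assume e: "e \<in> edges T" "e' \<in> edges T" "(a e, g (s e)) = (a e', g (s e'))"
            have "a e = a e'" "g (s e) = g (s e')" using e(3) by simp_all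
            note aa = this(1)
            from inj_onD[OF g(2) \<open>g (s e) = g (s e')\<close> sS[OF e(1)] sS[OF e(2)]] have ss: "s e = s e'" .
            have \<phi>V0: "\<phi> G0 (\<omega> e) \<in> V" "\<phi> G0 (\<omega> e') \<in> V" using \<phi>V[OF \<Phi>S[OF G0]] \<omega>(2) e by blast+
            have "\<phi> G0 (\<omega> e) = \<phi> G0 (\<omega> e') \<or> \<phi> G0 (\<omega> e) = - \<phi> G0 (\<omega> e')"
              using \<phi>\<omega>[OF G0 e(1)] \<phi>\<omega>[OF G0 e(2)] unfolding aa by (elim disjE) simp_all
            then have "\<phi> G0 (\<omega> e) = \<phi> G0 (\<omega> e')" using V(3)[OF \<phi>V0] by blast
            then have "\<psi> G0 (\<omega> e) = \<psi> G0 (\<omega> e')"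
              by (rule \<phi>eq[OF \<Phi>S[OF G0] \<Phi>S[OF G0] \<omega>(2)[OF e(1)] \<omega>(2)[OF e(2)]])
            then have \<omega>eq: "\<omega> e = \<omega> e'"
              by (rule inj_onD[OF \<psi>inj[OF \<Phi>S[OF G0]] _ \<omega>(2)[OF e(1)] \<omega>(2)[OF e(2)]])
            define z where "z = \<omega> e"
            have z: "z \<in> e" "z \<in> e'" using \<omega>(1)[OF e(1)] \<omega>(1)[OF e(2)] unfolding z_def \<omega>eq[symmetric] .
            obtain w where w: "e = {z, w}" using ex_doubleton[OF eT(2)[OF e(1)] z(1)] ..
            obtain w' where w': "e' = {z, w'}" using ex_doubleton[OF eT(2)[OF e(2)] z(2)] ..
            have wT: "w \<in> verts T" "w' \<in> verts T" using eT(1)[OF e(1)] eT(1)[OF e(2)] unfolding w w' by simp_all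
            have "\<phi> G0 z + \<phi> G0 w = s e" using sum[OF G0 e(1)[unfolded w]] unfolding w .
            moreover have "\<phi> G0 z + \<phi> G0 w' = s e'" using sum[OF G0 e(2)[unfolded w']] unfolding w' .
            ultimately have "\<phi> G0 z + \<phi> G0 w = \<phi> G0 z + \<phi> G0 w'" unfolding ss by (rule trans[OF _ sym])
            then have "\<phi> G0 w = \<phi> G0 w'" by (rule add_left_imp_eq)
            then have "\<psi> G0 w = \<psi> G0 w'" by (rule \<phi>eq[OF \<Phi>S[OF G0] \<Phi>S[OF G0] wT])
            then have "w = w'" by (rule inj_onD[OF \<psi>inj[OF \<Phi>S[OF G0]] _ wT])
            then show "e = e'" unfolding w w' by (rule arg_cong)
          qed
        qed
        then have "card \<Phi> \<le> (m * (2 * m + 1)) ^ m" unfolding card_image[OF injr] .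
        then show ?thesis unfolding \<Phi>_def .
      qed
    qed
    also have "card (\<Pi>\<^sub>E e\<in>edges T. e) = 2 ^ m"
      using eT(2) T(3) finE by (simp add: card_PiE)
    finally show False using k S(2) by simp
  qed
  also have "\<dots> = q ^ Suc m" using F Fq by (simp add: card_cartesian_product)
  finally show ?thesis .
qed

section \<open>The colouring for three copies\<close>

text \<open>A grown tree with an edge has no isolated vertex, so the last leaf is attached to a
  vertex that already lies on an edge.\<close>

lemma grows_cherry:
  assumes "grows U F" "card F \<ge> 2"
  shows "\<exists>u v w. v \<noteq> w \<and> {u, v} \<in> F \<and> {u, w} \<in> F"
proof -
  have cover: "F = {} \<or> U \<subseteq> \<Union>F" if "grows U F" for U :: "'a set" and F
    using that
  proof (induction rule: grows.induct)
    case (extend U F u w)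
    show ?case
    proof (cases "F = {}")
      case True
      then have "card U = 1" using grows_facts[OF extend.hyps(1)] by simp
      then have "U = {u}" using extend.hyps(2) by (metis card_1_singletonE singletonD)
      then show ?thesis by auto
    qed (use extend in auto)
  qed simp
  from assms(1) show ?thesis
  proof cases
    case (single v)
    then show ?thesis using assms(2) by simp
  next
    case (extend U' F' u w)
    have "F' \<noteq> {}" using assms(2) unfolding extend(2) by auto
    then obtain e where e: "e \<in> F'" "u \<in> e" using cover[OF extend(3)] extend(4) by blast
    have "card e = 2" "e \<subseteq> U'" using e(1) grows_facts[OF extend(3)] by (auto simp: all_edges_def)
    then obtain v where v: "e = {u, v}" "v \<in> U'" using e(2) unfolding card_2_iff by blast
    have "v \<noteq> w" using v(2) extend(5) by blast
    then show ?thesis using e(1) unfolding v(1) extend(2) by blast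
  qed
qed

text \<open>For a cherry, the two sums and two norms of differences confine the image of its centre
  to at most two values, but three disjoint copies have three different centres.\<close>

lemma repeat_number_3_le:
  fixes T :: "'a graph"
  assumes char: "CHAR('k::alg_closed_field) = 3"
    and T: "is_tree T" "card (edges T) \<ge> 2"
    and r: "r \<ge> 1" and q: "q = 3 ^ r" and n: "n \<le> q\<^sup>2"
  shows "repeat_number 3 n T \<le> q ^ 3"
proof -
  have fgT: "finite_graph T" using T(1) by (simp add: is_tree_def)
  define F where "F = (frob_field (q\<^sup>2) :: 'k set)"
  have qm: "q\<^sup>2 = 3 ^ (r * 2)" by (simp only: q power_mult)
  have rm: "r * 2 \<ge> 1" using r by simp
  have F: "finite F" "card F = q\<^sup>2" unfolding F_def qm by (rule card_frob_field[OF char rm])+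
  have Fq: "finite (frob_field q :: 'k set)" "card (frob_field q :: 'k set) = q"
    unfolding q by (rule card_frob_field[OF char r])+
  have F_diff: "x - y \<in> F" if "x \<in> F" "y \<in> F" for x y
    using frob_field_closed(2)[OF char] that unfolding F_def qm .
  have F_add: "x + y \<in> F" if "x \<in> F" "y \<in> F" for x y
    using frob_field_closed(1)[OF char] that unfolding F_def qm .
  have "card {..<n} \<le> card F" using n F(2) by simp
  from card_le_inj[OF _ F(1) this] obtain \<iota> where \<iota>: "\<iota> ` {..<n} \<subseteq> F" "inj_on \<iota> {..<n}" by auto
  have \<iota>F: "\<iota> x \<in> F" if "x < n" for x using \<iota>(1) that by blast
  \<comment> \<open>As \<open>q\<close> is odd, this norm is even; \<open>Max\<close> and
    \<open>Min\<close> below merely pick an order of the two endpoints.\<close>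
  have N_neg: "conj_norm q 2 (- z) = conj_norm q 2 z" for z :: 'k
    by (simp add: conj_norm_def numeral_2_eq_2 q frobenius_minus)
  define sm where "sm e = (\<Sum>x\<in>e. \<iota> x)" for e
  define col where "col e = (sm e, conj_norm q 2 (\<iota> (Max e) - \<iota> (Min e)))" for e
  have sm2: "sm {x, y} = \<iota> x + \<iota> y" if "x \<noteq> y" for x y using that by (simp add: sm_def)
  have col2: "col {x, y} = (\<iota> x + \<iota> y, conj_norm q 2 (\<iota> x - \<iota> y))" if "x \<noteq> y" for x y
  proof -
    have "conj_norm q 2 (\<iota> (Max {x, y}) - \<iota> (Min {x, y})) = conj_norm q 2 (\<iota> x - \<iota> y)"
    proof (cases "x < y")
      case True
      then have "Max {x, y} = y" "Min {x, y} = x" by simp_all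
      then show ?thesis using N_neg[of "\<iota> x - \<iota> y"] by simp
    next
      case False
      then have "Max {x, y} = x" "Min {x, y} = y" by simp_all
      then show ?thesis by simp
    qed
    then show ?thesis unfolding col_def sm2[OF that] by simp
  qed
  have "repeat_number 3 n T \<le> card (F \<times> (frob_field q :: 'k set))"
  proof (rule repeat_number_le_card_colours[OF fgT, where col = col])
    show "finite (F \<times> (frob_field q :: 'k set))" using F Fq by simp
    fix e :: "nat set" assume e: "e \<in> all_edges {..<n}"
    then have "card e = 2" "e \<subseteq> {..<n}" by (auto simp: all_edges_def)
    then obtain x y where xy: "e = {x, y}" "x \<noteq> y" "x < n" "y < n" unfolding card_2_iff by blast
    have "conj_norm q 2 (\<iota> x - \<iota> y) \<in> frob_field q"
      using F_diff[OF \<iota>F[OF xy(3)] \<iota>F[OF xy(4)]] unfolding F_def by (rule conj_norm_in_frob_field)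
    moreover have "\<iota> x + \<iota> y \<in> F" by (rule F_add[OF \<iota>F[OF xy(3)] \<iota>F[OF xy(4)]])
    ultimately show "col e \<in> F \<times> frob_field q" unfolding xy(1) col2[OF xy(2)] by simp
  next
    fix x y y' assume xy: "x < n" "y < n" "y' < n" "x \<noteq> y" "x \<noteq> y'" "col {x, y} = col {x, y'}"
    then have "\<iota> y = \<iota> y'" unfolding col2[OF xy(4)] col2[OF xy(5)] by simp
    then show "y = y'" by (rule inj_onD[OF \<iota>(2)]) (simp_all add: xy)
  next
    fix S :: "nat graph set" and \<psi>
    assume S: "finite S" "card S = 3"
      and \<psi>1: "\<forall>G\<in>S. inj_on (\<psi> G) (verts T) \<and> \<psi> G ` verts T \<subseteq> {..<n}"
      and \<psi>2: "\<forall>G\<in>S. \<forall>G'\<in>S. (G \<noteq> G' \<longrightarrow> \<psi> G ` verts T \<inter> \<psi> G' ` verts T = {}) \<and>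
        (\<forall>e\<in>edges T. col (\<psi> G ` e) = col (\<psi> G' ` e))"
    obtain u v w where uvw: "v \<noteq> w" "{u, v} \<in> edges T" "{u, w} \<in> edges T"
      using grows_cherry[OF tree_grows[OF T(1)] T(2)] by blast
    have eT: "e \<subseteq> verts T" "card e = 2" if "e \<in> edges T" for e
      using that fgT by (auto simp: finite_graph_def all_edges_def)
    have vT: "u \<in> verts T" "v \<in> verts T" "w \<in> verts T" using eT(1)[OF uvw(2)] eT(1)[OF uvw(3)] by blast+
    have ne: "u \<noteq> v" "u \<noteq> w" using eT(2)[OF uvw(2)] eT(2)[OF uvw(3)] by auto
    have "S \<noteq> {}" using S(2) by auto
    then obtain G0 where G0: "G0 \<in> S" by blast
    have \<psi>inj: "inj_on (\<psi> G) (verts T)" and \<psi>ran: "\<psi> G ` verts T \<subseteq> {..<n}" if "G \<in> S" for G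
      using bspec[OF \<psi>1 that] by simp_all
    have less: "\<psi> G z < n" if "G \<in> S" "z \<in> verts T" for G z using \<psi>ran[OF that(1)] that(2) by blast
    have \<psi>ne: "\<psi> G x \<noteq> \<psi> G y" if "G \<in> S" "x \<in> verts T" "y \<in> verts T" "x \<noteq> y" for G x y
      using inj_onD[OF \<psi>inj[OF that(1)]] that(2-4) by blast
    have colG: "col {\<psi> G x, \<psi> G y} = col {\<psi> G0 x, \<psi> G0 y}" if G: "G \<in> S" and e: "{x, y} \<in> edges T" for G x y
    proof -
      have "col (\<psi> G ` {x, y}) = col (\<psi> G0 ` {x, y})" using bspec[OF bspec[OF \<psi>2 G] G0] e by blast
      then show ?thesis unfolding image_insert image_empty .
    qed
    define s1 where "s1 = \<iota> (\<psi> G0 u) + \<iota> (\<psi> G0 v)"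
    define s2 where "s2 = \<iota> (\<psi> G0 u) + \<iota> (\<psi> G0 w)"
    define C where "C = (\<lambda>G. \<iota> (\<psi> G u)) ` S"
    have norm: "conj_norm q 2 (2 * \<iota> (\<psi> G u) - (\<iota> (\<psi> G0 u) + \<iota> (\<psi> G0 y))) = conj_norm q 2 (\<iota> (\<psi> G0 u) - \<iota> (\<psi> G0 y))"
      if G: "G \<in> S" and y: "y \<in> verts T" "u \<noteq> y" "{u, y} \<in> edges T" for G y
    proof -
      have "\<iota> (\<psi> G u) + \<iota> (\<psi> G y) = \<iota> (\<psi> G0 u) + \<iota> (\<psi> G0 y) \<and>
        conj_norm q 2 (\<iota> (\<psi> G u) - \<iota> (\<psi> G y)) = conj_norm q 2 (\<iota> (\<psi> G0 u) - \<iota> (\<psi> G0 y))"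
        using colG[OF G y(3)]
        unfolding col2[OF \<psi>ne[OF G vT(1) y(1,2)]] col2[OF \<psi>ne[OF G0 vT(1) y(1,2)]] prod.inject .
      note eqs = this[THEN conjunct1] this[THEN conjunct2]
      have diff: "2 * \<iota> (\<psi> G u) - (\<iota> (\<psi> G0 u) + \<iota> (\<psi> G0 y)) = \<iota> (\<psi> G u) - \<iota> (\<psi> G y)"
        unfolding eqs(1)[symmetric] by simp
      show ?thesis unfolding diff by (rule eqs(2))
    qed
    have "card C \<le> 2"
    proof (rule card_cherry_centres_le[OF char q, of s1 s2])
      show "s1 \<in> frob_field (q\<^sup>2)" "s2 \<in> frob_field (q\<^sup>2)"
        unfolding s1_def s2_def F_def[symmetric] by (intro F_add \<iota>F less[OF G0] vT)+
      show "s1 \<noteq> s2"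
      proof
        assume "s1 = s2"
        then have "\<iota> (\<psi> G0 v) = \<iota> (\<psi> G0 w)" by (simp add: s1_def s2_def)
        then have "\<psi> G0 v = \<psi> G0 w" by (rule inj_onD[OF \<iota>(2)]) (simp_all add: less[OF G0] vT)
        then show False using \<psi>ne[OF G0 vT(2,3) uvw(1)] by contradiction
      qed
      show "C \<subseteq> frob_field (q\<^sup>2)" unfolding C_def F_def[symmetric] using \<iota>F less vT by blast
      fix x assume "x \<in> C"
      then obtain G where G: "G \<in> S" "x = \<iota> (\<psi> G u)" unfolding C_def by blast
      show "conj_norm q 2 (2 * x - s1) = conj_norm q 2 (\<iota> (\<psi> G0 u) - \<iota> (\<psi> G0 v))"
        unfolding G(2) s1_def by (rule norm[OF G(1) vT(2) ne(1) uvw(2)])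
      show "conj_norm q 2 (2 * x - s2) = conj_norm q 2 (\<iota> (\<psi> G0 u) - \<iota> (\<psi> G0 w))"
        unfolding G(2) s2_def by (rule norm[OF G(1) vT(3) ne(2) uvw(3)])
    qed
    moreover have "card C = card S"
      unfolding C_def
    proof (rule card_image, rule inj_onI)
      fix G G' assume G: "G \<in> S" "G' \<in> S" "\<iota> (\<psi> G u) = \<iota> (\<psi> G' u)"
      have "\<psi> G u = \<psi> G' u"
        by (rule inj_onD[OF \<iota>(2) G(3)]) (simp_all add: less[OF G(1) vT(1)] less[OF G(2) vT(1)])
      then have "\<psi> G ` verts T \<inter> \<psi> G' ` verts T \<noteq> {}" using vT(1) by (metis disjoint_iff imageI)
      then show "G = G'" using bspec[OF bspec[OF \<psi>2 G(1)] G(2)] by blast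
    qed
    ultimately show False using S(2) by simp
  qed simp
  also have "\<dots> = q ^ 3" using F Fq by (simp add: card_cartesian_product power3_eq_cube power2_eq_square)
  finally show ?thesis .
qed

section \<open>Choice of the field and upper growth rates\<close>

text \<open>Take the least \<open>r\<close> satisfying the first bound. It is not 0 because
  \<open>3 * n > 1\<close>, and failure at \<open>r - 1\<close> gives the second bound, as one step
  multiplies the power by \<open>3 ^ m\<close>.\<close>

lemma ex_power_of_three:
  fixes m n :: nat
  assumes "n \<ge> 1" "m \<ge> 1"
  shows "\<exists>r\<ge>1. 3 * n \<le> (3 ^ r) ^ m \<and> (3 ^ r) ^ m \<le> 3 ^ Suc m * n"
proof -
  define P where "P r \<longleftrightarrow> 3 * n \<le> (3 ^ r) ^ m" for r
  have "3 * n \<le> 3 ^ (3 * n)" using less_exp[of "3 * n"] power_mono[of "2::nat" 3 "3 * n"] by linarith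
  also have "\<dots> \<le> (3 ^ (3 * n)) ^ m" using assms(2) by (intro self_le_power) auto
  finally have ex: "P (3 * n)" unfolding P_def .
  define r where "r = (LEAST r. P r)"
  have Pr: "P r" unfolding r_def using ex by (rule LeastI)
  have "\<not> P 0" using assms(1) by (simp add: P_def)
  then have r0: "r \<noteq> 0" using Pr by metis
  then obtain r' where r': "r = Suc r'" by (cases r) auto
  have "\<not> P r'" using not_less_Least[of r' P] r' unfolding r_def by simp
  then have "(3 ^ r') ^ m \<le> 3 * n" by (simp add: P_def)
  then have "3 ^ m * (3 ^ r') ^ m \<le> 3 ^ m * (3 * n)" by (rule mult_le_mono2)
  then have "(3 ^ r) ^ m \<le> 3 ^ Suc m * n" by (simp add: r' power_mult_distrib mult_ac)
  then show ?thesis using Pr r0 unfolding P_def by (intro exI[of _ r]) auto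
qed

lemma bigo_powr_of_power_bound:
  fixes f :: "nat \<Rightarrow> nat"
  assumes b: "b \<ge> 1" and ev: "eventually (\<lambda>n. f n ^ b \<le> K * n ^ a) at_top"
  shows "(\<lambda>n. real (f n)) \<in> O(\<lambda>n. real n powr (real a / real b))"
proof (rule bigoI)
  define c where "c = (real K + 1) powr (1 / real b)"
  show "eventually (\<lambda>n. norm (real (f n)) \<le> c * norm (real n powr (real a / real b))) at_top"
    using ev eventually_gt_at_top[of 0]
  proof eventually_elim
    case (elim n)
    have "real (f n ^ b) \<le> real (K * n ^ a)" using elim(1) by (simp only: of_nat_le_iff)
    also have "\<dots> \<le> (real K + 1) * real n ^ a" by (simp add: algebra_simps)
    finally have "(real (f n) ^ b) powr (1 / real b) \<le> ((real K + 1) * real n ^ a) powr (1 / real b)"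
      by (intro powr_mono2) auto
    also have "(real (f n) ^ b) powr (1 / real b) = real (f n)"
    proof (cases "f n = 0")
      case True
      then show ?thesis using b by (simp add: power_0_left)
    next
      case False
      then show ?thesis using b by (simp add: powr_powr flip: powr_realpow)
    qed
    also have "((real K + 1) * real n ^ a) powr (1 / real b) = c * real n powr (real a / real b)"
      using elim(2) by (simp add: c_def powr_mult powr_powr flip: powr_realpow)
    finally show ?case by simp
  qed
qed

lemma repeat_number_bigo_size:
  fixes T :: "'a graph"
  assumes char: "CHAR('k::alg_closed_field) = 3"
    and T: "is_tree T" "card (edges T) = m" "m \<ge> 1" and k: "k > (m * (2 * m + 1)) ^ m * 2 ^ m"
  shows "(\<lambda>n. real (repeat_number k n T)) \<in> O(\<lambda>n. real n powr ((real m + 1) / real m))"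
proof -
  have "(\<lambda>n. real (repeat_number k n T)) \<in> O(\<lambda>n. real n powr (real (Suc m) / real m))"
  proof (rule bigo_powr_of_power_bound[OF T(3), where K = "(3 ^ Suc m) ^ Suc m"])
    show "eventually (\<lambda>n. repeat_number k n T ^ m \<le> (3 ^ Suc m) ^ Suc m * n ^ Suc m) at_top"
      using eventually_ge_at_top[of 1]
    proof eventually_elim
      case (elim n)
      obtain r where r: "r \<ge> 1" "3 * n \<le> (3 ^ r) ^ m" "(3 ^ r) ^ m \<le> 3 ^ Suc m * n"
        using ex_power_of_three[OF elim T(3)] by blast
      have "repeat_number k n T \<le> (3 ^ r) ^ Suc m"
        using T(1) by (intro repeat_number_le_power_size[OF char _ _ T(2,3) r(1) refl r(2) k]) (simp_all add: is_tree_def)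
      then have "repeat_number k n T ^ m \<le> ((3 ^ r) ^ Suc m) ^ m" by (rule power_mono) simp
      \<comment> \<open>Exchanging the exponents isolates \<open>(3 ^ r) ^ m\<close>, which is of
        order \<open>n\<close>.\<close>
      also have "\<dots> = ((3 ^ r) ^ m) ^ Suc m" by (simp only: power_mult[symmetric] mult_ac)
      also have "\<dots> \<le> (3 ^ Suc m * n) ^ Suc m" by (rule power_mono[OF r(3)]) simp
      finally show ?case by (simp only: power_mult_distrib)
    qed
  qed
  then show ?thesis by (simp add: add.commute)
qed

lemma repeat_number_3_bigo:
  fixes T :: "'a graph"
  assumes char: "CHAR('k::alg_closed_field) = 3" and T: "is_tree T" "card (edges T) \<ge> 2"
  shows "(\<lambda>n. real (repeat_number 3 n T)) \<in> O(\<lambda>n. real n powr (3 / 2))"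
proof -
  have "(\<lambda>n. real (repeat_number 3 n T)) \<in> O(\<lambda>n. real n powr (real 3 / real 2))"
  proof (rule bigo_powr_of_power_bound[where K = "(3 ^ 3) ^ 3"])
    show "eventually (\<lambda>n. repeat_number 3 n T ^ 2 \<le> (3 ^ 3) ^ 3 * n ^ 3) at_top"
      using eventually_ge_at_top[of 1]
    proof eventually_elim
      case (elim n)
      have "(2::nat) \<ge> 1" by simp
      from ex_power_of_three[OF elim this]
      obtain r where r: "r \<ge> 1" "3 * n \<le> (3 ^ r)\<^sup>2" "(3 ^ r)\<^sup>2 \<le> 3 ^ Suc 2 * n" by blast
      have "n \<le> (3 ^ r)\<^sup>2" using r(2) by simp
      then have "repeat_number 3 n T \<le> (3 ^ r) ^ 3" by (rule repeat_number_3_le[OF char T r(1) refl])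
      then have "repeat_number 3 n T ^ 2 \<le> ((3 ^ r) ^ 3) ^ 2" by (rule power_mono) simp
      also have "\<dots> = ((3 ^ r)\<^sup>2) ^ 3" by (simp only: power_mult[symmetric] mult_ac)
      also have "\<dots> \<le> (3 ^ Suc 2 * n) ^ 3" by (rule power_mono[OF r(3)]) simp
      also have "\<dots> = (3 ^ 3) ^ 3 * n ^ 3" unfolding power_mult_distrib by simp
      finally show ?case .
    qed
  qed simp
  then show ?thesis by simp
qed

text \<open>The algebraic closure of the field with three elements is a single type containing the fields
  with \<open>3^r\<close> elements for all \<open>r\<close>.\<close>

datatype three = Three0 | Three1 | Three2

lemma UNIV_three: "(UNIV :: three set) = {Three0, Three1, Three2}"
  using three.exhaust by auto

instance three :: prime_card
proof
  have "CARD(three) = 3"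
    unfolding UNIV_three by simp
  then show "prime CARD(three)" by simp
qed

lemma CHAR_closure_three: "CHAR(three mod_ring alg_closure) = 3"
  by (simp add: UNIV_three)

theorem theorem1p5:
  fixes T :: "'a graph" and m k :: nat
  assumes "is_tree T" and "card (edges T) = m" and "m \<ge> 1" and "k \<ge> 3"
  shows "((\<lambda>n. real (repeat_number k n T)) \<in> \<Omega>(\<lambda>n. real n powr (real k / (real k - 1))) \<and>
          (m \<ge> 2 \<longrightarrow> (\<lambda>n. real (repeat_number 3 n T)) \<in> \<Theta>(\<lambda>n. real n powr (3 / 2)))) \<and>
         ((\<lambda>n. real (repeat_number k n T)) \<in> \<Omega>(\<lambda>n. real n powr ((real m + 1) / real m)) \<and>
          (\<exists>k'\<ge>2. (\<lambda>n. real (repeat_number k' n T)) \<in> O(\<lambda>n. real n powr ((real m + 1) / real m))))"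
proof -
  have ne: "edges T \<noteq> {}" using assms(2,3) by auto
  have k: "k \<ge> 2" using assms(4) by simp
  have "(\<lambda>n. real (repeat_number 3 n T)) \<in> \<Theta>(\<lambda>n. real n powr (3 / 2))" if "m \<ge> 2"
  proof (rule bigthetaI)
    show "(\<lambda>n. real (repeat_number 3 n T)) \<in> O(\<lambda>n. real n powr (3 / 2))"
      using that assms(2) by (intro repeat_number_3_bigo[OF CHAR_closure_three assms(1)]) simp
    have "(\<lambda>n. real (repeat_number 3 n T)) \<in> \<Omega>(\<lambda>n. real n powr (real 3 / (real 3 - 1)))"
      by (rule repeat_number_bigomega_copies[OF assms(1) ne]) simp
    then show "(\<lambda>n. real (repeat_number 3 n T)) \<in> \<Omega>(\<lambda>n. real n powr (3 / 2))" by simp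
  qed
  moreover have "\<exists>k'\<ge>2. (\<lambda>n. real (repeat_number k' n T)) \<in> O(\<lambda>n. real n powr ((real m + 1) / real m))"
  proof (intro exI conjI)
    \<comment> \<open>One more than the bound on the number of disjoint copies with equal colours:
      solutions of a norm system times orientations.\<close>
    let ?k = "Suc ((m * (2 * m + 1)) ^ m * 2 ^ m)"
    have "(m * (2 * m + 1)) ^ m * 2 ^ m \<noteq> 0" using assms(3) by simp
    then show "?k \<ge> 2" by linarith
    show "(\<lambda>n. real (repeat_number ?k n T)) \<in> O(\<lambda>n. real n powr ((real m + 1) / real m))"
      by (rule repeat_number_bigo_size[OF CHAR_closure_three assms(1-3)]) simp
  qed
  ultimately show ?thesis
    using repeat_number_bigomega_copies[OF assms(1) ne k] repeat_number_bigomega_size[OF assms(1-3) k]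
    by blast
qed

end
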